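(* Let $p$ be a prime and let $G$ be a finite $p$-group of order $p^n$. Put $d=d(G)$, $\delta=d(G/Z(G))$, $k'=d(\gamma_2G/\gamma_3G)$, and let $|\gamma_2G|=p^k$. Let $r$ and $t$ be non-negative integers such that $\binom{\delta}{2}-k'=\binom{r}{2}+t$ with $0\le t<r$. Then \[|M(G)|\le p^{\frac{1}{2}(d-1)(n+k)-k(d-\delta)-\binom{\delta}{3}+\binom{r}{3}+\binom{t}{2}}.\]
   Context: For a finite group $H$, $d(H)$ denotes the minimal number of generators of $H$; $Z(G)$ is the center of $G$; $\gamma_iG$ is the $i$-th term of the lower central series ($\gamma_1G=G$, $\gamma_{i+1}G=[\gamma_iG,G]$); $M(G)$ is the Schur multiplier of $G$ (i.e. $H_2(G,\mathbb{Z})$). Binomial coefficients satisfy $\binom{a}{b}=0$ when $0\le a<b$. *)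

theory Defs
  imports "HOL-Algebra.Algebra"
begin

definition center :: "('a, 'b) monoid_scheme \<Rightarrow> 'a set" where
  "center G = {z \<in> carrier G. \<forall>g \<in> carrier G. z \<otimes>\<^bsub>G\<^esub> g = g \<otimes>\<^bsub>G\<^esub> z}"

definition comm_subgroup :: "('a, 'b) monoid_scheme \<Rightarrow> 'a set \<Rightarrow> 'a set \<Rightarrow> 'a set" where
  "comm_subgroup G A B = generate G (\<Union>a \<in> A. \<Union>b \<in> B.
      {a \<otimes>\<^bsub>G\<^esub> b \<otimes>\<^bsub>G\<^esub> inv\<^bsub>G\<^esub> a \<otimes>\<^bsub>G\<^esub> inv\<^bsub>G\<^esub> b})"

text \<open>Lower central series: gamma G 1 = G, gamma G (i+1) = [gamma G i, G].
  (gamma G 0 is also set to G; it is never used.)\<close>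
fun lcs :: "('a, 'b) monoid_scheme \<Rightarrow> nat \<Rightarrow> 'a set" where
  "lcs G 0 = carrier G"
| "lcs G (Suc 0) = carrier G"
| "lcs G (Suc (Suc i)) = comm_subgroup G (lcs G (Suc i)) (carrier G)"

definition min_gens :: "('a, 'b) monoid_scheme \<Rightarrow> nat" where
  "min_gens H = (LEAST n. \<exists>S. S \<subseteq> carrier H \<and> finite S \<and> card S = n
                               \<and> generate H S = carrier H)"

section \<open>Schur multiplier M(G) = H_2(G,Z) via the (inhomogeneous) bar complex\<close>

text \<open>Integral n-chains for n = 1,2,3: integer-valued functions on G^n with support in G^n.
  The boundary maps (trivial coefficients) are
    d2[g|h] = [h] - [gh] + [g],
    d3[g|h|k] = [h|k] - [gh|k] + [g|hk] - [g|h].\<close>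

definition chains2 :: "('a, 'b) monoid_scheme \<Rightarrow> ('a \<times> 'a \<Rightarrow> int) set" where
  "chains2 G = {c. \<forall>x. x \<notin> carrier G \<times> carrier G \<longrightarrow> c x = 0}"

definition chains3 :: "('a, 'b) monoid_scheme \<Rightarrow> ('a \<times> 'a \<times> 'a \<Rightarrow> int) set" where
  "chains3 G = {c. \<forall>x. x \<notin> carrier G \<times> carrier G \<times> carrier G \<longrightarrow> c x = 0}"

definition bar_d2 :: "('a, 'b) monoid_scheme \<Rightarrow> ('a \<times> 'a \<Rightarrow> int) \<Rightarrow> ('a \<Rightarrow> int)" where
  "bar_d2 G c = (\<lambda>x. \<Sum>(g,h) \<in> carrier G \<times> carrier G.
       c (g,h) * ((if h = x then 1 else 0) - (if g \<otimes>\<^bsub>G\<^esub> h = x then 1 else 0)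
                  + (if g = x then 1 else 0)))"

definition bar_d3 :: "('a, 'b) monoid_scheme \<Rightarrow> ('a \<times> 'a \<times> 'a \<Rightarrow> int) \<Rightarrow> ('a \<times> 'a \<Rightarrow> int)" where
  "bar_d3 G c = (\<lambda>x. \<Sum>(g,h,k) \<in> carrier G \<times> carrier G \<times> carrier G.
       c (g,h,k) * ((if (h,k) = x then 1 else 0)
                    - (if (g \<otimes>\<^bsub>G\<^esub> h, k) = x then 1 else 0)
                    + (if (g, h \<otimes>\<^bsub>G\<^esub> k) = x then 1 else 0)
                    - (if (g,h) = x then 1 else 0)))"

definition cycles2 :: "('a, 'b) monoid_scheme \<Rightarrow> ('a \<times> 'a \<Rightarrow> int) set" where
  "cycles2 G = {c \<in> chains2 G. bar_d2 G c = (\<lambda>_. 0)}"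

definition boundaries2 :: "('a, 'b) monoid_scheme \<Rightarrow> ('a \<times> 'a \<Rightarrow> int) set" where
  "boundaries2 G = bar_d3 G ` chains3 G"

definition schur_multiplier :: "('a, 'b) monoid_scheme \<Rightarrow> ('a \<times> 'a \<Rightarrow> int) set set" where
  "schur_multiplier G = (\<lambda>z. {y \<in> cycles2 G. (\<lambda>x. y x - z x) \<in> boundaries2 G}) ` cycles2 G"

definition schur_order :: "('a, 'b) monoid_scheme \<Rightarrow> nat" where
  "schur_order G = card (schur_multiplier G)"

end

theory Submission
  imports Defs "HOL-Library.Nat_Bijection"
begin

text \<open>Let \<open>E\<close> be the central extension of \<open>G\<close> by 2-chains modulo boundaries
  whose cocycle sends \<open>(g, h)\<close> to the class of \<open>[g|h]\<close>. Cycles die in the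
  abelianization of \<open>E\<close>, so \<open>M(G)\<close> embeds into the kernel of
  \<open>\<gamma>\<^sub>2E \<rightarrow> \<gamma>\<^sub>2G\<close> and \<open>|M(G)| |\<gamma>\<^sub>2G| \<le> |\<gamma>\<^sub>2E|\<close>.
  The commutator induces pairings \<open>\<gamma>\<^sub>iG \<times> G \<rightarrow> \<gamma>\<^bsub>i+1\<^esub>E / \<gamma>\<^bsub>i+2\<^esub>E\<close>
  that kill \<open>\<gamma>\<^bsub>i+1\<^esub>G\<close> and, for \<open>i \<ge> 2\<close>, also \<open>Z(G)\<close>. Hence
  \<open>\<gamma>\<^sub>2E / \<gamma>\<^sub>3E\<close> is at most as large as an exterior square of \<open>G / \<gamma>\<^sub>2G\<close>, and
  each later factor is a quotient of \<open>(\<gamma>\<^sub>iG / \<gamma>\<^bsub>i+1\<^esub>G)\<^sup>\<delta>\<close>. For \<open>i = 2\<close>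
  the Jacobi identity supplies further relations, one for each triple \<open>a < b < c < \<delta>\<close>.

  Call a pair \<open>{a, b}\<close> standard if \<open>[x\<^sub>a, x\<^sub>b]\<close> is not generated by the commutators of
  smaller pairs modulo \<open>\<gamma>\<^sub>3G\<close>. Standard pairs generate \<open>\<gamma>\<^sub>2G / \<gamma>\<^sub>3G\<close>, so there
  are at least \<open>k'\<close> of them, and every triple containing a standard pair yields a Jacobi relation
  independent of those of smaller triples. The other triples are the triangles of a graph with at most
  \<open>r(r-1)/2 + t\<close> edges, and Kruskal--Katona bounds their number.\<close>

section \<open>Triangles in graphs\<close>

text \<open>Instead, independence of relations only means that each lies outside the subgroup
  generated by the earlier ones, which in a p-group costs a factor of at least p; and the exterior
  square of G/gamma_2(G) is estimated by adjoining generators of decreasing relative order. E is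
  infinite, because a chain that is not a cycle has infinite order modulo boundaries. Finiteness of
  gamma_2(E) is therefore proved together with its bound, from the bottom of the lower central
  series upwards. Origin of the exponent: with s Jacobi relations, the squared order of
  gamma_2(E)/gamma_3(E) is at most p^((n-k)(d-1)), and the order of gamma_3(E) is at most p^(k delta
  - s), since the delta-th powers of the orders of gamma_i(G)/gamma_{i+1}(G) telescope. Dividing by
  p^k leaves (n-k)(d-1)/2 + k delta - k - s, which is at most the stated exponent once s is at least
  binom(delta,3) - binom(r,3) - binom(t,2).\<close>

lemma two_choose_two: "2 * int (n choose 2) = int n * (int n - 1)"
proof -
  have "even (n * (n - 1))" by (cases n) auto
  hence "2 * (n choose 2) = n * (n - 1)" by (simp add: choose_two)
  hence "int (2 * (n choose 2)) = int (n * (n - 1))" by presburger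
  thus ?thesis by (cases n) (auto simp: algebra_simps)
qed

lemma choose_two_add: "((u + v) choose 2) = (u choose 2) + (v choose 2) + u * (v::nat)"
proof -
  have "2 * int ((u + v) choose 2) = 2 * int ((u choose 2) + (v choose 2) + u * v)"
    using two_choose_two[of "u+v"] two_choose_two[of u] two_choose_two[of v]
    by (simp add: algebra_simps)
  hence "int ((u + v) choose 2) = int ((u choose 2) + (v choose 2) + u * v)" by simp
  thus ?thesis by (simp only: of_nat_eq_iff)
qed

definition triangles :: "'v set set \<Rightarrow> 'v set set" where
  "triangles N = {T. card T = 3 \<and> (\<forall>e. e \<subseteq> T \<and> card e = 2 \<longrightarrow> e \<in> N)}"

lemma triangles_subset_vertices:
  assumes "T \<in> triangles N" shows "T \<subseteq> \<Union>N"
proof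
  fix v assume v: "v \<in> T"
  have "card (T - {v}) = 2" using assms v by (simp add: triangles_def)
  then obtain w where w: "w \<in> T - {v}"
    by (metis all_not_in_conv card.empty zero_neq_numeral)
  hence "{v, w} \<in> N" using assms v by (auto simp: triangles_def)
  thus "v \<in> \<Union>N" by blast
qed

text \<open>A triangle through \<open>v\<close> is the union of its two edges at \<open>v\<close>,
  so the pairs of edges at \<open>v\<close> cover all these triangles.\<close>

lemma card_triangles_at_vertex:
  assumes "finite N"
  shows "finite {T \<in> triangles N. v \<in> T}"
    and "card {T \<in> triangles N. v \<in> T} \<le> card {e \<in> N. v \<in> e} choose 2"
proof -
  let ?D = "{e \<in> N. v \<in> e}"
  let ?S = "{S. S \<subseteq> ?D \<and> card S = 2}"
  have fD: "finite ?D" using assms by simp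
  have sub: "{T \<in> triangles N. v \<in> T} \<subseteq> Union ` ?S"
  proof
    fix T assume T: "T \<in> {T \<in> triangles N. v \<in> T}"
    hence "card (T - {v}) = 2" by (simp add: triangles_def)
    then obtain a b where ab: "T - {v} = {a, b}" "a \<noteq> b" by (auto simp: card_2_iff)
    hence T2: "T = {v, a, b}" and ne: "a \<noteq> v" "b \<noteq> v" using T by auto
    have "{v, a} \<in> N" "{v, b} \<in> N" using T T2 ne by (auto simp: triangles_def)
    moreover have "{v, a} \<noteq> {v, b}" using ab ne by (auto simp: doubleton_eq_iff)
    ultimately have "{{v,a},{v,b}} \<in> ?S" by auto
    moreover have "T = \<Union>{{v,a},{v,b}}" using T2 by auto
    ultimately show "T \<in> Union ` ?S" by blast
  qed
  have fS: "finite ?S" using fD by simp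
  show "finite {T \<in> triangles N. v \<in> T}" using sub fS finite_surj by blast
  have "card {T \<in> triangles N. v \<in> T} \<le> card ?S" using sub fS surj_card_le by blast
  thus "card {T \<in> triangles N. v \<in> T} \<le> card ?D choose 2" using n_subsets[OF fD] by simp
qed

text \<open>Otherwise every vertex on an edge has degree at least r. Such a vertex and its
  neighbours are r + 1 vertices, and the degree sum forces at least r(r+1)/2 = binom(r,2) + r edges,
  beyond the allowed binom(r,2) + t.\<close>

lemma exists_low_degree:
  assumes fin: "finite N" and two: "\<And>e. e \<in> N \<Longrightarrow> card e = 2" and ne: "N \<noteq> {}"
    and le: "card N \<le> (r choose 2) + t" and tr: "t < r"
  shows "\<exists>v. 0 < card {e \<in> N. v \<in> e} \<and> card {e \<in> N. v \<in> e} < r"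
proof (rule ccontr)
  assume "\<not> ?thesis"
  hence big: "\<And>v. 0 < card {e \<in> N. v \<in> e} \<Longrightarrow> r \<le> card {e \<in> N. v \<in> e}" by (meson not_le)
  let ?V = "\<Union>N"
  have finV: "finite ?V" using fin two by (intro finite_Union) (auto intro: card_ge_0_finite)
  have deg: "r \<le> card {e \<in> N. v \<in> e}" if "v \<in> ?V" for v
    using that fin by (intro big) (auto simp: card_gt_0_iff)
  obtain e where "e \<in> N" using ne by auto
  moreover obtain v where "v \<in> e" using two[OF \<open>e \<in> N\<close>] by fastforce
  ultimately have v: "v \<in> ?V" by auto
  have "{e \<in> N. v \<in> e} \<subseteq> (\<lambda>w. {v, w}) ` (?V - {v})"
  proof
    fix f assume f: "f \<in> {e \<in> N. v \<in> e}"
    hence "card f = 2" using two by auto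
    then obtain w where "f = {v, w}" "w \<noteq> v" using f by (auto simp: card_2_iff)
    thus "f \<in> (\<lambda>w. {v, w}) ` (?V - {v})" using f by auto
  qed
  hence "card {e \<in> N. v \<in> e} \<le> card (?V - {v})" using finV surj_card_le by blast
  hence "r \<le> card (?V - {v})" using deg[OF v] by linarith
  moreover have "card (?V - {v}) + 1 = card ?V"
    using card_Suc_Diff1[OF finV v] by simp
  ultimately have rV: "r + 1 \<le> card ?V" by linarith
  have "(\<Sum>v\<in>?V. card {e \<in> N. v \<in> e}) = (\<Sum>v\<in>?V. \<Sum>e\<in>N. if v \<in> e then 1 else 0)"
    using fin by (intro sum.cong refl) (simp add: sum.If_cases Int_def)
  also have "\<dots> = (\<Sum>e\<in>N. \<Sum>v\<in>?V. if v \<in> e then 1 else 0)" by (rule sum.swap)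
  also have "\<dots> = (\<Sum>e\<in>N. card e)"
  proof (intro sum.cong refl)
    fix e assume "e \<in> N"
    hence "{v \<in> ?V. v \<in> e} = e" by auto
    thus "(\<Sum>v\<in>?V. if v \<in> e then 1 else 0) = card e"
      using finV by (simp add: sum.If_cases Int_def)
  qed
  also have "\<dots> = 2 * card N" using two by simp
  finally have "(\<Sum>v\<in>?V. card {e \<in> N. v \<in> e}) = 2 * card N" .
  moreover have "(\<Sum>v\<in>?V. card {e \<in> N. v \<in> e}) \<ge> (\<Sum>v\<in>?V. r)" by (intro sum_mono deg)
  ultimately have "card ?V * r \<le> 2 * card N" by simp
  moreover have "(r + 1) * r \<le> card ?V * r" using rV by (rule mult_le_mono1)
  moreover have "2 * card N \<le> 2 * ((r choose 2) + t)" using le by simp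
  ultimately have "(r + 1) * r \<le> 2 * ((r choose 2) + t)" by (meson order_trans)
  hence "int ((r + 1) * r) \<le> int (2 * ((r choose 2) + t))" by (simp only: of_nat_le_iff)
  thus False using two_choose_two[of r] tr by (simp add: algebra_simps)
qed

text \<open>The Kruskal--Katona theorem for the shadow from triangles to edges, by deleting a vertex of
  small positive degree.\<close>

lemma card_triangles_le:
  fixes N :: "'v set set"
  assumes "finite N" "\<And>e. e \<in> N \<Longrightarrow> card e = 2" "card N \<le> (r choose 2) + t" "t < r"
  shows "finite (triangles N) \<and> card (triangles N) \<le> (r choose 3) + (t choose 2)"
  using assms
proof (induction "card N" arbitrary: N r t rule: less_induct)
  case less
  show ?case
  proof (cases "N = {}")
    case True
    have "triangles N = {}"
    proof (rule ccontr)
      assume "triangles N \<noteq> {}"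
      then obtain T where T: "T \<in> triangles N" by auto
      hence "T = {}" using triangles_subset_vertices[OF T] True by simp
      thus False using T by (simp add: triangles_def)
    qed
    thus ?thesis by simp
  next
    case False
    obtain v where v: "0 < card {e \<in> N. v \<in> e}" "card {e \<in> N. v \<in> e} < r"
      using exists_low_degree[OF less.prems(1,2) False less.prems(3,4)] by auto
    define D where "D = card {e \<in> N. v \<in> e}"
    define M where "M = {e \<in> N. v \<notin> e}"
    have finM: "finite M" using less.prems(1) by (simp add: M_def)
    have "N = {e \<in> N. v \<in> e} \<union> M" by (auto simp: M_def)
    hence cN: "card N = D + card M"
      using card_Un_disjoint[of "{e \<in> N. v \<in> e}" M] less.prems(1) finM by (auto simp: D_def M_def)
    have sub: "triangles N \<subseteq> {T \<in> triangles N. v \<in> T} \<union> triangles M"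
      by (auto simp: triangles_def M_def)
    have M2: "\<And>e. e \<in> M \<Longrightarrow> card e = 2" using less.prems(2) by (simp add: M_def)
    have MN: "card M < card N" using cN v by (simp add: D_def)
    \<comment> \<open>Deleting \<open>v\<close> costs D edges and at most binom(D,2) triangles. New
      parameters for the smaller graph have to be chosen so that both contributions stay within the
      bound.\<close>
    have key: "finite (triangles M) \<and> (D choose 2) + card (triangles M) \<le> (r choose 3) + (t choose 2)"
    proof (cases "D \<le> t")
      case True
      have "card M \<le> (r choose 2) + (t - D)" using cN less.prems(3) True by linarith
      hence "finite (triangles M) \<and> card (triangles M) \<le> (r choose 3) + ((t - D) choose 2)"
        using less.hyps[OF MN finM M2] less.prems(4) by simp
      moreover have "(D choose 2) + ((t - D) choose 2) \<le> t choose 2"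
        using choose_two_add[of D "t - D"] True by simp
      ultimately show ?thesis by linarith
    next
      case False
      define a where "a = r - 1"
      have r: "r = Suc a" using less.prems(4) by (simp add: a_def)
      \<comment> \<open>As binom(r,2) = binom(a,2) + a, losing D edges leaves at most binom(a,2) + E
        of them; D > t makes E < a, so the pair (a, E) is again admissible.\<close>
      define E where "E = a + t - D"
      have DE: "D \<le> a" "E < a" using v False r by (auto simp: D_def[symmetric] E_def)
      have r2: "(r choose 2) = (a choose 2) + a" unfolding r numeral_2_eq_2 by simp
      have r3: "(r choose 3) = (a choose 3) + (a choose 2)"
        unfolding r numeral_3_eq_3 numeral_2_eq_2 by simp
      have "card M \<le> (a choose 2) + E" using cN less.prems(3) DE r2 by (simp add: E_def)
      hence IH: "finite (triangles M) \<and> card (triangles M) \<le> (a choose 3) + (E choose 2)"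
        using less.hyps[OF MN finM M2] DE by simp
      \<comment> \<open>D and E lie between t and a, and D + E = a + t. Convexity of binom(-,2)
        gives the inequality below, with slack u * w.\<close>
      define u where "u = D - t"
      define w where "w = E - t"
      have "D = t + u" "E = t + w" "a = t + (u + w)"
        using False DE r by (auto simp: u_def w_def E_def)
      hence "(D choose 2) + (E choose 2) \<le> (a choose 2) + (t choose 2)"
        by (simp add: choose_two_add algebra_simps)
      thus ?thesis using IH r3 by linarith
    qed
    have "finite (triangles N)"
      using sub key card_triangles_at_vertex(1)[OF less.prems(1)] by (meson finite_Un finite_subset)
    moreover have "card (triangles N) \<le> card {T \<in> triangles N. v \<in> T} + card (triangles M)"
      using sub key card_triangles_at_vertex(1)[OF less.prems(1)]
      by (meson card_Un_le card_mono dual_order.trans finite_UnI)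
    ultimately show ?thesis using key card_triangles_at_vertex(2)[OF less.prems(1), of v]
      by (simp add: D_def)
  qed
qed

section \<open>Commutators and the lower central series\<close>

definition commutator :: "('a, 'b) monoid_scheme \<Rightarrow> 'a \<Rightarrow> 'a \<Rightarrow> 'a" where
  "commutator G x y = x \<otimes>\<^bsub>G\<^esub> y \<otimes>\<^bsub>G\<^esub> inv\<^bsub>G\<^esub> x \<otimes>\<^bsub>G\<^esub> inv\<^bsub>G\<^esub> y"

context group
begin

lemma inv_mult_cancel: "x \<in> carrier G \<Longrightarrow> y \<in> carrier G \<Longrightarrow> inv x \<otimes> (x \<otimes> y) = y"
  by (simp add: m_assoc[symmetric])

lemma mult_inv_cancel: "x \<in> carrier G \<Longrightarrow> y \<in> carrier G \<Longrightarrow> x \<otimes> (inv x \<otimes> y) = y"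
  by (simp add: m_assoc[symmetric])

lemmas word_simps = m_assoc inv_mult_group inv_mult_cancel mult_inv_cancel

lemma commutator_closed [simp, intro]:
  "x \<in> carrier G \<Longrightarrow> y \<in> carrier G \<Longrightarrow> commutator G x y \<in> carrier G"
  by (simp add: commutator_def)

lemma inv_commutator:
  "x \<in> carrier G \<Longrightarrow> y \<in> carrier G \<Longrightarrow> inv (commutator G x y) = commutator G y x"
  by (simp add: commutator_def word_simps)

lemma commutator_self: "x \<in> carrier G \<Longrightarrow> commutator G x x = \<one>"
  by (simp add: commutator_def word_simps)

lemma commutator_mult_left:
  assumes "x \<in> carrier G" "x' \<in> carrier G" "y \<in> carrier G"
  shows "commutator G (x \<otimes> x') y = x \<otimes> commutator G x' y \<otimes> inv x \<otimes> commutator G x y"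
  using assms by (simp add: commutator_def word_simps)

lemma commutator_mult_right:
  assumes "x \<in> carrier G" "y \<in> carrier G" "y' \<in> carrier G"
  shows "commutator G x (y \<otimes> y') = commutator G x y \<otimes> (y \<otimes> commutator G x y' \<otimes> inv y)"
  using assms by (simp add: commutator_def word_simps)

lemma commutator_eq_one_iff:
  assumes "x \<in> carrier G" "y \<in> carrier G"
  shows "commutator G x y = \<one> \<longleftrightarrow> x \<otimes> y = y \<otimes> x"
proof
  assume "x \<otimes> y = y \<otimes> x"
  thus "commutator G x y = \<one>" using assms by (simp add: commutator_def word_simps)
next
  assume "commutator G x y = \<one>"
  hence "commutator G x y \<otimes> (y \<otimes> x) = y \<otimes> x" using assms by simp
  thus "x \<otimes> y = y \<otimes> x" using assms by (simp add: commutator_def word_simps)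
qed

lemma conj_commutator:
  assumes "x \<in> carrier G" "y \<in> carrier G" "g \<in> carrier G"
  shows "g \<otimes> commutator G x y \<otimes> inv g
    = commutator G (g \<otimes> x \<otimes> inv g) (g \<otimes> y \<otimes> inv g)"
  using assms by (simp add: commutator_def word_simps)

lemma center_subset: "center G \<subseteq> carrier G"
  by (auto simp: center_def)

lemma centerD: "z \<in> center G \<Longrightarrow> g \<in> carrier G \<Longrightarrow> z \<otimes> g = g \<otimes> z"
  by (auto simp: center_def)

lemma centerI: "z \<in> carrier G \<Longrightarrow> (\<And>g. g \<in> carrier G \<Longrightarrow> z \<otimes> g = g \<otimes> z) \<Longrightarrow> z \<in> center G"
  by (auto simp: center_def)

lemma center_subgroup: "subgroup (center G) G"
proof (rule subgroupI)
  show "center G \<subseteq> carrier G" by (rule center_subset)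
  have "\<one> \<in> center G" by (rule centerI) auto
  thus "center G \<noteq> {}" by auto
next
  fix a assume a: "a \<in> center G"
  hence aG: "a \<in> carrier G" using center_subset by auto
  show "inv a \<in> center G"
  proof (rule centerI)
    fix g assume g: "g \<in> carrier G"
    have "inv a \<otimes> g = inv a \<otimes> (g \<otimes> a) \<otimes> inv a" using aG g by (simp add: word_simps)
    also have "g \<otimes> a = a \<otimes> g" using centerD[OF a g] by simp
    finally show "inv a \<otimes> g = g \<otimes> inv a" using aG g by (simp add: word_simps)
  qed (use aG in simp)
next
  fix a b assume ab: "a \<in> center G" "b \<in> center G"
  hence c: "a \<in> carrier G" "b \<in> carrier G" using center_subset by auto
  show "a \<otimes> b \<in> center G"
  proof (rule centerI)
    fix g assume g: "g \<in> carrier G"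
    have "a \<otimes> b \<otimes> g = a \<otimes> (b \<otimes> g)" using c g by (simp add: m_assoc)
    also have "\<dots> = a \<otimes> g \<otimes> b" using centerD[OF ab(2) g] c g by (simp add: m_assoc)
    also have "\<dots> = g \<otimes> (a \<otimes> b)" using centerD[OF ab(1) g] c g by (simp add: m_assoc)
    finally show "a \<otimes> b \<otimes> g = g \<otimes> (a \<otimes> b)" .
  qed (use c in simp)
qed

lemma conj_center:
  assumes "z \<in> center G" "g \<in> carrier G"
  shows "g \<otimes> z \<otimes> inv g = z"
proof -
  have z: "z \<in> carrier G" using assms center_subset by auto
  have "g \<otimes> z = z \<otimes> g" using centerD[OF assms] by simp
  hence "g \<otimes> z \<otimes> inv g = z \<otimes> g \<otimes> inv g" by simp
  thus ?thesis using z assms(2) by (simp add: m_assoc)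
qed

lemma center_normal: "center G \<lhd> G"
  by (rule normal_invI[OF center_subgroup]) (simp add: conj_center)

lemma center_comm_group: "comm_group (G\<lparr>carrier := center G\<rparr>)"
proof -
  interpret Z: group "G\<lparr>carrier := center G\<rparr>"
    by (rule subgroup_imp_group[OF center_subgroup])
  show ?thesis using centerD center_subset
    by (intro Z.group_comm_groupI) auto
qed

lemma commutator_center_left:
  "z \<in> center G \<Longrightarrow> y \<in> carrier G \<Longrightarrow> commutator G z y = \<one>"
  using centerD[of z y] center_subset by (subst commutator_eq_one_iff) auto

text \<open>In [xx',y] = x[x',y]x^-1 [x,y] the conjugated factor is [x',y], so centrality is asked
  of that one; it then also moves past [x,y].\<close>

lemma commutator_hom_left:
  assumes "x \<in> carrier G" "x' \<in> carrier G" "y \<in> carrier G" "commutator G x' y \<in> center G"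
  shows "commutator G (x \<otimes> x') y = commutator G x y \<otimes> commutator G x' y"
  using centerD[OF assms(4), of "commutator G x y"] assms
  by (simp add: commutator_mult_left conj_center)

lemma commutator_hom_right:
  assumes "x \<in> carrier G" "y \<in> carrier G" "y' \<in> carrier G" "commutator G x y' \<in> center G"
  shows "commutator G x (y \<otimes> y') = commutator G x y \<otimes> commutator G x y'"
  using assms by (simp add: commutator_mult_right conj_center)

lemma comm_subgroup_eq:
  "comm_subgroup G A B = generate G (\<Union>a\<in>A. \<Union>b\<in>B. {commutator G a b})"
  by (simp add: comm_subgroup_def commutator_def)

lemma commutator_mem_comm_subgroup:
  "a \<in> A \<Longrightarrow> b \<in> B \<Longrightarrow> commutator G a b \<in> comm_subgroup G A B"
  unfolding comm_subgroup_eq by (rule generate.incl) blast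

lemma comm_subgroup_least:
  assumes "subgroup K G" "\<And>a b. a \<in> A \<Longrightarrow> b \<in> B \<Longrightarrow> commutator G a b \<in> K"
  shows "comm_subgroup G A B \<subseteq> K"
  unfolding comm_subgroup_eq by (rule generate_subgroup_incl) (use assms in auto)

lemma comm_subgroup_normal:
  assumes "N \<lhd> G"
  shows "comm_subgroup G N (carrier G) \<lhd> G"
  unfolding comm_subgroup_eq
proof (rule normal_generateI)
  interpret N: normal N G by fact
  show "(\<Union>a\<in>N. \<Union>b\<in>carrier G. {commutator G a b}) \<subseteq> carrier G" by auto
  fix h g assume "h \<in> (\<Union>a\<in>N. \<Union>b\<in>carrier G. {commutator G a b})" and g: "g \<in> carrier G"
  then obtain a b where ab: "a \<in> N" "b \<in> carrier G" "h = commutator G a b" by auto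
  have "g \<otimes> a \<otimes> inv g \<in> N" using ab g N.inv_op_closed2 by auto
  moreover have "g \<otimes> b \<otimes> inv g \<in> carrier G" using ab g by simp
  ultimately show "g \<otimes> h \<otimes> inv g \<in> (\<Union>a\<in>N. \<Union>b\<in>carrier G. {commutator G a b})"
    using ab g by (auto simp: conj_commutator)
qed

lemma lcs_Suc: "0 < i \<Longrightarrow> lcs G (Suc i) = comm_subgroup G (lcs G i) (carrier G)"
  by (cases i) auto

lemma lcs_normal: "lcs G i \<lhd> G"
proof (induction i)
  case 0 show ?case by (simp add: normal_self)
next
  case (Suc i)
  thus ?case by (cases "i = 0") (auto simp: normal_self lcs_Suc comm_subgroup_normal)
qed

lemma lcs_subgroup: "subgroup (lcs G i) G"
  using lcs_normal normal_imp_subgroup by blast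

lemma lcs_carrier: "lcs G i \<subseteq> carrier G"
  using lcs_subgroup subgroup.subset by blast

lemma commutator_lcs:
  "0 < i \<Longrightarrow> x \<in> lcs G i \<Longrightarrow> y \<in> carrier G \<Longrightarrow> commutator G x y \<in> lcs G (Suc i)"
  by (simp add: lcs_Suc commutator_mem_comm_subgroup)

lemma commutator_normal_mem:
  assumes "N \<lhd> G" "x \<in> N" "y \<in> carrier G"
  shows "commutator G x y \<in> N"
proof -
  interpret N: normal N G by fact
  have xG: "x \<in> carrier G" using assms by simp
  have "y \<otimes> inv x \<otimes> inv y \<in> N" using assms N.inv_op_closed2 by simp
  hence "x \<otimes> (y \<otimes> inv x \<otimes> inv y) \<in> N" using assms by simp
  thus ?thesis using xG assms by (simp add: commutator_def m_assoc)
qed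

lemma lcs_Suc_subset: "lcs G (Suc i) \<subseteq> lcs G i"
proof (cases "i = 0")
  case False
  hence "lcs G (Suc i) = comm_subgroup G (lcs G i) (carrier G)" by (simp add: lcs_Suc)
  also have "\<dots> \<subseteq> lcs G i"
    by (rule comm_subgroup_least[OF lcs_subgroup]) (rule commutator_normal_mem[OF lcs_normal])
  finally show ?thesis .
qed simp

lemma lcs_antimono: "i \<le> j \<Longrightarrow> lcs G j \<subseteq> lcs G i"
  by (induction rule: dec_induct) (use lcs_Suc_subset in auto)

end

context group_hom
begin

lemma hom_commutator:
  "x \<in> carrier G \<Longrightarrow> y \<in> carrier G \<Longrightarrow> h (commutator G x y) = commutator H (h x) (h y)"
  by (simp add: commutator_def)

lemma image_lcs:
  assumes surj: "h ` carrier G = carrier H"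
  shows "h ` lcs G i = lcs H i"
proof (induction i)
  case 0 show ?case using surj by simp
next
  case (Suc i)
  show ?case
  proof (cases "i = 0")
    case True thus ?thesis using surj by simp
  next
    case False
    have sub: "(\<Union>a\<in>lcs G i. \<Union>b\<in>carrier G. {commutator G a b}) \<subseteq> carrier G"
      using G.lcs_carrier by blast
    have "h ` (\<Union>a\<in>lcs G i. \<Union>b\<in>carrier G. {commutator G a b})
        = (\<Union>a\<in>lcs G i. \<Union>b\<in>carrier G. {h (commutator G a b)})"
      by (simp add: image_UN)
    also have "\<dots> = (\<Union>a\<in>lcs G i. \<Union>b\<in>carrier G. {commutator H (h a) (h b)})"
      using G.lcs_carrier[of i] by (intro SUP_cong refl) (simp add: hom_commutator subset_iff)
    also have "\<dots> = (\<Union>a\<in>lcs H i. \<Union>b\<in>carrier H. {commutator H a b})"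
      by (simp add: Suc.IH[symmetric] surj[symmetric])
    finally show ?thesis using generate_img[OF sub] False
      by (simp add: G.lcs_Suc H.lcs_Suc G.comm_subgroup_eq H.comm_subgroup_eq)
  qed
qed

end

section \<open>Orders of generated subgroups\<close>

text \<open>The fibres of \<open>h\<close> on \<open>S\<close> are translates of its kernel part.
  The ambient group may be infinite, so finiteness of \<open>S\<close> is a conclusion; this is how
  finiteness climbs the lower central series of E.\<close>

lemma (in group_hom) card_image_kernel:
  assumes S: "subgroup S G" and fin: "finite (h ` S)" "finite {x \<in> S. h x = \<one>\<^bsub>H\<^esub>}"
  shows "finite S" "card S = card (h ` S) * card {x \<in> S. h x = \<one>\<^bsub>H\<^esub>}"
proof -
  interpret S: subgroup S G by fact
  let ?K = "{x \<in> S. h x = \<one>\<^bsub>H\<^esub>}"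
  let ?F = "\<lambda>y. {x \<in> S. h x = y}"
  have bij: "bij_betw (\<lambda>k. k \<otimes> a) ?K (?F (h a))" if a: "a \<in> S" for a
  proof (rule bij_betw_byWitness[where f' = "\<lambda>x. x \<otimes> inv a"])
    show "\<forall>k\<in>?K. k \<otimes> a \<otimes> inv a = k" using a S.subset by (auto simp: G.m_assoc)
    show "\<forall>x\<in>?F (h a). x \<otimes> inv a \<otimes> a = x" using a S.subset by (auto simp: G.m_assoc)
    show "(\<lambda>k. k \<otimes> a) ` ?K \<subseteq> ?F (h a)"
    proof (rule image_subsetI)
      fix k assume "k \<in> ?K"
      thus "k \<otimes> a \<in> ?F (h a)" using a by simp
    qed
    show "(\<lambda>x. x \<otimes> inv a) ` ?F (h a) \<subseteq> ?K"
    proof (rule image_subsetI)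
      fix x assume "x \<in> ?F (h a)"
      thus "x \<otimes> inv a \<in> ?K" using a by simp
    qed
  qed
  have F: "finite (?F y)" "card (?F y) = card ?K" if y: "y \<in> h ` S" for y
  proof -
    obtain a where a: "a \<in> S" "y = h a" using y by auto
    show "finite (?F y)" using bij_betw_finite[OF bij[OF a(1)]] fin(2) a(2) by simp
    show "card (?F y) = card ?K" using bij_betw_same_card[OF bij[OF a(1)]] a(2) by simp
  qed
  have U: "S = (\<Union>y\<in>h ` S. ?F y)" by auto
  have "finite (\<Union>y\<in>h ` S. ?F y)" using fin(1) F(1) by (rule finite_UN_I)
  thus "finite S" using U by simp
  have "card S = card (\<Union>y\<in>h ` S. ?F y)" using U by simp
  also have "\<dots> = (\<Sum>y\<in>h ` S. card (?F y))"
    by (rule card_UN_disjoint) (use fin F in auto)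
  also have "\<dots> = card (h ` S) * card ?K" using F(2) by simp
  finally show "card S = card (h ` S) * card ?K" .
qed

context group
begin

lemma subgroup_card_dvd:
  assumes "subgroup H G" "subgroup K G" "H \<subseteq> K"
  shows "card H dvd card K"
proof -
  interpret K: group "G\<lparr>carrier := K\<rparr>" by (rule subgroup_imp_group[OF assms(2)])
  have "subgroup H (G\<lparr>carrier := K\<rparr>)" using subgroup_incl[OF assms] .
  from K.lagrange[OF this] have "card K = card (rcosets\<^bsub>G\<lparr>carrier := K\<rparr>\<^esub> H) * card H"
    by (simp add: order_def)
  thus ?thesis by simp
qed

text \<open>Substitute for counting linearly independent vectors: a step that enlarges the subgroup
  multiplies its order by a divisor of \<open>p ^ b\<close> other than 1, hence by at least
  \<open>p\<close>.\<close>

lemma card_subgroup_chain: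
  fixes J :: "nat \<Rightarrow> 'a"
  assumes fin: "finite (carrier G)" and p: "Factorial_Ring.prime p"
    and N: "subgroup N G" "card (carrier G) = p ^ b * card N"
    and J: "\<And>i. J i \<in> carrier G"
  shows "p ^ card {i. i < m \<and> J i \<notin> generate G (N \<union> J ` {..<i})} * card N
    \<le> card (generate G (N \<union> J ` {..<m}))"
proof (induction m)
  case 0
  have "generate G N = N" using generateI[OF N(1)] by blast
  thus ?case by simp
next
  case (Suc m)
  let ?H = "\<lambda>m. generate G (N \<union> J ` {..<m})"
  let ?F = "\<lambda>m. {i. i < m \<and> J i \<notin> ?H i}"
  have NG: "N \<subseteq> carrier G" using N(1) subgroup.subset by blast
  have sub: "N \<union> J ` {..<m} \<subseteq> carrier G" for m using NG J by auto
  have H: "subgroup (?H m) G" for m using generate_is_subgroup[OF sub] .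
  have finH: "finite (?H m)" for m using H subgroup.subset fin finite_subset by metis
  have "finite N" using NG fin finite_subset by blast
  hence cN: "card N > 0" using subgroup.one_closed[OF N(1)] by (auto simp: card_gt_0_iff)
  have mono: "?H m \<subseteq> ?H (Suc m)" by (rule mono_generate) auto
  show ?case
  proof (cases "J m \<in> ?H m")
    case True
    hence "?F (Suc m) = ?F m" by (auto simp: less_Suc_eq)
    thus ?thesis using Suc.IH card_mono[OF finH mono] by simp
  next
    case False
    hence "?F (Suc m) = insert m (?F m)" by (auto simp: less_Suc_eq)
    hence cF: "card (?F (Suc m)) = Suc (card (?F m))" by simp
    have "J m \<in> ?H (Suc m)" by (rule generate.incl) auto
    hence "?H m \<subset> ?H (Suc m)" using mono False by blast
    hence lt: "card (?H m) < card (?H (Suc m))" using finH psubset_card_mono by blast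
    have NH: "N \<subseteq> ?H m" by (auto intro: generate.incl)
    obtain u where u: "card (?H m) = card N * u"
      using subgroup_card_dvd[OF N(1) H NH] by auto
    obtain c where c: "card (?H (Suc m)) = card (?H m) * c"
      using subgroup_card_dvd[OF H H mono] by auto
    have "card (?H (Suc m)) dvd card (carrier G)"
      using subgroup_card_dvd[OF H subgroup_self] H subgroup.subset by blast
    hence "card N * (u * c) dvd card N * p ^ b" using u c N(2) by (simp add: mult.assoc mult.commute)
    hence "u * c dvd p ^ b" using cN by simp
    hence "c dvd p ^ b" using dvd_mult_right by blast
    then obtain j where j: "c = p ^ j" using divides_primepow_nat[OF p] by blast
    have "c > 1"
    proof (rule ccontr)
      assume "\<not> c > 1"
      hence "card (?H m) * c \<le> card (?H m) * 1" by (intro mult_le_mono) auto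
      thus False using lt c by simp
    qed
    hence "j \<noteq> 0" using j by (intro notI) simp
    hence "p ^ 1 \<le> p ^ j" using prime_gt_0_nat[OF p] by (intro power_increasing) auto
    hence "p \<le> c" using j by simp
    hence "p * (p ^ card (?F m) * card N) \<le> c * card (?H m)"
      using Suc.IH by (rule mult_le_mono)
    thus ?thesis using cF c by (simp add: mult.commute mult.left_commute)
  qed
qed

text \<open>The powers \<open>s [^] i\<close> with i < q lie in distinct cosets of \<open>A\<close>:
  a coincidence would put a positive power of \<open>s\<close> with exponent below q into
  \<open>A\<close>.\<close>

lemma card_generate_insert_ge:
  assumes fin: "finite (carrier G)" and A: "subgroup A G" and s: "s \<in> carrier G"
    and least: "\<And>e. 0 < e \<Longrightarrow> e < q \<Longrightarrow> s [^] (e::nat) \<notin> A"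
  shows "q * card A \<le> card (generate G (insert s A))"
proof -
  interpret A: subgroup A G by fact
  let ?A' = "generate G (insert s A)"
  have sub: "insert s A \<subseteq> carrier G" using s A.subset by auto
  interpret A': subgroup ?A' G by (rule generate_is_subgroup[OF sub])
  have sA: "s \<in> ?A'" "A \<subseteq> ?A'" by (auto intro: generate.incl)
  have pw: "s [^] (i::nat) \<in> ?A'" for i
    by (induction i) (use sA in auto)
  have inj1: "False" if "a \<in> A" "a' \<in> A" "i < j" "j < q" "a \<otimes> s [^] i = a' \<otimes> s [^] j"
    for a a' and i j :: nat
  proof -
    have aG: "a \<in> carrier G" "a' \<in> carrier G" using that by auto
    have "s [^] j = s [^] (j - i) \<otimes> s [^] i" using s that(3) by (simp add: nat_pow_mult)
    hence "a \<otimes> s [^] i = (a' \<otimes> s [^] (j - i)) \<otimes> s [^] i" using that(5) aG s by (simp add: m_assoc)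
    hence "a = a' \<otimes> s [^] (j - i)" using aG s by simp
    hence "s [^] (j - i) = inv a' \<otimes> a" using aG s by (simp add: inv_mult_cancel)
    hence "s [^] (j - i) \<in> A" using that by simp
    thus False using least[of "j - i"] that by simp
  qed
  have inj: "inj_on (\<lambda>(i, a). a \<otimes> s [^] (i::nat)) ({..<q} \<times> A)"
  proof (rule inj_onI)
    fix v w
    assume vw: "v \<in> {..<q} \<times> A" "w \<in> {..<q} \<times> A"
      "(\<lambda>(i, a). a \<otimes> s [^] (i::nat)) v = (\<lambda>(i, a). a \<otimes> s [^] (i::nat)) w"
    obtain i a j a' where ij: "v = (i, a)" "w = (j, a')" by (cases v, cases w) auto
    have h: "i < q" "a \<in> A" "j < q" "a' \<in> A" "a \<otimes> s [^] i = a' \<otimes> s [^] j"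
      using vw ij by auto
    have "i = j"
    proof (cases rule: linorder_cases[of i j])
      case less
      from inj1[OF h(2,4) less h(3,5)] show ?thesis ..
    next
      case greater
      from inj1[OF h(4,2) greater h(1) h(5)[symmetric]] show ?thesis ..
    qed
    moreover have "a = a'" using h \<open>i = j\<close> s by simp
    ultimately show "v = w" using ij by simp
  qed
  have "(\<lambda>(i, a). a \<otimes> s [^] (i::nat)) ` ({..<q} \<times> A) \<subseteq> ?A'"
    using pw sA by (auto intro: A'.m_closed)
  moreover have "finite ?A'" using A'.subset fin finite_subset by blast
  ultimately have "card ({..<q} \<times> A) \<le> card ?A'" using inj card_inj_on_le by blast
  thus ?thesis by (simp add: card_cartesian_product)
qed

end

context comm_group
begin

text \<open>By commutativity and because \<open>c [^] q\<close> lies in \<open>U\<close>, the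
  products of elements of \<open>U\<close> with \<open>c [^] i\<close>, i < q, already form a
  subgroup.\<close>

lemma card_generate_insert_le:
  assumes U: "subgroup U G" "finite U" and c: "c \<in> carrier G" "c [^] (q::nat) \<in> U" "0 < q"
  shows "finite (generate G (insert c U))" "card (generate G (insert c U)) \<le> card U * q"
proof -
  interpret U: subgroup U G by fact
  define R where "R = (\<lambda>(x, i). x \<otimes> c [^] (i::nat)) ` (U \<times> {..<q})"
  \<comment> \<open>Arbitrary exponents are reduced below q by absorbing \<open>c [^] q\<close> into
    the factor from \<open>U\<close>; products of two elements of \<open>R\<close> produce exponents
    up to 2q - 2.\<close>
  have R: "x \<otimes> c [^] i \<in> R" if "x \<in> U" for x and i :: nat
    using that
  proof (induction i arbitrary: x rule: less_induct)
    case (less i)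
    show ?case
    proof (cases "i < q")
      case True thus ?thesis using less by (auto simp: R_def)
    next
      case False
      hence "c [^] i = c [^] q \<otimes> c [^] (i - q)" using c by (simp add: nat_pow_mult)
      hence "x \<otimes> c [^] i = (x \<otimes> c [^] q) \<otimes> c [^] (i - q)"
        using less.prems c by (simp add: m_assoc)
      thus ?thesis using less.IH[of "i - q" "x \<otimes> c [^] q"] less.prems c False by simp
    qed
  qed
  have RE: "\<exists>x i. x \<in> U \<and> i < q \<and> a = x \<otimes> c [^] i" if "a \<in> R" for a
    using that by (auto simp: R_def)
  have "subgroup R G"
  proof (rule subgroupI)
    show "R \<subseteq> carrier G" using c by (auto simp: R_def)
    have "\<one> \<otimes> c [^] (0::nat) \<in> R" by (rule R) simp
    thus "R \<noteq> {}" by blast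
  next
    fix a assume "a \<in> R"
    obtain x i where a: "x \<in> U" "i < q" "a = x \<otimes> c [^] i" using RE[OF \<open>a \<in> R\<close>] by (elim exE conjE) (rule that)
    have xG: "x \<in> carrier G" using a by simp
    have "c [^] q = c [^] i \<otimes> c [^] (q - i)" using c a by (simp add: nat_pow_mult)
    hence e: "c [^] q \<otimes> inv (c [^] i) = c [^] (q - i)"
      using c m_comm[of "c [^] i" "c [^] (q - i)"] by (simp add: m_assoc)
    have "inv (c [^] i) = inv (c [^] q) \<otimes> (c [^] q \<otimes> inv (c [^] i))"
      using c by (simp add: inv_mult_cancel)
    hence e2: "inv (c [^] i) = inv (c [^] q) \<otimes> c [^] (q - i)" unfolding e .
    have "inv a = inv x \<otimes> inv (c [^] i)" using a xG c by (simp add: inv_mult)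
    also have "\<dots> = (inv x \<otimes> inv (c [^] q)) \<otimes> c [^] (q - i)"
      unfolding e2 using xG c by (simp add: m_assoc)
    finally have "inv a = (inv x \<otimes> inv (c [^] q)) \<otimes> c [^] (q - i)" .
    moreover have "inv x \<otimes> inv (c [^] q) \<in> U" using a(1) c(2) by simp
    hence "(inv x \<otimes> inv (c [^] q)) \<otimes> c [^] (q - i) \<in> R" by (rule R)
    ultimately show "inv a \<in> R" by (simp only:)
  next
    fix a b assume ab: "a \<in> R" "b \<in> R"
    obtain x i where a: "x \<in> U" "i < q" "a = x \<otimes> c [^] i" using RE[OF ab(1)] by (elim exE conjE) (rule that)
    obtain y j where b: "y \<in> U" "j < q" "b = y \<otimes> c [^] j" using RE[OF ab(2)] by (elim exE conjE) (rule that)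
    have xy: "x \<in> carrier G" "y \<in> carrier G" using a(1) b(1) by simp_all
    have cc: "c [^] i \<in> carrier G" "c [^] j \<in> carrier G" using c(1) by simp_all
    have "a \<otimes> b = (x \<otimes> y) \<otimes> (c [^] i \<otimes> c [^] j)"
      unfolding a(3) b(3) using xy cc by (simp only: m_ac m_closed)
    also have "c [^] i \<otimes> c [^] j = c [^] (i + j)" using c by (simp add: nat_pow_mult)
    finally have "a \<otimes> b = (x \<otimes> y) \<otimes> c [^] (i + j)" .
    moreover have "x \<otimes> y \<in> U" using a(1) b(1) by simp
    hence "(x \<otimes> y) \<otimes> c [^] (i + j) \<in> R" by (rule R)
    ultimately show "a \<otimes> b \<in> R" by (simp only:)
  qed
  moreover have "insert c U \<subseteq> R"
  proof -
    have "c \<in> R" using R[of \<one> 1] c by simp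
    moreover have "x \<in> R" if "x \<in> U" for x using R[of x 0] that by simp
    ultimately show ?thesis by blast
  qed
  ultimately have sub: "generate G (insert c U) \<subseteq> R" by (intro generate_subgroup_incl)
  have finR: "finite R" using U by (simp add: R_def)
  show "finite (generate G (insert c U))" using sub finR finite_subset by blast
  have "card (generate G (insert c U)) \<le> card R" using card_mono[OF finR sub] .
  also have "\<dots> \<le> card (U \<times> {..<q})" unfolding R_def by (rule card_image_le) (use U in simp)
  finally show "card (generate G (insert c U)) \<le> card U * q" by (simp add: card_cartesian_product)
qed

lemma card_generate_Un_le:
  assumes U: "subgroup U G" "finite U" and T: "finite T" and q: "0 < q"
    and c: "\<And>t. t \<in> T \<Longrightarrow> c t \<in> carrier G \<and> c t [^] (q::nat) \<in> U"
  shows "finite (generate G (U \<union> c ` T)) \<and> card (generate G (U \<union> c ` T)) \<le> card U * q ^ card T"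
  using T c
proof (induction T)
  case empty
  have "generate G U = U" using generateI[OF U(1)] by blast
  thus ?case using U by simp
next
  case (insert t T)
  have XG: "U \<subseteq> carrier G" using U subgroup.subset by blast
  let ?Y = "generate G (U \<union> c ` T)"
  have sub: "U \<union> c ` T \<subseteq> carrier G" using XG insert.prems by auto
  have Y: "subgroup ?Y G" by (rule generate_is_subgroup[OF sub])
  have IH: "finite ?Y" "card ?Y \<le> card U * q ^ card T" using insert by auto
  have t: "c t \<in> carrier G" "c t [^] q \<in> ?Y"
    using insert.prems by (auto intro: generate.incl)
  note Z = card_generate_insert_le[OF Y IH(1) t q]
  have "generate G (U \<union> c ` insert t T) \<subseteq> generate G (insert (c t) ?Y)"
    by (rule mono_generate) (auto intro: generate.incl)
  moreover have "card (generate G (insert (c t) ?Y)) \<le> card U * q ^ card (insert t T)"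
  proof -
    have "card (generate G (insert (c t) ?Y)) \<le> (card U * q ^ card T) * q"
      using Z(2) mult_le_mono1[OF IH(2), of q] by (rule order_trans)
    thus ?thesis using insert.hyps by (simp add: ac_simps)
  qed
  ultimately show ?case using Z(1) by (meson card_mono finite_subset order_trans)
qed

end

section \<open>Bihomomorphisms and alternating pairings\<close>

lemma generate_mem_subgroup:
  assumes "group G" "subgroup K G" "x \<in> generate G A" "A \<subseteq> K"
  shows "x \<in> K"
  using group.generate_subgroup_incl[OF assms(1,4,2)] assms(3) by blast

text \<open>A bimultiplicative map on subgroups takes the place of a homomorphism on a tensor
  product of factor groups. Nothing is divided out here: the subgroups to be ignored are recorded as
  radicals in the locales built on this one. The left argument ranges over \<open>H\<close> because
  it will be a term of the lower central series.\<close>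

locale bihom = G: group G + C: comm_group C
  for G :: "('a, 'b) monoid_scheme" (structure) and C :: "('c, 'd) monoid_scheme"
    and H :: "'a set" and B :: "'a \<Rightarrow> 'a \<Rightarrow> 'c" +
  assumes H: "subgroup H G"
    and B_closed [simp, intro]: "x \<in> H \<Longrightarrow> y \<in> carrier G \<Longrightarrow> B x y \<in> carrier C"
    and B_left: "x \<in> H \<Longrightarrow> x' \<in> H \<Longrightarrow> y \<in> carrier G \<Longrightarrow> B (x \<otimes> x') y = B x y \<otimes>\<^bsub>C\<^esub> B x' y"
    and B_right: "x \<in> H \<Longrightarrow> y \<in> carrier G \<Longrightarrow> y' \<in> carrier G \<Longrightarrow> B x (y \<otimes> y') = B x y \<otimes>\<^bsub>C\<^esub> B x y'"
begin

lemma B_hom_left: "y \<in> carrier G \<Longrightarrow> group_hom (G\<lparr>carrier := H\<rparr>) C (\<lambda>x. B x y)"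
  by (rule group_hom.intro[OF G.subgroup_imp_group[OF H] C.is_group])
    (auto simp: group_hom_axioms_def hom_def B_left)

lemma B_hom_right: "x \<in> H \<Longrightarrow> group_hom G C (B x)"
  by (rule group_hom.intro[OF G.is_group C.is_group])
    (auto simp: group_hom_axioms_def hom_def B_right)

lemma B_one_left [simp]: "y \<in> carrier G \<Longrightarrow> B \<one> y = \<one>\<^bsub>C\<^esub>"
  using group_hom.hom_one[OF B_hom_left] by simp

lemma B_one_right [simp]: "x \<in> H \<Longrightarrow> B x \<one> = \<one>\<^bsub>C\<^esub>"
  using group_hom.hom_one[OF B_hom_right] by simp

lemma B_inv_left: "x \<in> H \<Longrightarrow> y \<in> carrier G \<Longrightarrow> B (inv x) y = inv\<^bsub>C\<^esub> B x y"
  using group_hom.hom_inv[OF B_hom_left, of y x] G.m_inv_consistent[OF H] by simp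

lemma B_inv_right: "x \<in> H \<Longrightarrow> y \<in> carrier G \<Longrightarrow> B x (inv y) = inv\<^bsub>C\<^esub> B x y"
  using group_hom.hom_inv[OF B_hom_right] by simp

lemma B_pow_right: "x \<in> H \<Longrightarrow> y \<in> carrier G \<Longrightarrow> B x (y [^] (e::nat)) = B x y [^]\<^bsub>C\<^esub> e"
  using group_hom.hom_nat_pow[OF B_hom_right] by simp

lemma subgroup_right: 
  assumes K: "subgroup K C" and X: "Y \<subseteq> H"
  shows "subgroup {y \<in> carrier G. \<forall>x\<in>Y. B x y \<in> K} G"
proof -
  interpret K: subgroup K C by fact
  have YH: "\<And>x. x \<in> Y \<Longrightarrow> x \<in> H" using X by auto
  show ?thesis
    by (rule G.subgroupI) (auto simp: B_inv_right B_right YH intro!: exI[of _ \<one>])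
qed

lemma subgroup_left: 
  assumes K: "subgroup K C" and Y: "Y \<subseteq> carrier G"
  shows "subgroup {x \<in> H. \<forall>y\<in>Y. B x y \<in> K} G"
proof -
  interpret K: subgroup K C by fact
  interpret H: subgroup H G by (rule H)
  have YG: "\<And>y. y \<in> Y \<Longrightarrow> y \<in> carrier G" using Y by auto
  show ?thesis
    by (rule G.subgroupI) (auto simp: B_inv_left B_left YG intro!: exI[of _ \<one>])
qed

end

text \<open>Stands for an alternating pairing on G/L. It is used twice: with \<open>L\<close> the
  second lower central term, to bound gamma_2(E)/gamma_3(E), and with \<open>L\<close> the centre,
  to generate gamma_2(G) modulo gamma_3(G).\<close>

locale alternating = bihom G C "carrier G" B
  for G :: "('a, 'b) monoid_scheme" (structure) and C :: "('c, 'd) monoid_scheme"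
    and B :: "'a \<Rightarrow> 'a \<Rightarrow> 'c" +
  fixes L :: "'a set"
  assumes L: "subgroup L G"
    and alt: "x \<in> carrier G \<Longrightarrow> B x x = \<one>\<^bsub>C\<^esub>"
    and radical: "l \<in> L \<Longrightarrow> y \<in> carrier G \<Longrightarrow> B l y = \<one>\<^bsub>C\<^esub>"
    and fin: "finite (carrier G)"
begin

lemma antisym: "x \<in> carrier G \<Longrightarrow> y \<in> carrier G \<Longrightarrow> B y x = inv\<^bsub>C\<^esub> B x y"
proof -
  assume xy: "x \<in> carrier G" "y \<in> carrier G"
  have "\<one>\<^bsub>C\<^esub> = B (x \<otimes> y) (x \<otimes> y)" using xy alt by simp
  also have "\<dots> = B x y \<otimes>\<^bsub>C\<^esub> B y x" using xy by (simp add: B_left B_right alt[of x] alt[of y] C.m_comm)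
  finally show ?thesis using xy by (metis B_closed C.inv_equality C.m_comm)
qed

lemma radical_right: "l \<in> L \<Longrightarrow> y \<in> carrier G \<Longrightarrow> B y l = \<one>\<^bsub>C\<^esub>"
  using antisym[of l y] radical[of l y] subgroup.mem_carrier[OF L] by simp

abbreviation A where "A T \<equiv> generate G (L \<union> T)"
abbreviation W where "W T \<equiv> generate C ((\<lambda>(s, t). B s t) ` (T \<times> T))"

lemma W_sub: "T \<subseteq> carrier G \<Longrightarrow> (\<lambda>(s, t). B s t) ` (T \<times> T) \<subseteq> carrier C"
  by auto

lemma W_subgroup: "T \<subseteq> carrier G \<Longrightarrow> subgroup (W T) C"
  by (rule C.generate_is_subgroup[OF W_sub])

lemma A_subset: "T \<subseteq> carrier G \<Longrightarrow> L \<union> T \<subseteq> carrier G"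
  using L subgroup.subset by blast

lemma B_right_mem:
  assumes T: "T \<subseteq> carrier G" and t: "t \<in> T" and a: "a \<in> A T"
  shows "B t a \<in> W T"
proof -
  have "t \<in> carrier G" using T t by auto
  let ?K = "{y \<in> carrier G. \<forall>x\<in>{t}. B x y \<in> W T}"
  have "subgroup ?K G" using \<open>t \<in> carrier G\<close> by (intro subgroup_right W_subgroup T) auto
  moreover have "L \<union> T \<subseteq> ?K"
  proof
    fix y assume y: "y \<in> L \<union> T"
    have "B t y \<in> W T"
    proof (cases "y \<in> L")
      case True
      hence "B t y = \<one>\<^bsub>C\<^esub>" using \<open>t \<in> carrier G\<close> by (rule radical_right)
      thus ?thesis by (simp add: generate.one)
    next
      case False
      thus ?thesis using y t by (intro generate.incl) auto
    qed
    thus "y \<in> ?K" using y A_subset[OF T] by auto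
  qed
  ultimately have "a \<in> ?K" using generate_mem_subgroup[OF G.is_group _ a] by blast
  thus ?thesis by simp
qed

lemma B_mem:
  assumes T: "T \<subseteq> carrier G" and a: "a \<in> A T" "b \<in> A T"
  shows "B a b \<in> W T"
proof -
  have bG: "b \<in> carrier G" using G.generate_in_carrier[OF A_subset[OF T] a(2)] .
  let ?K = "{x \<in> carrier G. \<forall>y\<in>{b}. B x y \<in> W T}"
  have "subgroup ?K G" using bG by (intro subgroup_left W_subgroup T) auto
  moreover have "L \<union> T \<subseteq> ?K"
  proof
    fix y assume y: "y \<in> L \<union> T"
    have "B y b \<in> W T"
    proof (cases "y \<in> L")
      case True
      hence "B y b = \<one>\<^bsub>C\<^esub>" using bG by (rule radical)
      thus ?thesis by (simp add: generate.one)
    next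
      case False
      thus ?thesis using y a(2) by (intro B_right_mem[OF T]) auto
    qed
    thus "y \<in> ?K" using y A_subset[OF T] by auto
  qed
  ultimately have "a \<in> ?K" using generate_mem_subgroup[OF G.is_group _ a(1)] by blast
  thus ?thesis by simp
qed

text \<open>Greedy choice of the generators: at each step take the one of largest order modulo the
  subgroup generated so far. These orders decrease, which is what replaces the structure theorem for
  finite abelian groups.\<close>

lemma greedy:
  assumes S: "finite S" "S \<subseteq> carrier G" and m: "m \<le> card S"
  shows "\<exists>T q. T \<subseteq> S \<and> card T = m \<and> finite (W T)
    \<and> (card (W T))\<^sup>2 * card L ^ (m - 1) \<le> card (A T) ^ (m - 1)
    \<and> 0 < q \<and> q ^ m * card L \<le> card (A T)
    \<and> (\<forall>s\<in>S - T. \<exists>e::nat. 0 < e \<and> e \<le> q \<and> s [^] e \<in> A T)"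
  using m
proof (induction m)
  case 0
  have A0: "A {} = L" using G.generateI[OF L] by auto
  have "W {} = {\<one>\<^bsub>C\<^esub>}" using C.generate_empty by simp
  hence "finite (W {})" "card (W {}) = 1" by simp_all
  \<comment> \<open>Initial value of q: the group order is an exponent that annihilates every
    generator.\<close>
  moreover have "\<exists>e::nat. 0 < e \<and> e \<le> order G \<and> s [^] e \<in> A {}" if "s \<in> S" for s
  proof (intro exI conjI)
    show "0 < order G" using G.order_gt_0_iff_finite fin by simp
    have "s [^] order G = \<one>" using G.pow_order_eq_1 that S by auto
    thus "s [^] order G \<in> A {}" by (simp add: generate.one)
  qed simp
  moreover have "0 < order G" using G.order_gt_0_iff_finite fin by simp
  ultimately show ?case using A0 by (intro exI[of _ "{}"] exI[of _ "order G"]) simp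
next
  case (Suc m)
  then obtain T q where T: "T \<subseteq> S" "card T = m" "finite (W T)"
    and WT: "(card (W T))\<^sup>2 * card L ^ (m - 1) \<le> card (A T) ^ (m - 1)"
    and q: "0 < q" "q ^ m * card L \<le> card (A T)"
    and ord: "\<forall>s\<in>S - T. \<exists>e::nat. 0 < e \<and> e \<le> q \<and> s [^] e \<in> A T" by (meson Suc_leD)
  \<comment> \<open>The order of \<open>s\<close> modulo \<open>A T\<close>, which the invariant
    bounds by q for the generators not yet chosen.\<close>
  define o' where "o' s = (LEAST e::nat. 0 < e \<and> s [^] e \<in> A T)" for s
  have o': "0 < o' s" "s [^] o' s \<in> A T" "o' s \<le> q" if "s \<in> S - T" for s
  proof -
    obtain e :: nat where e: "0 < e" "e \<le> q" "s [^] e \<in> A T"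
      using bspec[OF ord \<open>s \<in> S - T\<close>] by (auto simp only:)
    hence "0 < o' s \<and> s [^] o' s \<in> A T"
      unfolding o'_def using LeastI[of "\<lambda>e. 0 < e \<and> s [^] e \<in> A T" e] by simp
    thus "0 < o' s" "s [^] o' s \<in> A T" by auto
    have "o' s \<le> e" unfolding o'_def by (rule Least_le) (use e in simp)
    thus "o' s \<le> q" using e by simp
  qed
  have ne: "S - T \<noteq> {}"
  proof
    assume "S - T = {}"
    hence "S = T" using T(1) by blast
    thus False using Suc.prems T(2) by simp
  qed
  have finD: "finite (S - T)" using S by simp
  obtain s where s: "s \<in> S - T" and smax: "\<And>s'. s' \<in> S - T \<Longrightarrow> o' s' \<le> o' s"
  proof -
    have "Max (o' ` (S - T)) \<in> o' ` (S - T)" using finD ne by (intro Max_in) auto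
    then obtain s where s: "s \<in> S - T" "o' s = Max (o' ` (S - T))" by auto
    show ?thesis by (rule that[OF s(1)]) (use s(2) finD in simp)
  qed
  define q' where "q' = o' s"
  define T' where "T' = insert s T"
  have q'q: "q' \<le> q" "0 < q'" using o'[OF s] by (auto simp: q'_def)
  have sG: "s \<in> carrier G" and TG: "T \<subseteq> carrier G" and T'G: "T' \<subseteq> carrier G"
    using S s T by (auto simp: T'_def)
  have finT: "finite T" using T S finite_subset by blast
  have cT': "card T' = Suc m" using T s finT by (simp add: T'_def)
  have AT: "subgroup (A T) G" by (rule G.generate_is_subgroup[OF A_subset[OF TG]])
  have "A T' = generate G (insert s (A T))"
  proof
    show "A T' \<subseteq> generate G (insert s (A T))"
      unfolding T'_def by (rule G.mono_generate) (auto intro: generate.incl)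
    have "A T \<subseteq> A T'" unfolding T'_def by (rule G.mono_generate) auto
    moreover have "s \<in> A T'" unfolding T'_def by (rule generate.incl) simp
    ultimately show "generate G (insert s (A T)) \<subseteq> A T'"
      by (intro G.generate_subgroup_incl G.generate_is_subgroup A_subset T'G) simp
  qed
  moreover have "s [^] e \<notin> A T" if "0 < e" "e < q'" for e :: nat
    using not_less_Least[of e "\<lambda>e. 0 < e \<and> s [^] e \<in> A T"] that by (auto simp: q'_def o'_def)
  ultimately have cA: "q' * card (A T) \<le> card (A T')"
    using G.card_generate_insert_ge[OF fin AT sG, of q'] by simp
  \<comment> \<open>\<open>B t s\<close> to the power q' is the value at t and
    \<open>s [^] q'\<close>, and the latter lies in \<open>A T\<close>. So each of the m new values
    has order at most q' modulo \<open>W T\<close>, and together they contribute at most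
    q'^m.\<close>
  have WTs: "B t s \<in> carrier C \<and> B t s [^]\<^bsub>C\<^esub> q' \<in> W T" if t: "t \<in> T" for t
  proof -
    have tG: "t \<in> carrier G" using t TG by auto
    have "B t s [^]\<^bsub>C\<^esub> q' = B t (s [^] q')" using tG sG by (simp add: B_pow_right)
    also have "\<dots> \<in> W T" using o'[OF s] t by (intro B_right_mem TG) (auto simp: q'_def)
    finally show ?thesis using tG sG by simp
  qed
  let ?V = "generate C (W T \<union> (\<lambda>t. B t s) ` T)"
  have V: "finite ?V" "card ?V \<le> card (W T) * q' ^ m"
    using C.card_generate_Un_le[OF W_subgroup[OF TG] T(3) finT q'q(2) WTs] T(2) by auto
  have Vsub: "subgroup ?V C"
    using WTs subgroup.subset[OF W_subgroup[OF TG]] by (intro C.generate_is_subgroup) auto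
  have "(\<lambda>(s, t). B s t) ` (T' \<times> T') \<subseteq> ?V"
  proof clarify
    fix t t' assume tt: "t \<in> T'" "t' \<in> T'"
    consider "t \<in> T" "t' \<in> T" | "t \<in> T" "t' = s" | "t = s" "t' \<in> T" | "t = s" "t' = s"
      using tt unfolding T'_def by blast
    thus "B t t' \<in> ?V"
    proof cases
      case 1 thus ?thesis by (intro generate.incl UnI1) auto
    next
      case 2 thus ?thesis by (intro generate.incl UnI2) auto
    next
      case 3
      hence "B t t' = inv\<^bsub>C\<^esub> B t' t" using sG TG by (intro antisym) auto
      thus ?thesis using 3 by (auto intro: generate.inv)
    next
      case 4 thus ?thesis using sG by (simp add: alt generate.one)
    qed
  qed
  hence W'V: "W T' \<subseteq> ?V" using Vsub by (rule C.generate_subgroup_incl)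
  have finW': "finite (W T')" using W'V V finite_subset by blast
  have cW': "card (W T') \<le> card (W T) * q' ^ m" using card_mono[OF V(1) W'V] V(2) by linarith
  \<comment> \<open>This is the point of the greedy order: q' does not exceed the previous maximum
    q, so the lower bound on \<open>card (A T)\<close> in terms of q also holds for q'.\<close>
  have qm: "q' ^ m * card L \<le> card (A T)"
    using q(2) power_mono[OF q'q(1), of m] by (meson le_trans mult_le_mono1 zero_le)
  have "(card (W T'))\<^sup>2 * card L ^ m \<le> card (A T') ^ m"
  proof (cases m)
    case 0
    have "(card (W T'))\<^sup>2 \<le> (card (W T))\<^sup>2" using cW' 0 by (intro power_mono) auto
    also have "\<dots> \<le> 1" using WT 0 by simp
    finally show ?thesis using 0 by simp
  next
    case (Suc j)
    \<comment> \<open>Squaring produces q'^m twice. One copy is absorbed together with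
      \<open>card L ^ m\<close> by means of \<open>qm\<close>; the other joins the m-th power of
      \<open>card (A T)\<close>, to which \<open>cA\<close> applies.\<close>
    have "(card (W T'))\<^sup>2 * card L ^ m \<le> (card (W T) * q' ^ m)\<^sup>2 * card L ^ m"
      using cW' by (intro mult_le_mono1 power_mono) auto
    also have "\<dots> = ((card (W T))\<^sup>2 * card L ^ (m - 1)) * (q' ^ m * (q' ^ m * card L))"
      using Suc by (simp add: power2_eq_square mult_ac)
    also have "\<dots> \<le> card (A T) ^ (m - 1) * (q' ^ m * card (A T))"
      using WT qm by (intro mult_le_mono le_refl)
    also have "\<dots> = (q' * card (A T)) ^ m" using Suc by (simp add: power_mult_distrib mult_ac)
    also have "\<dots> \<le> card (A T') ^ m" using cA by (rule power_mono) simp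
    finally show ?thesis .
  qed
  moreover have "q' ^ Suc m * card L \<le> card (A T')"
  proof -
    have "q' ^ Suc m * card L = q' * (q' ^ m * card L)" by simp
    also have "\<dots> \<le> q' * card (A T)" using qm by (rule mult_le_mono2)
    finally show ?thesis using cA by linarith
  qed
  moreover have "\<exists>e::nat. 0 < e \<and> e \<le> q' \<and> s' [^] e \<in> A T'" if "s' \<in> S - T'" for s'
  proof (intro exI conjI)
    have s': "s' \<in> S - T" using that by (auto simp: T'_def)
    show "0 < o' s'" using o'[OF s'] by simp
    show "o' s' \<le> q'" using smax[OF s'] by (simp add: q'_def)
    have "A T \<subseteq> A T'" unfolding T'_def by (rule G.mono_generate) auto
    thus "s' [^] o' s' \<in> A T'" using o'[OF s'] by auto
  qed
  moreover have "T' \<subseteq> S" using s T by (auto simp: T'_def)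
  ultimately show ?case using cT' finW' q'q(2)
    by (intro exI[of _ T'] exI[of _ q']) (simp only: diff_Suc_1, simp)
qed

text \<open>A greedy choice of \<open>card S\<close> elements exhausts \<open>S\<close>. The
  inequality is the estimate |G/L|^((d-1)/2) for an exterior square of G/L on d generators, squared
  and cleared of quotients.\<close>

lemma card_alternating_image:
  assumes S: "finite S" "S \<subseteq> carrier G" "A S = carrier G"
  shows "finite (W S)" "(card (W S))\<^sup>2 * card L ^ (card S - 1) \<le> card (carrier G) ^ (card S - 1)"
    and "x \<in> carrier G \<Longrightarrow> y \<in> carrier G \<Longrightarrow> B x y \<in> W S"
proof -
  obtain T where T: "T \<subseteq> S" "card T = card S" "finite (W T)"
     "(card (W T))\<^sup>2 * card L ^ (card S - 1) \<le> card (A T) ^ (card S - 1)"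
    using greedy[OF S(1,2) le_refl] by blast
  have "T = S" using T S(1) card_subset_eq by blast
  thus "finite (W S)" "(card (W S))\<^sup>2 * card L ^ (card S - 1) \<le> card (carrier G) ^ (card S - 1)"
    using T S(3) by auto
  show "x \<in> carrier G \<Longrightarrow> y \<in> carrier G \<Longrightarrow> B x y \<in> W S"
    using B_mem[OF S(2)] S(3) by simp
qed

end

section \<open>Relations from the Jacobi identity\<close>

lemma sorted_triple:
  assumes "card (T :: nat set) = 3"
  obtains a b c where "a < b" "b < c" "T = {a, b, c}"
proof -
  have fin: "finite T" using assms by (intro card_ge_0_finite) simp
  hence ne: "T \<noteq> {}" using assms by auto
  define a where "a = Min T"
  have a: "a \<in> T" using fin ne by (simp add: a_def)
  define T1 where "T1 = T - {a}"
  have T1: "finite T1" "card T1 = 2" using a fin assms by (auto simp: T1_def)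
  hence ne1: "T1 \<noteq> {}" by auto
  define b where "b = Min T1"
  have b: "b \<in> T1" using T1 ne1 by (simp add: b_def)
  have "card (T1 - {b}) = 1" using b T1 by simp
  then obtain c where c: "T1 - {b} = {c}" by (auto simp: card_1_singleton_iff)
  hence c1: "c \<in> T1" "c \<noteq> b" by auto
  have "b \<le> c" using c1 T1 by (simp add: b_def)
  moreover have "a \<le> b" using b fin by (simp add: a_def T1_def)
  moreover have "a \<noteq> b" using b by (auto simp: T1_def)
  moreover have "T = {a, b, c}" using a b c by (auto simp: T1_def)
  ultimately show ?thesis using that[of a b c] c1 by simp
qed

text \<open>Intended instance: \<open>H\<close> = gamma_i(G), \<open>N\<close> = gamma_{i+1}(G) and
  \<open>Z\<close> the centre, for i >= 2, with \<open>x\<close> lifting generators of G/Z. The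
  pairing then factors through H/N and G/Z, and \<open>\<Theta>\<close> exhibits its image as part
  of a quotient of H^delta.\<close>

locale pairing = bihom G C H B
  for G :: "('a, 'b) monoid_scheme" (structure) and C :: "('c, 'd) monoid_scheme"
    and H :: "'a set" and B :: "'a \<Rightarrow> 'a \<Rightarrow> 'c" +
  fixes N Z :: "'a set" and x :: "nat \<Rightarrow> 'a" and \<delta> :: nat
  assumes N: "subgroup N G" "N \<subseteq> H" and finH: "finite H"
    and radical_left: "n \<in> N \<Longrightarrow> y \<in> carrier G \<Longrightarrow> B n y = \<one>\<^bsub>C\<^esub>"
    and radical_right: "h \<in> H \<Longrightarrow> z \<in> Z \<Longrightarrow> B h z = \<one>\<^bsub>C\<^esub>"
    and xG: "\<And>j. x j \<in> carrier G" and ZG: "Z \<subseteq> carrier G"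
    and gen: "generate G (Z \<union> x ` {..<\<delta>}) = carrier G"
begin

abbreviation GH where "GH \<equiv> G\<lparr>carrier := H\<rparr>"

definition D where "D = product_group {..<\<delta>} (\<lambda>_. GH)"

definition \<Theta> where "\<Theta> h = finprod C (\<lambda>j. B (h j) (x j)) {..<\<delta>}"

definition im where "im = generate C {B h y | h y. h \<in> H \<and> y \<in> carrier G}"

lemma GH_group: "group GH" by (rule G.subgroup_imp_group[OF H])

lemma carrier_D: "carrier D = {..<\<delta>} \<rightarrow>\<^sub>E H" by (simp add: D_def)

lemma D_group: "group D" unfolding D_def by (rule product_group) (rule GH_group)

lemma D_mem: "f \<in> carrier D \<Longrightarrow> j < \<delta> \<Longrightarrow> f j \<in> H"
  by (auto simp: carrier_D)

lemma D_mult: "j < \<delta> \<Longrightarrow> (f \<otimes>\<^bsub>D\<^esub> g) j = f j \<otimes> g j" by (simp add: D_def)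

lemma D_one: "j < \<delta> \<Longrightarrow> \<one>\<^bsub>D\<^esub> j = \<one>" by (simp add: D_def)

lemma D_inv: "f \<in> carrier D \<Longrightarrow> j < \<delta> \<Longrightarrow> (inv\<^bsub>D\<^esub> f) j = inv (f j)"
  using inv_product_group[of f "{..<\<delta>}" "\<lambda>_. GH"] GH_group D_mem G.m_inv_consistent[OF H]
  by (simp add: D_def)

lemma finite_D: "finite (carrier D)" by (simp add: carrier_D finite_PiE finH)

lemma card_D: "card (carrier D) = card H ^ \<delta>" by (simp add: carrier_D card_PiE)

lemma \<Theta>_hom: "group_hom D C \<Theta>"
proof (rule group_hom.intro[OF D_group C.is_group], unfold group_hom_axioms_def, rule homI)
  fix f assume f: "f \<in> carrier D"
  show "\<Theta> f \<in> carrier C" unfolding \<Theta>_def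
    by (rule C.finprod_closed) (use f D_mem xG in auto)
next
  fix f g assume fg: "f \<in> carrier D" "g \<in> carrier D"
  have "\<Theta> (f \<otimes>\<^bsub>D\<^esub> g) = finprod C (\<lambda>j. B (f j) (x j) \<otimes>\<^bsub>C\<^esub> B (g j) (x j)) {..<\<delta>}"
    unfolding \<Theta>_def
    by (rule C.finprod_cong') (use fg D_mem xG in \<open>auto simp: D_mult B_left\<close>)
  also have "\<dots> = \<Theta> f \<otimes>\<^bsub>C\<^esub> \<Theta> g"
    unfolding \<Theta>_def by (rule C.finprod_multf) (use fg D_mem xG in auto)
  finally show "\<Theta> (f \<otimes>\<^bsub>D\<^esub> g) = \<Theta> f \<otimes>\<^bsub>C\<^esub> \<Theta> g" .
qed

text \<open>A value at \<open>x j\<close> comes from the tuple whose only nontrivial entry is at j,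
  values on \<open>Z\<close> are trivial, and multiplicativity in the second argument extends this
  to all of G.\<close>

lemma im_subset: "im \<subseteq> \<Theta> ` carrier D"
proof -
  interpret T: group_hom D C \<Theta> by (rule \<Theta>_hom)
  interpret H: subgroup H G by (rule H)
  let ?I = "\<Theta> ` carrier D"
  let ?K = "{y \<in> carrier G. \<forall>h\<in>H. B h y \<in> ?I}"
  have I: "subgroup ?I C" by (rule T.img_is_subgroup)
  have K: "subgroup ?K G" by (rule subgroup_right[OF I]) simp
  have "Z \<union> x ` {..<\<delta>} \<subseteq> ?K"
  proof
    fix y assume y: "y \<in> Z \<union> x ` {..<\<delta>}"
    have "B h y \<in> ?I" if h: "h \<in> H" for h
    proof (cases "y \<in> Z")
      case True
      thus ?thesis using radical_right[OF h] subgroup.one_closed[OF I] by simp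
    next
      case False
      then obtain j where j: "j < \<delta>" "y = x j" using y by auto
      let ?f = "\<lambda>i\<in>{..<\<delta>}. if i = j then h else \<one>"
      have f: "?f \<in> carrier D" using h by (auto simp: carrier_D)
      have "\<Theta> ?f = finprod C (\<lambda>i. if j = i then B h (x i) else \<one>\<^bsub>C\<^esub>) {..<\<delta>}"
        unfolding \<Theta>_def by (rule C.finprod_cong') (use h xG in auto)
      also have "\<dots> = B h (x j)" by (rule C.finprod_singleton) (use j h xG in auto)
      finally show ?thesis using f j by (metis imageI)
    qed
    thus "y \<in> ?K" using y ZG xG by auto
  qed
  hence "carrier G \<subseteq> ?K" using G.generate_subgroup_incl[OF _ K] gen by blast
  hence "{B h y | h y. h \<in> H \<and> y \<in> carrier G} \<subseteq> ?I" by auto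
  thus ?thesis unfolding im_def using I by (rule C.generate_subgroup_incl)
qed

text \<open>\<open>U\<close> is a set of relations: the more of the kernel of
  \<open>\<Theta>\<close> it generates, the smaller the image. It is applied to N^delta alone and to
  N^delta together with the Jacobi relations.\<close>

lemma card_im_bound:
  assumes U: "U \<subseteq> carrier D" "\<And>u. u \<in> U \<Longrightarrow> \<Theta> u = \<one>\<^bsub>C\<^esub>"
  shows "finite im" "card im * card (generate D U) \<le> card H ^ \<delta>"
proof -
  interpret T: group_hom D C \<Theta> by (rule \<Theta>_hom)
  let ?K = "{f \<in> carrier D. \<Theta> f = \<one>\<^bsub>C\<^esub>}"
  have finI: "finite (\<Theta> ` carrier D)" using finite_D by simp
  show "finite im" using im_subset finI finite_subset by blast
  have "?K = kernel D C \<Theta>" by (simp add: kernel_def)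
  hence "subgroup ?K D" using T.subgroup_kernel by simp
  hence "generate D U \<subseteq> ?K" using U by (intro T.G.generate_subgroup_incl) auto
  hence "card (generate D U) \<le> card ?K" using finite_D by (intro card_mono) auto
  moreover have "card im \<le> card (\<Theta> ` carrier D)" using im_subset finI card_mono by blast
  ultimately have "card im * card (generate D U) \<le> card (\<Theta> ` carrier D) * card ?K"
    by (rule mult_le_mono[rotated])
  also have "\<dots> = card H ^ \<delta>"
    using T.card_image_kernel(2)[OF T.G.subgroup_self finI] finite_D card_D by simp
  finally show "card im * card (generate D U) \<le> card H ^ \<delta>" .
qed

definition ND where "ND = ({..<\<delta>} \<rightarrow>\<^sub>E N)"

lemma ND_subset: "ND \<subseteq> carrier D"
  using N by (auto simp: ND_def carrier_D PiE_iff)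

lemma ND_subgroup: "subgroup ND D"
proof -
  have "subgroup N GH" by (rule G.subgroup_incl[OF N(1) H N(2)])
  thus ?thesis unfolding ND_def D_def
    using PiE_subgroup_product_group[of "{..<\<delta>}" "\<lambda>_. GH" "\<lambda>_. N"] GH_group by simp
qed

lemma card_ND: "card ND = card N ^ \<delta>" by (simp add: ND_def card_PiE)

lemma \<Theta>_ND: "u \<in> ND \<Longrightarrow> \<Theta> u = \<one>\<^bsub>C\<^esub>"
  unfolding \<Theta>_def
proof (rule C.finprod_one_eqI)
  fix j assume "u \<in> ND" "j \<in> {..<\<delta>}"
  hence "u j \<in> N" unfolding ND_def by (rule PiE_mem)
  thus "B (u j) (x j) = \<one>\<^bsub>C\<^esub>" using xG by (rule radical_left)
qed

lemma card_im_le: "finite im" "card im * card N ^ \<delta> \<le> card H ^ \<delta>"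
proof -
  interpret T: group_hom D C \<Theta> by (rule \<Theta>_hom)
  show "finite im" by (rule card_im_bound(1)[OF ND_subset \<Theta>_ND])
  have "generate D ND = ND" using T.G.generateI[OF ND_subgroup] by blast
  thus "card im * card N ^ \<delta> \<le> card H ^ \<delta>"
    using card_im_bound(2)[OF ND_subset \<Theta>_ND] card_ND by simp
qed

end

text \<open>The Jacobi identity puts the element with coordinates \<open>[x\<^sub>a,x\<^sub>b]\<close> at \<open>c\<close>,
  \<open>[x\<^sub>b,x\<^sub>c]\<close> at \<open>a\<close> and \<open>[x\<^sub>a,x\<^sub>c]\<^sup>-\<^sup>1\<close> at \<open>b\<close> into the kernel
  of the sum map.\<close>

locale jacobi_pairing = pairing G C H B N Z x \<delta>
  for G :: "('a, 'b) monoid_scheme" (structure) and C :: "('c, 'd) monoid_scheme"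
    and H :: "'a set" and B :: "'a \<Rightarrow> 'a \<Rightarrow> 'c" and N Z x \<delta> +
  fixes w :: "nat set \<Rightarrow> 'a"
  assumes wH: "\<And>P. w P \<in> H"
    and jacobi: "a < b \<Longrightarrow> b < c \<Longrightarrow> c < \<delta> \<Longrightarrow>
      B (w {b, c}) (x a) \<otimes>\<^bsub>C\<^esub> (B (inv (w {a, c})) (x b) \<otimes>\<^bsub>C\<^esub> B (w {a, b}) (x c)) = \<one>\<^bsub>C\<^esub>"
begin

definition subsets where "subsets m = {P. P \<subseteq> {..<\<delta>} \<and> card P = m}"

text \<open>The code is the sum of 2^i over i in P, so removing a common element from two sets
  lowers both codes by the same amount. This is what lets the order on triples induce the order on
  the pairs inside them.\<close>

definition lower where "lower P = generate G (N \<union> w ` {Q \<in> subsets 2. set_encode Q < set_encode P})"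

definition standard where "standard P \<longleftrightarrow> P \<in> subsets 2 \<and> w P \<notin> lower P"

definition jac where "jac T = (\<lambda>j\<in>{..<\<delta>}. if j \<in> T
    then if j = Min T \<or> j = Max T then w (T - {j}) else inv (w (T - {j})) else \<one>)"

text \<open>Numbering the relations by the codes of their triples turns the smaller triples into an
  initial segment of the naturals, the form that a chain of subgroups requires. Codes of other sets
  contribute the unit.\<close>

definition J where "J i = (if set_decode i \<in> subsets 3 then jac (set_decode i) else \<one>\<^bsub>D\<^esub>)"

lemma finite_subsets: "P \<in> subsets m \<Longrightarrow> finite P"
  by (auto simp: subsets_def finite_subset)

lemma jac_carrier: "jac T \<in> carrier D"
  using wH subgroup.m_inv_closed[OF H wH] subgroup.one_closed[OF H]
  by (auto simp: jac_def carrier_D)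

lemma J_carrier: "J i \<in> carrier D"
  using jac_carrier group.is_monoid[OF D_group] by (auto simp: J_def monoid.one_closed)

lemma \<Theta>_jac: assumes T: "T \<in> subsets 3" shows "\<Theta> (jac T) = \<one>\<^bsub>C\<^esub>"
proof -
  obtain a b c where abc: "a < b" "b < c" "T = {a, b, c}"
    using sorted_triple[of T] T by (auto simp: subsets_def)
  have c: "c < \<delta>" using T abc by (auto simp: subsets_def)
  have MM: "Min T = a" "Max T = c" using abc by auto
  have diff: "T - {a} = {b, c}" "T - {b} = {a, c}" "T - {c} = {a, b}" using abc by auto
  have iH: "inv (w P) \<in> H" for P using subgroup.m_inv_closed[OF H wH] .
  have j: "jac T a = w {b, c}" "jac T b = inv (w {a, c})" "jac T c = w {a, b}"
    using abc c MM diff by (auto simp: jac_def)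
  have "\<Theta> (jac T) = finprod C (\<lambda>j. B (jac T j) (x j)) {a, b, c}"
    unfolding \<Theta>_def
  proof (rule C.finprod_mono_neutral_cong_right)
    show "{a, b, c} \<subseteq> {..<\<delta>}" using abc c by auto
    show "B (jac T i) (x i) = \<one>\<^bsub>C\<^esub>" if "i \<in> {..<\<delta>} - {a, b, c}" for i
      using that abc xG by (simp add: jac_def)
    show "(\<lambda>j. B (jac T j) (x j)) \<in> {..<\<delta>} \<rightarrow> carrier C"
      using D_mem[OF jac_carrier] xG by auto
  qed auto
  also have "\<dots> = B (jac T a) (x a) \<otimes>\<^bsub>C\<^esub> (B (jac T b) (x b) \<otimes>\<^bsub>C\<^esub> B (jac T c) (x c))"
    using abc c D_mem[OF jac_carrier] xG by simp
  also have "\<dots> = \<one>\<^bsub>C\<^esub>" unfolding j by (rule jacobi[OF abc(1,2) c])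
  finally show ?thesis .
qed

lemma \<Theta>_J: "\<Theta> (J i) = \<one>\<^bsub>C\<^esub>"
  using \<Theta>_jac group_hom.hom_one[OF \<Theta>_hom] by (simp add: J_def)

lemma coordinate_subgroup:
  assumes K: "subgroup K G" and j: "j < \<delta>"
  shows "subgroup {f \<in> carrier D. f j \<in> K} D"
proof -
  interpret K: subgroup K G by fact
  interpret D: group D by (rule D_group)
  show ?thesis
  proof (rule D.subgroupI)
    have "\<one>\<^bsub>D\<^esub> \<in> {f \<in> carrier D. f j \<in> K}" using D_one[OF j] by simp
    thus "{f \<in> carrier D. f j \<in> K} \<noteq> {}" by blast
  next
    fix f assume "f \<in> {f \<in> carrier D. f j \<in> K}"
    thus "inv\<^bsub>D\<^esub> f \<in> {f \<in> carrier D. f j \<in> K}" using j by (simp add: D_inv)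
  next
    fix f g assume "f \<in> {f \<in> carrier D. f j \<in> K}" "g \<in> {f \<in> carrier D. f j \<in> K}"
    thus "f \<otimes>\<^bsub>D\<^esub> g \<in> {f \<in> carrier D. f j \<in> K}" using j by (simp add: D_mult)
  qed auto
qed

lemma lower_subgroup: "subgroup (lower P) G"
  unfolding lower_def using N(2) wH subgroup.subset[OF H]
  by (intro G.generate_is_subgroup) auto

lemma set_encode_remove:
  "finite T \<Longrightarrow> c \<in> T \<Longrightarrow> set_encode T = 2 ^ c + set_encode (T - {c})"
  using set_encode_insert[of "T - {c}" c] by (simp add: insert_absorb)

text \<open>Look at coordinate c. An earlier relation from a triple S containing c has there the
  commutator of S - {c} or its inverse, and S - {c} is smaller than T - {c}. Other earlier relations
  have the unit there, and elements of N^delta an element of \<open>N\<close>. All of these lie in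
  \<open>lower (T - {c})\<close>, which misses the entry of \<open>jac T\<close> because T - {c} is
  standard.\<close>

lemma J_independent:
  assumes T: "T \<in> subsets 3" and c: "c \<in> T" and st: "standard (T - {c})"
  shows "J (set_encode T) \<notin> generate D (ND \<union> J ` {..<set_encode T})"
proof
  let ?P = "T - {c}"
  assume mem: "J (set_encode T) \<in> generate D (ND \<union> J ` {..<set_encode T})"
  interpret L: subgroup "lower ?P" G by (rule lower_subgroup)
  have cd: "c < \<delta>" using T c by (auto simp: subsets_def)
  have finT: "finite T" by (rule finite_subsets[OF T])
  let ?K = "{f \<in> carrier D. f c \<in> lower ?P}"
  have "ND \<union> J ` {..<set_encode T} \<subseteq> ?K"
  proof
    fix f assume f: "f \<in> ND \<union> J ` {..<set_encode T}"
    show "f \<in> ?K"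
    proof (cases "f \<in> ND")
      case True
      hence "f c \<in> N" using cd by (auto simp: ND_def)
      thus ?thesis using True ND_subset by (auto simp: lower_def intro: generate.incl)
    next
      case False
      then obtain i where i: "i < set_encode T" "f = J i" using f by auto
      define S where "S = set_decode i"
      have iS: "i = set_encode S" by (simp add: S_def)
      have "J i c \<in> lower ?P"
      proof (cases "S \<in> subsets 3 \<and> c \<in> S")
        case True
        have finS: "finite S" using True finite_subsets by blast
        have "set_encode (S - {c}) < set_encode ?P"
          using i(1) iS set_encode_remove[OF finS conjunct2[OF True]] set_encode_remove[OF finT c]
          by simp
        moreover have "S - {c} \<in> subsets 2" using True by (auto simp: subsets_def)
        ultimately have "w (S - {c}) \<in> lower ?P"
          unfolding lower_def by (intro generate.incl) auto
        thus ?thesis using True cd by (simp add: J_def S_def[symmetric] jac_def)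
      next
        case False
        hence "J i c = \<one>" using cd by (auto simp: J_def S_def[symmetric] jac_def D_one)
        thus ?thesis by simp
      qed
      thus ?thesis using i J_carrier by simp
    qed
  qed
  hence "J (set_encode T) \<in> ?K"
    using generate_mem_subgroup[OF D_group coordinate_subgroup[OF lower_subgroup cd] mem] by blast
  hence "jac T c \<in> lower ?P" using T finT by (simp add: J_def)
  hence "w ?P \<in> lower ?P \<or> inv (w ?P) \<in> lower ?P"
    using c cd by (auto simp: jac_def split: if_splits)
  moreover have "w ?P \<in> carrier G" using wH subgroup.subset[OF H] by auto
  ultimately have "w ?P \<in> lower ?P" using L.m_inv_closed[of "inv (w ?P)"] by auto
  thus False using st by (simp add: standard_def)
qed

text \<open>Each triple with a standard pair enlarges, by a factor of at least p, a chain of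
  subgroups that starts at N^delta and stays inside the kernel of \<open>\<Theta>\<close>.\<close>

lemma card_im_jacobi:
  assumes p: "Factorial_Ring.prime p" and HN: "card H = p ^ b * card N"
  shows "finite im"
    "card im * (p ^ card {T \<in> subsets 3. \<exists>c\<in>T. standard (T - {c})} * card N ^ \<delta>) \<le> card H ^ \<delta>"
proof -
  interpret D: group D by (rule D_group)
  show "finite im" by (rule card_im_le)
  let ?S = "{T \<in> subsets 3. \<exists>c\<in>T. standard (T - {c})}"
  have finS: "finite ?S" by (rule finite_subset[of _ "Pow {..<\<delta>}"]) (auto simp: subsets_def)
  then obtain m where m: "\<forall>i\<in>set_encode ` ?S. i < m"
    using finite_nat_set_iff_bounded[of "set_encode ` ?S"] by auto
  let ?F = "{i. i < m \<and> J i \<notin> generate D (ND \<union> J ` {..<i})}"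
  have "set_encode ` ?S \<subseteq> ?F" using m J_independent by auto
  hence "card (set_encode ` ?S) \<le> card ?F" by (intro card_mono) auto
  moreover have "inj_on set_encode ?S"
    using inj_on_set_encode by (rule inj_on_subset) (auto intro: finite_subsets)
  ultimately have "card ?S \<le> card ?F" by (simp add: card_image)
  hence "p ^ card ?S * card N ^ \<delta> \<le> p ^ card ?F * card ND"
    using prime_gt_0_nat[OF p] card_ND by (intro mult_le_mono power_increasing) auto
  also have "\<dots> \<le> card (generate D (ND \<union> J ` {..<m}))"
  proof (rule D.card_subgroup_chain[OF finite_D p ND_subgroup _ J_carrier])
    show "card (carrier D) = p ^ (b * \<delta>) * card ND"
      by (simp add: card_D card_ND HN power_mult_distrib power_mult)
  qed
  finally have "card im * (p ^ card ?S * card N ^ \<delta>)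
      \<le> card im * card (generate D (ND \<union> J ` {..<m}))" by simp
  also have "\<dots> \<le> card H ^ \<delta>"
    by (rule card_im_bound(2)) (use ND_subset J_carrier \<Theta>_ND \<Theta>_J in auto)
  finally show "card im * (p ^ card ?S * card N ^ \<delta>) \<le> card H ^ \<delta>" .
qed

end

section \<open>Commutator pairings of a central extension\<close>

declare lcs.simps(3) [simp del]

text \<open>The map y -> [x,y] is a homomorphism into the centre and hence kills commutators.
  Concretely, cd = [c,d](dc), while [x,cd] and [x,dc] agree.\<close>

lemma (in group) commutator_commutator_eq_one:
  assumes central: "\<And>y. y \<in> carrier G \<Longrightarrow> commutator G x y \<in> center G"
    and x: "x \<in> carrier G" and cd: "c \<in> carrier G" "d \<in> carrier G"
  shows "commutator G x (commutator G c d) = \<one>"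
proof -
  have comm: "commutator G x c \<otimes> commutator G x d = commutator G x d \<otimes> commutator G x c"
    using centerD[OF central[OF cd(1)]] x cd by simp
  have "commutator G c d \<otimes> (d \<otimes> c) = c \<otimes> d"
    using cd by (simp add: commutator_def word_simps)
  hence "commutator G x (commutator G c d) \<otimes> commutator G x (d \<otimes> c) = commutator G x (c \<otimes> d)"
    using x cd central commutator_hom_right[of x "commutator G c d" "d \<otimes> c"] by simp
  also have "\<dots> = commutator G x c \<otimes> commutator G x d"
    using x cd central by (intro commutator_hom_right)
  also have "\<dots> = commutator G x (d \<otimes> c)"
    unfolding comm using x cd central by (intro commutator_hom_right[symmetric])
  finally show ?thesis using x cd by simp
qed

text \<open>Conjugate e = [a,b] by c in two ways. The result is [c,e]e, and also [ua,vb] with u =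
  [c,a] and v = [c,b]. Commutators commute with one another here, so the second expression expands
  to [a,v][u,b]e.\<close>

lemma (in group) jacobi_identity:
  assumes central: "\<And>a b c. a \<in> carrier G \<Longrightarrow> b \<in> carrier G \<Longrightarrow> c \<in> carrier G
      \<Longrightarrow> commutator G (commutator G a b) c \<in> center G"
    and abc: "a \<in> carrier G" "b \<in> carrier G" "c \<in> carrier G"
  shows "commutator G (commutator G b c) a \<otimes> (commutator G (commutator G c a) b
    \<otimes> commutator G (commutator G a b) c) = \<one>"
proof -
  define u where "u = commutator G c a"
  define v where "v = commutator G c b"
  define e where "e = commutator G a b"
  have uve: "u \<in> carrier G" "v \<in> carrier G" "e \<in> carrier G" using abc by (auto simp: u_def v_def e_def)
  have commute: "commutator G p q \<otimes> commutator G r s = commutator G r s \<otimes> commutator G p q"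
    if "p \<in> carrier G" "q \<in> carrier G" "r \<in> carrier G" "s \<in> carrier G" for p q r s
    using commutator_commutator_eq_one[of "commutator G p q" r s] central that
    by (simp add: commutator_eq_one_iff)
  have vc: "commutator G v a \<in> center G" "commutator G u b \<in> center G"
    using central abc by (auto simp: u_def v_def)
  have av: "commutator G a v \<in> center G"
    using vc(1) subgroup.m_inv_closed[OF center_subgroup vc(1)] abc uve by (simp add: inv_commutator)
  have conj_a: "c \<otimes> a \<otimes> inv c = u \<otimes> a" and conj_b: "c \<otimes> b \<otimes> inv c = v \<otimes> b"
    using abc by (auto simp: u_def v_def commutator_def word_simps)
  have ve: "v \<otimes> e \<otimes> inv v = e" "u \<otimes> e \<otimes> inv u = e"
    using uve commute[of c b a b] commute[of c a a b] abc
    by (simp_all add: u_def[symmetric] v_def[symmetric] e_def[symmetric] m_assoc)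
  have 1: "commutator G a (v \<otimes> b) = commutator G a v \<otimes> e"
    using abc uve ve by (simp add: commutator_mult_right e_def[symmetric])
  have "u \<otimes> (commutator G a v \<otimes> e) \<otimes> inv u = commutator G a v \<otimes> (u \<otimes> e \<otimes> inv u)"
  proof -
    have "u \<otimes> (commutator G a v \<otimes> e) = commutator G a v \<otimes> (u \<otimes> e)"
      using centerD[OF av uve(1)] abc uve by (simp add: m_assoc[symmetric])
    thus ?thesis using abc uve by (simp add: m_assoc)
  qed
  hence 2: "u \<otimes> commutator G a (v \<otimes> b) \<otimes> inv u = commutator G a v \<otimes> e" using 1 ve by simp
  have uv: "commutator G u v = \<one>"
    using commute[of c a c b] abc uve by (simp add: commutator_eq_one_iff u_def[symmetric] v_def[symmetric])
  have 3: "commutator G u (v \<otimes> b) = commutator G u b"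
    using abc uve uv conj_center[OF vc(2) uve(2)] by (simp add: commutator_mult_right)
  have "c \<otimes> e \<otimes> inv c = commutator G (u \<otimes> a) (v \<otimes> b)"
    using abc by (simp add: e_def conj_commutator conj_a conj_b)
  also have "\<dots> = commutator G a v \<otimes> e \<otimes> commutator G u b"
    using abc uve 2 3 by (simp add: commutator_mult_left)
  also have "\<dots> = commutator G a v \<otimes> commutator G u b \<otimes> e"
    using centerD[OF vc(2) uve(3)] abc uve by (simp add: m_assoc)
  finally have "commutator G c e = commutator G a v \<otimes> commutator G u b"
    using abc uve by (simp add: commutator_def[of G c e] m_assoc)
  \<comment> \<open>v = [c,b] is inverse to [b,c], and bracketing with a is multiplicative on such
    elements, so [v,a] and [[b,c],a] are inverse to each other.\<close>
  moreover have "commutator G a v = commutator G (commutator G b c) a"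
  proof -
    have "commutator G v (commutator G b c) = \<one>"
      using commute[of c b b c] abc uve by (simp add: commutator_eq_one_iff v_def)
    have vi: "v \<otimes> commutator G b c = \<one>"
      using abc r_inv[of v] uve by (simp add: inv_commutator v_def)
    have "commutator G v a \<otimes> commutator G (commutator G b c) a = commutator G (v \<otimes> commutator G b c) a"
      using abc uve central by (intro commutator_hom_left[symmetric]) auto
    also have "\<dots> = \<one>" unfolding vi using abc by (simp add: commutator_eq_one_iff)
    finally have "commutator G v a \<otimes> commutator G (commutator G b c) a = \<one>" .
    hence "inv (commutator G v a) = commutator G (commutator G b c) a"
      using abc uve by (intro inv_equality[symmetric, THEN sym]) (auto simp: inv_comm)
    thus ?thesis using abc uve by (simp add: inv_commutator)
  qed
  ultimately have "commutator G (commutator G b c) a \<otimes> commutator G (commutator G c a) b = commutator G c e"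
    by (simp add: u_def)
  moreover have "commutator G c e \<otimes> commutator G e c = \<one>"
    using abc uve r_inv[of "commutator G c e"] by (simp add: inv_commutator)
  ultimately have "commutator G (commutator G b c) a \<otimes> commutator G (commutator G c a) b
      \<otimes> commutator G e c = \<one>" by simp
  thus ?thesis using abc uve by (simp add: e_def m_assoc)
qed

section \<open>Central extensions and commutators of lifts\<close>

locale central_extension = E: group E + G: group G
  for E :: "('e, 'f) monoid_scheme" (structure) and G :: "('a, 'b) monoid_scheme" +
  fixes \<pi> :: "'e \<Rightarrow> 'a"
  assumes \<pi>_hom: "\<pi> \<in> hom E G" and surj: "\<pi> ` carrier E = carrier G"
    and central: "e \<in> carrier E \<Longrightarrow> \<pi> e = \<one>\<^bsub>G\<^esub> \<Longrightarrow> e \<in> center E"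
begin

sublocale pi: group_hom E G \<pi>
  by unfold_locales (rule \<pi>_hom)

definition \<sigma> where "\<sigma> g = (SOME e. e \<in> carrier E \<and> \<pi> e = g)"

text \<open>Two lifts of an element differ by an element of the central kernel, which does not
  affect commutators. The choice made in \<open>\<sigma>\<close> is therefore immaterial, and lifts
  may be taken inside a prescribed lower central term of E.\<close>

definition \<kappa> where "\<kappa> g h = commutator E (\<sigma> g) (\<sigma> h)"

lemma \<sigma>: assumes "g \<in> carrier G" shows "\<sigma> g \<in> carrier E" "\<pi> (\<sigma> g) = g"
proof -
  have "g \<in> \<pi> ` carrier E" using assms surj by simp
  then obtain e where "e \<in> carrier E \<and> \<pi> e = g" by blast
  hence "\<sigma> g \<in> carrier E \<and> \<pi> (\<sigma> g) = g" unfolding \<sigma>_def by (rule someI)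
  thus "\<sigma> g \<in> carrier E" "\<pi> (\<sigma> g) = g" by auto
qed

lemma commutator_cong_left:
  assumes e: "e1 \<in> carrier E" "e2 \<in> carrier E" "y \<in> carrier E" "\<pi> e1 = \<pi> e2"
  shows "commutator E e1 y = commutator E e2 y"
proof -
  define z where "z = inv e2 \<otimes> e1"
  have z: "z \<in> carrier E" "z \<in> center E" using e by (auto simp: z_def intro!: central)
  have "e1 = e2 \<otimes> z" using e by (simp add: z_def E.mult_inv_cancel)
  moreover have "commutator E z y = \<one>" using z e by (intro E.commutator_center_left)
  ultimately show ?thesis using e z by (simp add: E.commutator_mult_left)
qed

lemma commutator_cong:
  assumes "e1 \<in> carrier E" "e2 \<in> carrier E" "y1 \<in> carrier E" "y2 \<in> carrier E"
    "\<pi> e1 = \<pi> e2" "\<pi> y1 = \<pi> y2"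
  shows "commutator E e1 y1 = commutator E e2 y2"
proof -
  have "commutator E e1 y1 = commutator E e2 y1" using assms by (intro commutator_cong_left)
  also have "\<dots> = inv (commutator E y1 e2)" using assms by (simp add: E.inv_commutator)
  also have "commutator E y1 e2 = commutator E y2 e2" using assms by (intro commutator_cong_left)
  finally show ?thesis using assms by (simp add: E.inv_commutator)
qed

lemma \<kappa>_\<pi>: "e \<in> carrier E \<Longrightarrow> y \<in> carrier E \<Longrightarrow> \<kappa> (\<pi> e) (\<pi> y) = commutator E e y"
  unfolding \<kappa>_def by (rule commutator_cong) (auto simp: \<sigma>)

lemma lift_lcs:
  assumes "g \<in> lcs G i"
  obtains e where "e \<in> lcs E i" "e \<in> carrier E" "\<pi> e = g"
proof -
  have "g \<in> \<pi> ` lcs E i" using assms pi.image_lcs[OF surj, of i] by simp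
  then obtain e where "e \<in> lcs E i" "\<pi> e = g" by blast
  thus ?thesis using that E.lcs_carrier[of i] by blast
qed

lemma lift:
  assumes "g \<in> carrier G"
  obtains e where "e \<in> carrier E" "\<pi> e = g"
  using \<sigma>[OF assms] by blast

text \<open>A lift of a central element commutes with \<open>a\<close> modulo the kernel of \<open>\<pi>\<close>, so
  conjugation by it does not change \<open>[a,b]\<close>.\<close>

lemma lift_center_commutes:
  assumes y: "y \<in> carrier E" "\<pi> y \<in> center G" and e: "e \<in> lcs E 2"
  shows "commutator E e y = \<one>"
proof -
  let ?K = "{e \<in> carrier E. commutator E e y = \<one>}"
  \<comment> \<open>Commuting with \<open>y\<close> is rephrased as being fixed under conjugation by
    \<open>y\<close>: fixed points form a subgroup, and conjugation passes inside a
    commutator.\<close>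
  have eq: "commutator E e y = \<one> \<longleftrightarrow> y \<otimes> e \<otimes> inv y = e" if "e \<in> carrier E" for e
  proof -
    have "commutator E e y = \<one> \<longleftrightarrow> e \<otimes> y = y \<otimes> e" using that y by (simp add: E.commutator_eq_one_iff)
    also have "\<dots> \<longleftrightarrow> y \<otimes> e \<otimes> inv y = e" using that y
      by (metis E.inv_solve_right E.m_closed)
    finally show ?thesis .
  qed
  have "subgroup ?K E"
  proof (rule E.subgroupI)
    show "?K \<noteq> {}" using y eq[of \<one>] by (auto intro!: exI[of _ \<one>])
  next
    fix a assume "a \<in> ?K"
    hence a: "a \<in> carrier E" "y \<otimes> a \<otimes> inv y = a" using eq by auto
    have "y \<otimes> inv a \<otimes> inv y = inv (y \<otimes> a \<otimes> inv y)" using a(1) y by (simp add: E.word_simps)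
    thus "inv a \<in> ?K" using a eq by simp
  next
    fix a b assume "a \<in> ?K" "b \<in> ?K"
    hence ab: "a \<in> carrier E" "y \<otimes> a \<otimes> inv y = a" "b \<in> carrier E" "y \<otimes> b \<otimes> inv y = b" using eq by auto
    have "y \<otimes> (a \<otimes> b) \<otimes> inv y = (y \<otimes> a \<otimes> inv y) \<otimes> (y \<otimes> b \<otimes> inv y)"
      using ab(1,3) y by (simp add: E.word_simps)
    thus "a \<otimes> b \<in> ?K" using ab eq by simp
  qed auto
  moreover have "commutator E a b \<in> ?K" if ab: "a \<in> carrier E" "b \<in> carrier E" for a b
  proof -
    have p: "\<pi> (y \<otimes> a \<otimes> inv y) = \<pi> a" if "a \<in> carrier E" for a
      using that y G.conj_center[OF y(2)] G.centerD[OF y(2), of "\<pi> a"] by (simp add: G.m_assoc)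
    have "y \<otimes> commutator E a b \<otimes> inv y = commutator E (y \<otimes> a \<otimes> inv y) (y \<otimes> b \<otimes> inv y)"
      using ab y by (simp add: E.conj_commutator)
    also have "\<dots> = commutator E a b" using ab y p by (intro commutator_cong) auto
    finally show ?thesis using eq ab by simp
  qed
  ultimately have "comm_subgroup E (carrier E) (carrier E) \<subseteq> ?K" by (rule E.comm_subgroup_least)
  moreover have "e \<in> comm_subgroup E (carrier E) (carrier E)"
    using e by (simp add: numeral_2_eq_2 E.lcs_Suc)
  ultimately show ?thesis by auto
qed

section \<open>The commutator pairings modulo lower central terms of E\<close>

definition Q where "Q i = E Mod lcs E (Suc (Suc i))"
definition \<phi> where "\<phi> i = (\<lambda>e. lcs E (Suc (Suc i)) #> e)"
text \<open>The target is the whole centre of E/gamma_{i+2}(E), which contains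
  gamma_{i+1}(E)/gamma_{i+2}(E): it is a commutative group at no cost, and only the subgroup
  generated by the values is ever counted.\<close>

definition CQ where "CQ i = (Q i)\<lparr>carrier := center (Q i)\<rparr>"
definition B where "B i g h = \<phi> i (\<kappa> g h)"

lemma \<phi>_hom: "group_hom E (Q i) (\<phi> i)"
proof -
  interpret N: normal "lcs E (Suc (Suc i))" E by (rule E.lcs_normal)
  show ?thesis unfolding Q_def \<phi>_def
    by (rule group_hom.intro[OF E.is_group N.factorgroup_is_group])
      (rule group_hom_axioms.intro[OF N.r_coset_hom_Mod])
qed

lemma \<phi>_surj: "\<phi> i ` carrier E = carrier (Q i)"
  by (simp add: Q_def \<phi>_def carrier_FactGroup)

lemma \<phi>_eq_one_iff: "e \<in> carrier E \<Longrightarrow> \<phi> i e = \<one>\<^bsub>Q i\<^esub> \<longleftrightarrow> e \<in> lcs E (Suc (Suc i))"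
  unfolding Q_def \<phi>_def
  using E.coset_join1[OF _ _ E.lcs_subgroup, of _ e] E.coset_join2[OF _ E.lcs_subgroup, of e]
  by (auto simp del: lcs.simps)

lemma \<phi>_central:
  assumes "e \<in> lcs E (Suc i)"
  shows "\<phi> i e \<in> center (Q i)"
proof -
  interpret phi: group_hom E "Q i" "\<phi> i" by (rule \<phi>_hom)
  have eE: "e \<in> carrier E" using assms E.lcs_carrier by auto
  show ?thesis
  proof (rule phi.H.centerI)
    fix q assume "q \<in> carrier (Q i)"
    then obtain y where y: "y \<in> carrier E" "q = \<phi> i y" using \<phi>_surj by blast
    have "commutator E e y \<in> lcs E (Suc (Suc i))" using E.commutator_lcs assms y by simp
    hence "commutator (Q i) (\<phi> i e) q = \<one>\<^bsub>Q i\<^esub>"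
      using eE y by (simp add: phi.hom_commutator[symmetric] \<phi>_eq_one_iff)
    thus "\<phi> i e \<otimes>\<^bsub>Q i\<^esub> q = q \<otimes>\<^bsub>Q i\<^esub> \<phi> i e" using eE y by (simp add: phi.H.commutator_eq_one_iff)
  qed (use eE in simp)
qed

lemma CQ_group: "comm_group (CQ i)"
proof -
  interpret phi: group_hom E "Q i" "\<phi> i" by (rule \<phi>_hom)
  show ?thesis unfolding CQ_def by (rule phi.H.center_comm_group)
qed

lemma CQ_simps [simp]: "carrier (CQ i) = center (Q i)" "monoid.mult (CQ i) = monoid.mult (Q i)" "one (CQ i) = one (Q i)"
  by (simp_all add: CQ_def)

lemma B_\<pi>: "e \<in> carrier E \<Longrightarrow> y \<in> carrier E
    \<Longrightarrow> B i (\<pi> e) (\<pi> y) = commutator (Q i) (\<phi> i e) (\<phi> i y)"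
  using group_hom.hom_commutator[OF \<phi>_hom] by (simp add: B_def \<kappa>_\<pi>)

text \<open>An element of gamma_i(G) lifts to gamma_i(E). Its commutators lie in gamma_{i+1}(E),
  hence are central modulo gamma_{i+2}(E), and central commutators are multiplicative in each
  argument.\<close>

lemma B_bihom:
  assumes i: "0 < i"
  shows "bihom G (CQ i) (lcs G i) (B i)"
proof -
  interpret phi: group_hom E "Q i" "\<phi> i" by (rule \<phi>_hom)
  interpret C: comm_group "CQ i" by (rule CQ_group)
  have cen: "commutator (Q i) (\<phi> i e) (\<phi> i y) \<in> center (Q i)"
    if e: "e \<in> lcs E i" and y: "y \<in> carrier E" for e y
  proof -
    have "e \<in> carrier E" using e E.lcs_carrier by auto
    hence "commutator (Q i) (\<phi> i e) (\<phi> i y) = \<phi> i (commutator E e y)"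
      using y by (simp add: phi.hom_commutator)
    thus ?thesis using \<phi>_central[OF E.commutator_lcs[OF i e y]] by simp
  qed
  show ?thesis
  proof (intro bihom.intro bihom_axioms.intro G.is_group CQ_group)
    show "subgroup (lcs G i) G" by (rule G.lcs_subgroup)
  next
    fix g h assume "g \<in> lcs G i" "h \<in> carrier G"
    then obtain e y where e: "e \<in> lcs E i" "e \<in> carrier E" "\<pi> e = g" and y: "y \<in> carrier E" "\<pi> y = h"
      by (meson lift_lcs lift)
    show "B i g h \<in> carrier (CQ i)" using B_\<pi>[OF e(2) y(1), of i] cen[OF e(1) y(1)] e y by simp
  next
    fix g g' h assume "g \<in> lcs G i" "g' \<in> lcs G i" "h \<in> carrier G"
    then obtain e e' y where e: "e \<in> lcs E i" "e \<in> carrier E" "\<pi> e = g"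
        and e': "e' \<in> lcs E i" "e' \<in> carrier E" "\<pi> e' = g'"
        and y: "y \<in> carrier E" "\<pi> y = h"
      by (meson lift_lcs lift)
    show "B i (g \<otimes>\<^bsub>G\<^esub> g') h = B i g h \<otimes>\<^bsub>CQ i\<^esub> B i g' h"
      using B_\<pi>[of "e \<otimes> e'" y i] B_\<pi>[OF e(2) y(1), of i] B_\<pi>[OF e'(2) y(1), of i]
        phi.H.commutator_hom_left[OF _ _ _ cen[OF e'(1) y(1)], of "\<phi> i e"] e e' y by simp
  next
    fix g h h' assume "g \<in> lcs G i" "h \<in> carrier G" "h' \<in> carrier G"
    then obtain e y y' where e: "e \<in> lcs E i" "e \<in> carrier E" "\<pi> e = g"
        and y: "y \<in> carrier E" "\<pi> y = h" and y': "y' \<in> carrier E" "\<pi> y' = h'"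
      by (meson lift_lcs lift)
    show "B i g (h \<otimes>\<^bsub>G\<^esub> h') = B i g h \<otimes>\<^bsub>CQ i\<^esub> B i g h'"
      using B_\<pi>[of e "y \<otimes> y'" i] B_\<pi>[OF e(2) y(1), of i] B_\<pi>[OF e(2) y'(1), of i]
        phi.H.commutator_hom_right[OF _ _ _ cen[OF e(1) y'(1)], of "\<phi> i y"] e y y' by simp
  qed
qed

lemma B_radical_left:
  assumes "n \<in> lcs G (Suc i)" "h \<in> carrier G"
  shows "B i n h = \<one>\<^bsub>CQ i\<^esub>"
proof -
  obtain e where e: "e \<in> lcs E (Suc i)" "e \<in> carrier E" "\<pi> e = n" using lift_lcs[OF assms(1)] .
  obtain y where y: "y \<in> carrier E" "\<pi> y = h" using lift[OF assms(2)] .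
  have "commutator E e y \<in> lcs E (Suc (Suc i))" using E.commutator_lcs e y by simp
  moreover have "B i n h = \<phi> i (commutator E e y)" using e y \<kappa>_\<pi>[of e y] by (simp add: B_def)
  ultimately show ?thesis using \<phi>_eq_one_iff[of "commutator E e y" i] e y by simp
qed

text \<open>A lift of \<open>z\<close> centralizes gamma_2(E), which contains gamma_i(E) for i >= 2.
  Hence generators of G modulo its centre suffice for these pairings, which is where delta
  enters.\<close>

lemma B_radical_right:
  assumes "2 \<le> i" "h \<in> lcs G i" "z \<in> center G"
  shows "B i h z = \<one>\<^bsub>CQ i\<^esub>"
proof -
  obtain e where e: "e \<in> lcs E i" "e \<in> carrier E" "\<pi> e = h" using lift_lcs[OF assms(2)] .
  have "z \<in> carrier G" using assms(3) G.center_subset by auto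
  then obtain y where y: "y \<in> carrier E" "\<pi> y = z" using lift by blast
  have "e \<in> lcs E 2" using e E.lcs_antimono[OF assms(1)] by auto
  hence "commutator E e y = \<one>" using lift_center_commutes[OF y(1)] y assms by simp
  moreover have "B i h z = \<phi> i (commutator E e y)" using e y \<kappa>_\<pi>[of e y] by (simp add: B_def)
  moreover have "\<phi> i \<one> = \<one>\<^bsub>Q i\<^esub>" using group_hom.hom_one[OF \<phi>_hom] by simp
  ultimately show ?thesis by simp
qed

lemma B_self: "g \<in> carrier G \<Longrightarrow> B i g g = \<one>\<^bsub>CQ i\<^esub>"
  using group_hom.hom_one[OF \<phi>_hom] \<sigma> by (simp add: B_def \<kappa>_def E.commutator_self)

definition im where "im i = generate (CQ i) {B i h y | h y. h \<in> lcs G i \<and> y \<in> carrier G}"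

text \<open>On gamma_{i+1}(E) the map \<open>\<phi> i\<close> has kernel gamma_{i+2}(E), and it
  sends the generating commutators to values of \<open>B i\<close>.\<close>

lemma card_lcs_step:
  assumes i: "0 < i" and fin: "finite (lcs E (Suc (Suc i)))" "finite (im i)"
  shows "finite (lcs E (Suc i))" "card (lcs E (Suc i)) \<le> card (im i) * card (lcs E (Suc (Suc i)))"
proof -
  interpret phi: group_hom E "Q i" "\<phi> i" by (rule \<phi>_hom)
  interpret b: bihom G "CQ i" "lcs G i" "B i" by (rule B_bihom[OF i])
  let ?X = "\<Union>a\<in>lcs E i. \<Union>b\<in>carrier E. {commutator E a b}"
  let ?Y = "{B i h y | h y. h \<in> lcs G i \<and> y \<in> carrier G}"
  have sub: "?X \<subseteq> carrier E" using E.lcs_carrier by blast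
  have YC: "?Y \<subseteq> center (Q i)" using b.B_closed by auto
  have "\<phi> i ` ?X \<subseteq> ?Y"
  proof clarify
    fix a b assume ab: "a \<in> lcs E i" "b \<in> carrier E"
    have "a \<in> carrier E" using ab E.lcs_carrier by auto
    hence "\<phi> i (commutator E a b) = B i (\<pi> a) (\<pi> b)" using ab by (simp add: B_def \<kappa>_\<pi>)
    moreover have "\<pi> a \<in> lcs G i" using ab pi.image_lcs[OF surj, of i] by blast
    moreover have "\<pi> b \<in> carrier G" using ab by simp
    ultimately show "\<exists>h y. \<phi> i (commutator E a b) = B i h y \<and> h \<in> lcs G i \<and> y \<in> carrier G"
      by (intro exI[of _ "\<pi> a"] exI[of _ "\<pi> b"] conjI)
  qed
  hence "generate (Q i) (\<phi> i ` ?X) \<subseteq> generate (Q i) ?Y" by (rule phi.H.mono_generate)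
  moreover have "generate (Q i) ?Y = im i"
    unfolding im_def CQ_def by (rule phi.H.generate_consistent[symmetric, OF YC phi.H.center_subgroup])
  ultimately have img: "\<phi> i ` lcs E (Suc i) \<subseteq> im i"
    using phi.generate_img[OF sub] i by (simp add: E.lcs_Suc E.comm_subgroup_eq)
  have ker: "{x \<in> lcs E (Suc i). \<phi> i x = \<one>\<^bsub>Q i\<^esub>} = lcs E (Suc (Suc i))"
    using \<phi>_eq_one_iff E.lcs_carrier E.lcs_Suc_subset[of "Suc i"] by blast
  have finI: "finite (\<phi> i ` lcs E (Suc i))" using img fin(2) finite_subset by blast
  note ck = phi.card_image_kernel[OF E.lcs_subgroup finI, unfolded ker, OF fin(1)]
  show "finite (lcs E (Suc i))" by (rule ck(1))
  show "card (lcs E (Suc i)) \<le> card (im i) * card (lcs E (Suc (Suc i)))"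
    using ck(2) card_mono[OF fin(2) img] by simp
qed

text \<open>Triple commutators are central in E/gamma_4(E), so the Jacobi identity applies to lifts
  there. The middle term is written with the inverse of [a,c] so that each commutator has its
  arguments in the order a, b, c.\<close>

lemma B_jacobi:
  assumes "a \<in> carrier G" "b \<in> carrier G" "c \<in> carrier G"
  shows "B 2 (commutator G b c) a \<otimes>\<^bsub>CQ 2\<^esub> (B 2 (inv\<^bsub>G\<^esub> commutator G a c) b
    \<otimes>\<^bsub>CQ 2\<^esub> B 2 (commutator G a b) c) = \<one>\<^bsub>CQ 2\<^esub>"
proof -
  interpret phi: group_hom E "Q 2" "\<phi> 2" by (rule \<phi>_hom)
  obtain u v w where uvw: "u \<in> carrier E" "\<pi> u = a" "v \<in> carrier E" "\<pi> v = b" "w \<in> carrier E" "\<pi> w = c"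
    using assms by (meson lift)
  have BB: "B 2 (commutator G (\<pi> p) (\<pi> q)) (\<pi> r)
      = commutator (Q 2) (commutator (Q 2) (\<phi> 2 p) (\<phi> 2 q)) (\<phi> 2 r)"
    if "p \<in> carrier E" "q \<in> carrier E" "r \<in> carrier E" for p q r
    using B_\<pi>[of "commutator E p q" r 2] that by (simp add: pi.hom_commutator phi.hom_commutator)
  have cen: "commutator (Q 2) (commutator (Q 2) p q) r \<in> center (Q 2)"
    if "p \<in> carrier (Q 2)" "q \<in> carrier (Q 2)" "r \<in> carrier (Q 2)" for p q r
  proof -
    have "commutator (Q 2) (commutator (Q 2) p q) r \<in> lcs (Q 2) 3"
      unfolding numeral_3_eq_3 using that
      by (intro phi.H.commutator_lcs) auto
    then obtain e where "e \<in> lcs E 3" "commutator (Q 2) (commutator (Q 2) p q) r = \<phi> 2 e"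
      using phi.image_lcs[OF \<phi>_surj, of 3] by blast
    thus ?thesis using \<phi>_central[of e 2] by (simp add: numeral_3_eq_3 numeral_2_eq_2)
  qed
  have "inv\<^bsub>G\<^esub> commutator G a c = commutator G c a" using assms by (simp add: G.inv_commutator)
  thus ?thesis
    using phi.H.jacobi_identity[OF cen, of "\<phi> 2 u" "\<phi> 2 v" "\<phi> 2 w"] uvw BB by auto
qed

end

section \<open>The order of the commutator subgroup of a central extension\<close>

lemma min_gens_le:
  assumes "S \<subseteq> carrier K" "finite S" "generate K S = carrier K"
  shows "min_gens K \<le> card S"
  unfolding min_gens_def by (rule Least_le) (use assms in blast)

context jacobi_pairing
begin

lemma finite_subsets_set: "finite (subsets m)"
  by (rule finite_subset[of _ "Pow {..<\<delta>}"]) (auto simp: subsets_def)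

lemma card_subsets: "card (subsets m) = \<delta> choose m"
  unfolding subsets_def using n_subsets[of "{..<\<delta>}" m] by simp

text \<open>Descent along the code: a pair that is not standard is generated, modulo
  \<open>N\<close>, by strictly smaller pairs.\<close>

lemma mem_generate_standard:
  assumes "P \<in> subsets 2"
  shows "w P \<in> generate G (N \<union> w ` {P. standard P})"
  using assms
proof (induction "set_encode P" arbitrary: P rule: less_induct)
  case less
  let ?K = "generate G (N \<union> w ` {P. standard P})"
  have K: "subgroup ?K G"
    using N(2) wH subgroup.subset[OF H] by (intro G.generate_is_subgroup) auto
  show ?case
  proof (cases "standard P")
    case True thus ?thesis by (auto intro: generate.incl)
  next
    case False
    hence "w P \<in> lower P" using less.prems by (simp add: standard_def)
    moreover have "N \<union> w ` {Q \<in> subsets 2. set_encode Q < set_encode P} \<subseteq> ?K"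
      using less.hyps by (auto intro: generate.incl)
    ultimately show ?thesis
      unfolding lower_def using generate_mem_subgroup[OF G.is_group K] by blast
  qed
qed

lemma min_gens_le_card_standard:
  assumes nor: "N \<lhd> G" and genH: "H \<subseteq> generate G (N \<union> w ` subsets 2)"
  shows "min_gens (GH Mod N) \<le> card {P. standard P}"
proof -
  interpret GH: group GH by (rule GH_group)
  interpret N: normal N GH by (rule G.normal_restrict_supergroup[OF H nor N(2)])
  interpret Q: group "GH Mod N" by (rule N.factorgroup_is_group)
  interpret f: group_hom GH "GH Mod N" "\<lambda>a. N #>\<^bsub>GH\<^esub> a"
    by (rule group_hom.intro[OF GH_group Q.is_group]) (rule group_hom_axioms.intro[OF N.r_coset_hom_Mod])
  let ?f = "\<lambda>a. N #>\<^bsub>GH\<^esub> a"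
  let ?S = "?f ` w ` {P. standard P}"
  let ?K = "N \<union> w ` {P. standard P}"
  have fin: "finite {P. standard P}"
    using finite_subsets_set[of 2] by (rule finite_subset[rotated]) (auto simp: standard_def)
  have KH: "?K \<subseteq> H" using N(2) wH by auto
  have SQ: "?S \<subseteq> carrier (GH Mod N)" using wH by (auto simp: carrier_FactGroup)
  have KG: "?K \<subseteq> carrier G" using KH subgroup.subset[OF H] by auto
  have "N \<union> w ` subsets 2 \<subseteq> generate G ?K"
    using mem_generate_standard by (auto intro: generate.incl)
  hence "H \<subseteq> generate G ?K"
    using genH G.generate_subgroup_incl[OF _ G.generate_is_subgroup[OF KG]] by blast
  hence "generate GH ?K = H"
    using G.generate_consistent[OF KH H] G.generate_subgroup_incl[OF KH H] by simp
  hence "carrier (GH Mod N) = ?f ` generate GH ?K" by (simp add: carrier_FactGroup)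
  also have "\<dots> = generate (GH Mod N) (?f ` ?K)" using KH by (intro f.generate_img[symmetric]) simp
  also have "\<dots> \<subseteq> generate (GH Mod N) ?S"
  proof (rule Q.generate_subgroup_incl[OF _ Q.generate_is_subgroup[OF SQ]])
    have "?f a = \<one>\<^bsub>GH Mod N\<^esub>" if "a \<in> N" for a
      using that GH.coset_join2[OF _ N.subgroup_axioms, of a] N.subset by auto
    thus "?f ` ?K \<subseteq> generate (GH Mod N) ?S"
      by (auto intro: generate.incl generate.one simp del: one_FactGroup)
  qed
  finally have "generate (GH Mod N) ?S = carrier (GH Mod N)"
    using Q.generate_incl[OF SQ] by blast
  hence "min_gens (GH Mod N) \<le> card ?S" using SQ fin by (intro min_gens_le) auto
  also have "\<dots> \<le> card {P. standard P}"
    using fin card_image_le[OF fin, of w] card_image_le[of "w ` {P. standard P}" ?f]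
    by (meson finite_imageI order_trans)
  finally show ?thesis .
qed

text \<open>\<open>s\<close> counts the triples that contain a standard pair; every other triple is
  a triangle in the graph of non-standard pairs. The additive form of the first bound avoids
  truncated subtraction.\<close>

lemma card_im_kruskal_katona:
  assumes p: "Factorial_Ring.prime p" and HN: "card H = p ^ b * card N"
    and nor: "N \<lhd> G" and genH: "H \<subseteq> generate G (N \<union> w ` subsets 2)"
    and rt: "\<delta> choose 2 = min_gens (GH Mod N) + (r choose 2) + t" "t < r"
  shows "\<exists>s. \<delta> choose 3 \<le> s + (r choose 3) + (t choose 2)
    \<and> card im * (p ^ s * card N ^ \<delta>) \<le> card H ^ \<delta>"
proof (intro exI conjI)
  let ?S = "{T \<in> subsets 3. \<exists>c\<in>T. standard (T - {c})}"
  let ?N = "{P \<in> subsets 2. \<not> standard P}"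
  show "card im * (p ^ card ?S * card N ^ \<delta>) \<le> card H ^ \<delta>"
    by (rule card_im_jacobi(2)[OF p HN])
  have "subsets 2 = {P. standard P} \<union> ?N" by (auto simp: standard_def)
  moreover have "finite {P. standard P}" "finite ?N"
    using finite_subsets_set[of 2] by (auto simp: standard_def)
  moreover have "{P. standard P} \<inter> ?N = {}" by auto
  ultimately have "card (subsets 2) = card {P. standard P} + card ?N"
    using card_Un_disjoint by metis
  hence "card ?N \<le> (r choose 2) + t"
    using card_subsets[of 2] rt(1) min_gens_le_card_standard[OF nor genH] by linarith
  moreover have "\<And>e. e \<in> ?N \<Longrightarrow> card e = 2" by (auto simp: subsets_def)
  ultimately have tri: "finite (triangles ?N)" "card (triangles ?N) \<le> (r choose 3) + (t choose 2)"
    using card_triangles_le[OF \<open>finite ?N\<close> _ _ rt(2)] by auto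
  have "subsets 3 \<subseteq> ?S \<union> triangles ?N"
  proof
    fix T assume T: "T \<in> subsets 3"
    show "T \<in> ?S \<union> triangles ?N"
    proof (rule ccontr)
      assume c: "T \<notin> ?S \<union> triangles ?N"
      hence "T \<notin> triangles ?N" by simp
      then obtain e where e: "e \<subseteq> T" "card e = 2" "e \<notin> ?N"
        using T by (auto simp: triangles_def subsets_def)
      have finT: "finite T" using T finite_subsets by blast
      have "e \<in> subsets 2" using e T by (auto simp: subsets_def)
      hence st: "standard e" using e by auto
      have "card (T - e) = 1" using e T finT by (subst card_Diff_subset) (auto simp: subsets_def finite_subset)
      then obtain c where "T - e = {c}" by (auto simp: card_1_singleton_iff)
      hence "c \<in> T" "T - {c} = e" using e by auto
      thus False using c T st by auto
    qed
  qed
  moreover have "finite ?S" using finite_subsets_set[of 3] by auto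
  ultimately have "card (subsets 3) \<le> card (?S \<union> triangles ?N)" using tri by (intro card_mono) auto
  also have "\<dots> \<le> card ?S + card (triangles ?N)" by (rule card_Un_le)
  finally show "\<delta> choose 3 \<le> card ?S + (r choose 3) + (t choose 2)"
    using tri card_subsets[of 3] by linarith
qed

end

text \<open>For E = G the first pairing is the commutator form of G modulo gamma_3(G), so the
  results on alternating pairings apply to G itself.\<close>

lemma (in group) central_extension_id: "central_extension G G id"
proof -
  have "\<one> \<in> center G" by (rule centerI) auto
  thus ?thesis
    by (intro central_extension.intro central_extension_axioms.intro is_group) (auto simp: hom_def)
qed

text \<open>Modulo gamma_3(G) the commutator is an alternating pairing with the centre in its
  radical, so its values are generated by those on the \<open>x j\<close>. The error made lies in
  gamma_3(G), which \<open>K\<close> contains.\<close>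

lemma (in group) lcs_two_generated:
  fixes x :: "nat \<Rightarrow> 'a"
  assumes fin: "finite (carrier G)" and xG: "\<And>j. x j \<in> carrier G"
    and gen: "generate G (center G \<union> x ` {..<\<delta>}) = carrier G"
    and K: "subgroup K G" "lcs G 3 \<subseteq> K"
    and pairs: "\<And>a b. a < b \<Longrightarrow> b < \<delta> \<Longrightarrow> commutator G (x a) (x b) \<in> K"
  shows "lcs G 2 \<subseteq> K"
proof -
  interpret c: central_extension G G id by (rule central_extension_id)
  interpret phi: group_hom G "c.Q (Suc 0)" "c.\<phi> (Suc 0)" by (rule c.\<phi>_hom)
  have B: "c.B (Suc 0) g h = c.\<phi> (Suc 0) (commutator G g h)" if "g \<in> carrier G" "h \<in> carrier G" for g h
    using that c.\<kappa>_\<pi>[of g h] by (simp add: c.B_def)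
  have bh: "bihom G (c.CQ (Suc 0)) (carrier G) (c.B (Suc 0))" using c.B_bihom[of "Suc 0"] by simp
  interpret b: alternating G "c.CQ (Suc 0)" "c.B (Suc 0)" "center G"
  proof (intro alternating.intro bh alternating_axioms.intro center_subgroup fin)
    show "c.B (Suc 0) x x = \<one>\<^bsub>c.CQ (Suc 0)\<^esub>" if "x \<in> carrier G" for x using that by (rule c.B_self)
    fix l y assume ly: "l \<in> center G" "y \<in> carrier G"
    hence "l \<in> carrier G" using center_subset by blast
    hence "c.B (Suc 0) l y = c.\<phi> (Suc 0) \<one>" using B[of l y] commutator_center_left[OF ly] ly(2) by simp
    thus "c.B (Suc 0) l y = \<one>\<^bsub>c.CQ (Suc 0)\<^esub>" by simp
  qed
  let ?S = "x ` {..<\<delta>}"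
  let ?C = "(\<lambda>(s, t). commutator G s t) ` (?S \<times> ?S)"
  have C_sub: "?C \<subseteq> carrier G" using xG by auto
  have all: "commutator G (x a) (x b) \<in> K" if "a < \<delta>" "b < \<delta>" for a b
  proof (cases rule: linorder_cases[of a b])
    case less thus ?thesis using pairs that by simp
  next
    case equal thus ?thesis using xG subgroup.one_closed[OF K(1)] by (simp add: commutator_self)
  next
    case greater
    hence "inv (commutator G (x b) (x a)) \<in> K" using pairs that subgroup.m_inv_closed[OF K(1)] by simp
    thus ?thesis using xG by (simp add: inv_commutator)
  qed
  have CK: "generate G ?C \<subseteq> K" by (rule generate_subgroup_incl[OF _ K(1)]) (use all in auto)
  have "commutator G g h \<in> K" if gh: "g \<in> carrier G" "h \<in> carrier G" for g h
  proof -
    have "c.B (Suc 0) g h \<in> generate (c.CQ (Suc 0)) ((\<lambda>(s, t). c.B (Suc 0) s t) ` (?S \<times> ?S))"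
      using gh xG gen by (intro b.card_alternating_image(3)) auto
    also have "(\<lambda>(s, t). c.B (Suc 0) s t) ` (?S \<times> ?S) = c.\<phi> (Suc 0) ` ?C"
      unfolding image_image
    proof (rule image_cong[OF refl])
      fix v assume "v \<in> ?S \<times> ?S"
      then obtain i j where "v = (x i, x j)" by blast
      thus "(case v of (s, t) \<Rightarrow> c.B (Suc 0) s t) = c.\<phi> (Suc 0) (case v of (s, t) \<Rightarrow> commutator G s t)"
        using B[OF xG xG] by simp
    qed
    also have "generate (c.CQ (Suc 0)) (c.\<phi> (Suc 0) ` ?C) = generate (c.Q (Suc 0)) (c.\<phi> (Suc 0) ` ?C)"
      unfolding c.CQ_def
    proof (rule phi.H.generate_consistent[OF _ phi.H.center_subgroup])
      show "c.\<phi> (Suc 0) ` ?C \<subseteq> center (c.Q (Suc 0))"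
      proof
        fix q assume "q \<in> c.\<phi> (Suc 0) ` ?C"
        then obtain i j where "q = c.\<phi> (Suc 0) (commutator G (x i) (x j))" by auto
        thus "q \<in> center (c.Q (Suc 0))" using b.B_closed[OF xG xG, of i j] B[OF xG xG, of i j] by simp
      qed
    qed
    also have "\<dots> = c.\<phi> (Suc 0) ` generate G ?C" by (rule phi.generate_img[OF C_sub])
    finally have "c.\<phi> (Suc 0) (commutator G g h) \<in> c.\<phi> (Suc 0) ` generate G ?C"
      unfolding B[OF gh] .
    then obtain k where k: "k \<in> generate G ?C" "c.\<phi> (Suc 0) (commutator G g h) = c.\<phi> (Suc 0) k"
      by blast
    have kG: "k \<in> carrier G" using k generate_in_carrier[OF C_sub] by simp
    have "c.\<phi> (Suc 0) (commutator G g h \<otimes> inv k) = \<one>\<^bsub>c.Q (Suc 0)\<^esub>" using gh kG k by simp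
    hence "commutator G g h \<otimes> inv k \<in> lcs G 3"
      using c.\<phi>_eq_one_iff[of "commutator G g h \<otimes> inv k" "Suc 0"] gh kG by (simp add: numeral_3_eq_3)
    hence "commutator G g h \<otimes> inv k \<otimes> k \<in> K"
      using K CK k subgroup.m_closed[OF K(1)] by blast
    thus ?thesis using gh kG by (simp add: m_assoc)
  qed
  hence "comm_subgroup G (carrier G) (carrier G) \<subseteq> K" by (rule comm_subgroup_least[OF K(1)])
  thus ?thesis by (simp add: numeral_2_eq_2 lcs_Suc)
qed

context central_extension
begin

text \<open>For i = 1 the radical at hand is gamma_2(G), so generators of the whole of G enter; this
  is the source of the term (n-k)(d-1)/2.\<close>

lemma card_im_one:
  assumes fin: "finite (carrier G)" and S: "finite S" "S \<subseteq> carrier G" "generate G S = carrier G"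
  shows "finite (im 1)" "(card (im 1))\<^sup>2 * card (lcs G 2) ^ (card S - 1) \<le> card (carrier G) ^ (card S - 1)"
proof -
  have bh: "bihom G (CQ 1) (carrier G) (B 1)" using B_bihom[of 1] by simp
  interpret b: alternating G "CQ 1" "B 1" "lcs G 2"
  proof (intro alternating.intro bh alternating_axioms.intro G.lcs_subgroup fin)
    show "B 1 x x = \<one>\<^bsub>CQ 1\<^esub>" if "x \<in> carrier G" for x using that by (rule B_self)
    show "B 1 l y = \<one>\<^bsub>CQ 1\<^esub>" if "l \<in> lcs G 2" "y \<in> carrier G" for l y
      using that by (intro B_radical_left) (simp_all add: numeral_2_eq_2)
  qed
  have "carrier G \<subseteq> generate G (lcs G 2 \<union> S)" using S(3) G.mono_generate[of S "lcs G 2 \<union> S"] by auto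
  hence gen: "generate G (lcs G 2 \<union> S) = carrier G"
    using S(2) G.lcs_carrier[of 2] by (intro equalityI G.generate_incl) auto
  note W = b.card_alternating_image[OF S(1,2) gen]
  have sub: "im 1 \<subseteq> generate (CQ 1) ((\<lambda>(s, t). B 1 s t) ` (S \<times> S))"
    unfolding im_def by (rule b.C.generate_subgroup_incl[OF _ b.W_subgroup[OF S(2)]]) (use W(3) in auto)
  show "finite (im 1)" using sub W(1) finite_subset by blast
  have "(card (im 1))\<^sup>2 \<le> (card (generate (CQ 1) ((\<lambda>(s, t). B 1 s t) ` (S \<times> S))))\<^sup>2"
    using card_mono[OF W(1) sub] by (rule power_mono) simp
  thus "(card (im 1))\<^sup>2 * card (lcs G 2) ^ (card S - 1) \<le> card (carrier G) ^ (card S - 1)"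
    using W(2) mult_le_mono1 order_trans by blast
qed

lemma B_pairing:
  assumes fin: "finite (carrier G)" and i: "2 \<le> i" and xG: "\<And>j. x j \<in> carrier G"
    and gen: "generate G (center G \<union> x ` {..<\<delta>}) = carrier G"
  shows "pairing G (CQ i) (lcs G i) (B i) (lcs G (Suc i)) (center G) x \<delta>"
proof (intro pairing.intro pairing_axioms.intro)
  show "bihom G (CQ i) (lcs G i) (B i)" using i by (intro B_bihom) simp
  show "finite (lcs G i)" using fin G.lcs_carrier finite_subset by blast
qed (use assms B_radical_left B_radical_right G.lcs_subgroup G.lcs_Suc_subset G.center_subset in auto)

lemma pairing_im:
  assumes "pairing G (CQ i) (lcs G i) (B i) N Z x \<delta>"
  shows "pairing.im G (CQ i) (lcs G i) (B i) = im i"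
  unfolding pairing.im_def[OF assms] im_def ..

text \<open>Downward induction from a trivial term of G: each step contributes at most the delta-th
  power of the order of gamma_j(G)/gamma_{j+1}(G), and the product telescopes.\<close>

lemma card_lcs_bound:
  assumes fin: "finite (carrier G)" and xG: "\<And>j. x j \<in> carrier G"
    and gen: "generate G (center G \<union> x ` {..<\<delta>}) = carrier G"
    and nil: "lcs G m = {\<one>\<^bsub>G\<^esub>}" and i: "2 \<le> i"
  shows "finite (lcs E (Suc i)) \<and> card (lcs E (Suc i)) \<le> card (lcs G i) ^ \<delta>"
proof -
  define M where "M = max m i"
  have trivM: "lcs G M = {\<one>\<^bsub>G\<^esub>}"
    using G.lcs_antimono[of m M] nil subgroup.one_closed[OF G.lcs_subgroup[of M]] by (auto simp: M_def)
  have "i \<le> M" by (simp add: M_def)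
  thus ?thesis using i
  proof (induction rule: inc_induct)
    case base
    \<comment> \<open>Where gamma_M(G) is trivial, gamma_M(E) lies in the central kernel, so the
      next term of E vanishes.\<close>
    have "lcs E (Suc M) \<subseteq> {\<one>}"
    proof -
      have "commutator E a b \<in> {\<one>}" if ab: "a \<in> lcs E M" "b \<in> carrier E" for a b
      proof -
        have aE: "a \<in> carrier E" using ab E.lcs_carrier by auto
        have "\<pi> a \<in> lcs G M" using ab(1) pi.image_lcs[OF surj, of M] by blast
        hence "a \<in> center E" using trivM aE by (intro central) auto
        thus ?thesis using ab E.commutator_center_left by simp
      qed
      hence "comm_subgroup E (lcs E M) (carrier E) \<subseteq> {\<one>}"
        by (rule E.comm_subgroup_least[OF E.triv_subgroup])
      thus ?thesis using base by (simp add: E.lcs_Suc)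
    qed
    hence "lcs E (Suc M) = {\<one>}" using subgroup.one_closed[OF E.lcs_subgroup[of "Suc M"]] by auto
    thus ?case using trivM by simp
  next
    case (step j)
    have j: "2 \<le> j" using step by simp
    have IH: "finite (lcs E (Suc (Suc j)))" "card (lcs E (Suc (Suc j))) \<le> card (lcs G (Suc j)) ^ \<delta>"
      using step j by auto
    interpret P: pairing G "CQ j" "lcs G j" "B j" "lcs G (Suc j)" "center G" x \<delta>
      using fin j xG gen by (rule B_pairing)
    have im: "P.im = im j" by (rule pairing_im[OF P.pairing_axioms])
    note c = P.card_im_le[unfolded im]
    have jj: "0 < j" using j by simp
    note s = card_lcs_step[OF jj IH(1) c(1)]
    have "card (lcs E (Suc j)) \<le> card (im j) * card (lcs G (Suc j)) ^ \<delta>"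
      using s(2) IH(2) by (meson mult_le_mono2 order_trans)
    thus ?case using s(1) c(2) by simp
  qed
qed

lemma card_lcs_two_bound:
  assumes fin: "finite (carrier G)" and p: "Factorial_Ring.prime p"
    and n: "card (carrier G) = p ^ n" and k: "card (lcs G 2) = p ^ k"
    and S: "finite S" "S \<subseteq> carrier G" "generate G S = carrier G"
    and xG: "\<And>j. x j \<in> carrier G" and gen: "generate G (center G \<union> x ` {..<\<delta>}) = carrier G"
    and nil: "lcs G m = {\<one>\<^bsub>G\<^esub>}"
    and rt: "\<delta> choose 2 = min_gens (G\<lparr>carrier := lcs G 2\<rparr> Mod lcs G 3) + (r choose 2) + t" "t < r"
  shows "\<exists>s. \<delta> choose 3 \<le> s + (r choose 3) + (t choose 2) \<and> finite (lcs E 2)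
    \<and> (card (lcs E 2) * p ^ s)\<^sup>2 * p ^ (k * (card S - 1)) \<le> p ^ (n * (card S - 1) + 2 * (k * \<delta>))"
proof -
  \<comment> \<open>Encodes [x_a, x_b] for a < b as a function of the set {a, b}. On sets that are
    not pairs the value is irrelevant, but it still lies in gamma_2(G) because \<open>x\<close>
    takes all its values in G.\<close>
  let ?w = "\<lambda>P :: nat set. commutator G (x (Min P)) (x (Max P))"
  have three: "Suc 2 = (3::nat)" by simp
  have P: "pairing G (CQ 2) (lcs G 2) (B 2) (lcs G 3) (center G) x \<delta>"
    using B_pairing[OF fin _ xG gen, of 2] unfolding three by simp
  have w2: "?w P \<in> lcs G 2" for P
    using G.commutator_lcs[of 1 "x (Min P)" "x (Max P)"] xG by (simp add: numeral_2_eq_2)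
  interpret J: jacobi_pairing G "CQ 2" "lcs G 2" "B 2" "lcs G 3" "center G" x \<delta> ?w
  proof (intro jacobi_pairing.intro P jacobi_pairing_axioms.intro w2)
    fix a b c assume "a < b" "b < c" "c < \<delta>"
    moreover from this have "Min {a, b} = a" "Max {a, b} = b" "Min {b, c} = b" "Max {b, c} = c"
      "Min {a, c} = a" "Max {a, c} = c" by auto
    ultimately show "B 2 (?w {b, c}) (x a) \<otimes>\<^bsub>CQ 2\<^esub> (B 2 (inv\<^bsub>G\<^esub> (?w {a, c})) (x b)
        \<otimes>\<^bsub>CQ 2\<^esub> B 2 (?w {a, b}) (x c)) = \<one>\<^bsub>CQ 2\<^esub>"
      using B_jacobi[OF xG xG xG] by simp
  qed
  have im: "J.im = im 2" by (rule pairing_im[OF P])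
  have sub32: "lcs G 3 \<subseteq> lcs G 2" using G.lcs_Suc_subset[of 2] unfolding three .
  have "lcs G 3 \<union> ?w ` J.subsets 2 \<subseteq> carrier G" using G.lcs_carrier w2 by blast
  hence genS: "subgroup (generate G (lcs G 3 \<union> ?w ` J.subsets 2)) G" by (rule G.generate_is_subgroup)
  have genH: "lcs G 2 \<subseteq> generate G (lcs G 3 \<union> ?w ` J.subsets 2)"
  proof (rule G.lcs_two_generated[OF fin xG gen genS])
    show "lcs G 3 \<subseteq> generate G (lcs G 3 \<union> ?w ` J.subsets 2)" by (auto intro: generate.incl)
    fix a b assume ab: "a < b" "b < \<delta>"
    have eq: "?w {a, b} = commutator G (x a) (x b)" using ab by auto
    have "{a, b} \<in> J.subsets 2" using ab by (auto simp: J.subsets_def)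
    hence "?w {a, b} \<in> generate G (lcs G 3 \<union> ?w ` J.subsets 2)"
      by (intro generate.incl UnI2 imageI)
    thus "commutator G (x a) (x b) \<in> generate G (lcs G 3 \<union> ?w ` J.subsets 2)"
      unfolding eq .
  qed
  obtain l where l: "card (lcs G 2) = card (lcs G 3) * l"
    using G.subgroup_card_dvd[OF G.lcs_subgroup G.lcs_subgroup sub32] by auto
  hence "l dvd p ^ k" using k by (metis dvd_triv_right)
  then obtain b where "l = p ^ b" using divides_primepow_nat[OF p] by blast
  hence HN: "card (lcs G 2) = p ^ b * card (lcs G 3)" using l by simp
  obtain s where s: "\<delta> choose 3 \<le> s + (r choose 3) + (t choose 2)"
      "card (im 2) * (p ^ s * card (lcs G 3) ^ \<delta>) \<le> card (lcs G 2) ^ \<delta>"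
    using J.card_im_kruskal_katona[OF p HN G.lcs_normal genH rt] unfolding im by blast
  \<comment> \<open>Jacobi relations sharpen only the factor gamma_3(E)/gamma_4(E); below it the
    telescoped bound is enough.\<close>
  have E4: "finite (lcs E 4)" "card (lcs E 4) \<le> card (lcs G 3) ^ \<delta>"
    using card_lcs_bound[OF fin xG gen nil, of 3] by simp_all
  have fin2: "finite (im 2)" using J.card_im_le(1) unfolding im .
  have E3: "finite (lcs E 3)" "card (lcs E 3) \<le> card (im 2) * card (lcs E 4)"
    using card_lcs_step[of 2] E4 fin2 by simp_all
  note im1 = card_im_one[OF fin S]
  have E2: "finite (lcs E 2)" "card (lcs E 2) \<le> card (im 1) * card (lcs E 3)"
    using card_lcs_step[of 1] E3 im1 by (simp_all add: numeral_2_eq_2 numeral_3_eq_3)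
  have "card (lcs E 3) * p ^ s \<le> card (im 2) * (p ^ s * card (lcs G 3) ^ \<delta>)"
  proof -
    have "card (lcs E 3) * p ^ s \<le> card (im 2) * card (lcs E 4) * p ^ s" using E3(2) by (rule mult_le_mono1)
    also have "\<dots> \<le> card (im 2) * card (lcs G 3) ^ \<delta> * p ^ s"
      using E4(2) by (intro mult_le_mono1 mult_le_mono2)
    finally show ?thesis by (simp add: ac_simps)
  qed
  also have "\<dots> \<le> card (lcs G 2) ^ \<delta>" by (rule s(2))
  also have "\<dots> = p ^ (k * \<delta>)" using k by (simp add: power_mult)
  finally have E3s: "card (lcs E 3) * p ^ s \<le> p ^ (k * \<delta>)" .
  have "(card (lcs E 2) * p ^ s)\<^sup>2 * p ^ (k * (card S - 1))
      \<le> (card (im 1) * (card (lcs E 3) * p ^ s))\<^sup>2 * p ^ (k * (card S - 1))"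
    using E2(2) mult_le_mono1[OF E2(2), of "p ^ s"]
    by (intro mult_le_mono1 power_mono) (simp_all add: mult.assoc)
  also have "\<dots> = ((card (im 1))\<^sup>2 * card (lcs G 2) ^ (card S - 1)) * (card (lcs E 3) * p ^ s)\<^sup>2"
    using k by (simp add: power_mult power_mult_distrib mult_ac)
  also have "\<dots> \<le> card (carrier G) ^ (card S - 1) * (p ^ (k * \<delta>))\<^sup>2"
    using im1(2) power_mono[OF E3s, of 2] by (intro mult_le_mono) simp_all
  also have "\<dots> = p ^ (n * (card S - 1) + 2 * (k * \<delta>))"
    using n by (simp add: power_add power_mult[symmetric] mult_ac)
  finally show ?thesis using s(1) E2(1) by blast
qed

end

section \<open>The extension by chains modulo boundaries\<close>

locale cocycle = A: comm_group A + G: group G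
  for A :: "('c, 'd) monoid_scheme" and G :: "('a, 'b) monoid_scheme" (structure) +
  fixes f :: "'a \<Rightarrow> 'a \<Rightarrow> 'c"
  assumes f_closed [simp, intro]: "g \<in> carrier G \<Longrightarrow> h \<in> carrier G \<Longrightarrow> f g h \<in> carrier A"
    and f_cocycle: "g \<in> carrier G \<Longrightarrow> h \<in> carrier G \<Longrightarrow> k \<in> carrier G \<Longrightarrow>
      f h k \<otimes>\<^bsub>A\<^esub> f g (h \<otimes> k) = f (g \<otimes> h) k \<otimes>\<^bsub>A\<^esub> f g h"
begin

text \<open>The cocycle is not assumed normalized: in the application the class of [1|1] is not
  trivial, since [1|1] is not a cycle. Hence the unit has first component f(1,1)^-1, and the
  embedding \<open>inc\<close> of the kernel carries the same correction.\<close>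

definition ext where
  "ext = \<lparr>carrier = carrier A \<times> carrier G,
    monoid.mult = (\<lambda>x y. (fst x \<otimes>\<^bsub>A\<^esub> fst y \<otimes>\<^bsub>A\<^esub> f (snd x) (snd y), snd x \<otimes> snd y)),
    one = (inv\<^bsub>A\<^esub> f \<one> \<one>, \<one>)\<rparr>"

lemma f_one_left: "h \<in> carrier G \<Longrightarrow> f \<one> h = f \<one> \<one>"
  using f_cocycle[of \<one> \<one> h] by simp

lemma f_one_right: "g \<in> carrier G \<Longrightarrow> f g \<one> = f \<one> \<one>"
  using f_cocycle[of g \<one> \<one>] by simp

lemma ext_carrier: "carrier ext = carrier A \<times> carrier G"
  by (simp add: ext_def)

lemma ext_mult: "(a, g) \<otimes>\<^bsub>ext\<^esub> (b, h) = (a \<otimes>\<^bsub>A\<^esub> b \<otimes>\<^bsub>A\<^esub> f g h, g \<otimes> h)"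
  by (simp add: ext_def)

lemma ext_one: "\<one>\<^bsub>ext\<^esub> = (inv\<^bsub>A\<^esub> f \<one> \<one>, \<one>)"
  by (simp add: ext_def)

lemma ext_group: "group ext"
proof (rule groupI)
  show "\<one>\<^bsub>ext\<^esub> \<in> carrier ext" by (simp add: ext_carrier ext_one)
next
  fix x y assume "x \<in> carrier ext" "y \<in> carrier ext"
  thus "x \<otimes>\<^bsub>ext\<^esub> y \<in> carrier ext" by (cases x, cases y) (simp add: ext_carrier ext_mult)
next
  fix x y z assume xyz: "x \<in> carrier ext" "y \<in> carrier ext" "z \<in> carrier ext"
  obtain a g b h c k where e: "x = (a, g)" "y = (b, h)" "z = (c, k)"
    by (cases x, cases y, cases z)
  have c: "a \<in> carrier A" "b \<in> carrier A" "c \<in> carrier A" "g \<in> carrier G" "h \<in> carrier G" "k \<in> carrier G"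
    using xyz e by (auto simp: ext_carrier)
  have m: "f h k \<in> carrier A" "f g (h \<otimes> k) \<in> carrier A" "f (g \<otimes> h) k \<in> carrier A" "f g h \<in> carrier A"
    using c by auto
  have "a \<otimes>\<^bsub>A\<^esub> b \<otimes>\<^bsub>A\<^esub> f g h \<otimes>\<^bsub>A\<^esub> c \<otimes>\<^bsub>A\<^esub> f (g \<otimes> h) k
      = a \<otimes>\<^bsub>A\<^esub> b \<otimes>\<^bsub>A\<^esub> c \<otimes>\<^bsub>A\<^esub> (f (g \<otimes> h) k \<otimes>\<^bsub>A\<^esub> f g h)"
    using c m by (simp add: A.m_ac)
  also have "\<dots> = a \<otimes>\<^bsub>A\<^esub> b \<otimes>\<^bsub>A\<^esub> c \<otimes>\<^bsub>A\<^esub> (f h k \<otimes>\<^bsub>A\<^esub> f g (h \<otimes> k))"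
    using f_cocycle[OF c(4-6)] by simp
  also have "\<dots> = a \<otimes>\<^bsub>A\<^esub> (b \<otimes>\<^bsub>A\<^esub> c \<otimes>\<^bsub>A\<^esub> f h k) \<otimes>\<^bsub>A\<^esub> f g (h \<otimes> k)"
    using c m by (simp add: A.m_ac)
  finally show "x \<otimes>\<^bsub>ext\<^esub> y \<otimes>\<^bsub>ext\<^esub> z = x \<otimes>\<^bsub>ext\<^esub> (y \<otimes>\<^bsub>ext\<^esub> z)"
    using c by (simp add: e ext_mult G.m_assoc)
next
  fix x assume "x \<in> carrier ext"
  then obtain b h where e: "x = (b, h)" "b \<in> carrier A" "h \<in> carrier G" by (auto simp: ext_carrier)
  have "inv\<^bsub>A\<^esub> f \<one> \<one> \<otimes>\<^bsub>A\<^esub> b \<otimes>\<^bsub>A\<^esub> f \<one> \<one> = b"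
    using e A.m_comm[of "inv\<^bsub>A\<^esub> f \<one> \<one>" b] by (simp add: A.m_assoc)
  thus "\<one>\<^bsub>ext\<^esub> \<otimes>\<^bsub>ext\<^esub> x = x" using e f_one_left[of h] by (simp add: ext_one ext_mult)
next
  fix x assume "x \<in> carrier ext"
  then obtain a g where e: "x = (a, g)" "a \<in> carrier A" "g \<in> carrier G" by (auto simp: ext_carrier)
  let ?b = "inv\<^bsub>A\<^esub> f \<one> \<one> \<otimes>\<^bsub>A\<^esub> inv\<^bsub>A\<^esub> (a \<otimes>\<^bsub>A\<^esub> f (inv g) g)"
  have "?b \<otimes>\<^bsub>A\<^esub> a \<otimes>\<^bsub>A\<^esub> f (inv g) g = inv\<^bsub>A\<^esub> f \<one> \<one>"
    using e by (simp add: A.m_assoc)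
  hence "(?b, inv g) \<otimes>\<^bsub>ext\<^esub> x = \<one>\<^bsub>ext\<^esub>" using e by (simp add: ext_mult ext_one)
  moreover have "(?b, inv g) \<in> carrier ext" using e by (simp add: ext_carrier)
  ultimately show "\<exists>y\<in>carrier ext. y \<otimes>\<^bsub>ext\<^esub> x = \<one>\<^bsub>ext\<^esub>" by blast
qed

lemma ext_central_extension: "central_extension ext G snd"
proof (intro central_extension.intro central_extension_axioms.intro ext_group G.is_group)
  show "snd \<in> hom ext G" by (auto simp: hom_def ext_carrier ext_mult)
  show "snd ` carrier ext = carrier G" using A.one_closed by (force simp: ext_carrier)
  fix e assume "e \<in> carrier ext" "snd e = \<one>"
  then obtain a where a: "e = (a, \<one>)" "a \<in> carrier A" by (auto simp: ext_carrier)
  show "e \<in> center ext"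
  proof (rule group.centerI[OF ext_group \<open>e \<in> carrier ext\<close>])
    fix y assume "y \<in> carrier ext"
    then obtain b h where y: "y = (b, h)" "b \<in> carrier A" "h \<in> carrier G" by (auto simp: ext_carrier)
    thus "e \<otimes>\<^bsub>ext\<^esub> y = y \<otimes>\<^bsub>ext\<^esub> e"
      using a f_one_left[of h] f_one_right[of h] A.m_comm[of a b] by (simp add: ext_mult)
  qed
qed

definition inc where "inc a = (a \<otimes>\<^bsub>A\<^esub> inv\<^bsub>A\<^esub> f \<one> \<one>, \<one>)"

lemma inc_hom: "inc \<in> hom A ext"
proof (rule homI)
  fix a b assume ab: "a \<in> carrier A" "b \<in> carrier A"
  define u where "u = f \<one> \<one>"
  have u: "u \<in> carrier A" by (simp add: u_def)
  have "a \<otimes>\<^bsub>A\<^esub> inv\<^bsub>A\<^esub> u \<otimes>\<^bsub>A\<^esub> (b \<otimes>\<^bsub>A\<^esub> inv\<^bsub>A\<^esub> u) \<otimes>\<^bsub>A\<^esub> u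
      = a \<otimes>\<^bsub>A\<^esub> inv\<^bsub>A\<^esub> u \<otimes>\<^bsub>A\<^esub> b" using ab u by (simp add: A.m_assoc)
  also have "\<dots> = a \<otimes>\<^bsub>A\<^esub> b \<otimes>\<^bsub>A\<^esub> inv\<^bsub>A\<^esub> u" using ab u by (simp add: A.m_ac)
  finally show "inc (a \<otimes>\<^bsub>A\<^esub> b) = inc a \<otimes>\<^bsub>ext\<^esub> inc b"
    by (simp add: inc_def ext_mult u_def)
qed (simp add: inc_def ext_carrier)

lemma inc_inj: "a \<in> carrier A \<Longrightarrow> b \<in> carrier A \<Longrightarrow> inc a = inc b \<Longrightarrow> a = b"
  by (simp add: inc_def)

text \<open>Identifies \<open>f\<close> as the cocycle of the section g -> (1, g), the form in which
  it is passed to the abelianization.\<close>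

lemma section_mult:
  assumes "g \<in> carrier G" "h \<in> carrier G"
  shows "(\<one>\<^bsub>A\<^esub>, g) \<otimes>\<^bsub>ext\<^esub> (\<one>\<^bsub>A\<^esub>, h) = inc (f g h) \<otimes>\<^bsub>ext\<^esub> (\<one>\<^bsub>A\<^esub>, g \<otimes> h)"
  using assms f_one_left[of "g \<otimes> h"] by (simp add: ext_mult inc_def A.m_assoc)

end

section \<open>Integral 2-chains of the bar complex\<close>

definition chain_group :: "('a, 'b) monoid_scheme \<Rightarrow> ('a \<times> 'a \<Rightarrow> int) monoid" where
  "chain_group G = \<lparr>carrier = chains2 G, monoid.mult = (\<lambda>c c' z. c z + c' z), one = (\<lambda>_. 0)\<rparr>"

definition single :: "'z \<Rightarrow> 'z \<Rightarrow> int" where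
  "single z = (\<lambda>w. if w = z then 1 else 0)"

lemma chain_group_simps [simp]:
  "carrier (chain_group G) = chains2 G"
  "c \<otimes>\<^bsub>chain_group G\<^esub> c' = (\<lambda>z. c z + c' z)"
  "\<one>\<^bsub>chain_group G\<^esub> = (\<lambda>_. 0)"
  by (simp_all add: chain_group_def)

lemma chain_group: "comm_group (chain_group G)"
proof (rule comm_groupI)
  fix c assume c: "c \<in> carrier (chain_group G)"
  thus "\<exists>y\<in>carrier (chain_group G). y \<otimes>\<^bsub>chain_group G\<^esub> c = \<one>\<^bsub>chain_group G\<^esub>"
    by (intro bexI[of _ "\<lambda>z. - c z"]) (auto simp: chains2_def)
qed (auto simp: chains2_def add.assoc add.commute)

lemma chain_group_inv: "c \<in> chains2 G \<Longrightarrow> inv\<^bsub>chain_group G\<^esub> c = (\<lambda>z. - c z)"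
proof -
  assume c: "c \<in> chains2 G"
  interpret comm_group "chain_group G" by (rule chain_group)
  show ?thesis by (rule inv_equality) (use c in \<open>auto simp: chains2_def\<close>)
qed

lemma sum_single:
  assumes "finite S" "s \<in> S"
  shows "(\<Sum>y\<in>S. single s y * F y) = F s"
proof -
  have "(\<Sum>y\<in>S. single s y * F y) = (\<Sum>y\<in>S. if y = s then F y else 0)"
    by (intro sum.cong) (auto simp: single_def)
  thus ?thesis using assms by simp
qed

context group
begin

lemma single_chains2: "g \<in> carrier G \<Longrightarrow> h \<in> carrier G \<Longrightarrow> single (g, h) \<in> chains2 G"
  by (auto simp: chains2_def single_def)

lemma bar_d3_add: "bar_d3 G (\<lambda>z. c z + c' z) = (\<lambda>x. bar_d3 G c x + bar_d3 G c' x)"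
  unfolding bar_d3_def by (intro ext) (simp add: sum.distrib[symmetric] split_beta algebra_simps)

lemma bar_d3_minus: "bar_d3 G (\<lambda>z. - c z) = (\<lambda>x. - bar_d3 G c x)"
  unfolding bar_d3_def by (intro ext) (simp add: sum_negf[symmetric] split_beta algebra_simps)

lemma bar_d2_add: "bar_d2 G (\<lambda>z. c z + c' z) = (\<lambda>x. bar_d2 G c x + bar_d2 G c' x)"
  unfolding bar_d2_def by (intro ext) (simp add: sum.distrib[symmetric] split_beta algebra_simps)

lemma bar_d3_single:
  assumes fin: "finite (carrier G)" and c: "g \<in> carrier G" "h \<in> carrier G" "k \<in> carrier G"
  shows "bar_d3 G (single (g, h, k)) = (\<lambda>x. single (h, k) x - single (g \<otimes> h, k) x
    + single (g, h \<otimes> k) x - single (g, h) x)"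
proof
  fix x
  let ?F = "\<lambda>(g, h, k). ((if (h,k) = x then 1 else 0) - (if (g \<otimes> h, k) = x then 1 else 0)
                    + (if (g, h \<otimes> k) = x then 1 else 0) - (if (g,h) = x then 1 else 0)) :: int"
  have "bar_d3 G (single (g, h, k)) x = (\<Sum>y\<in>carrier G \<times> carrier G \<times> carrier G. single (g, h, k) y * ?F y)"
    unfolding bar_d3_def by (intro sum.cong) auto
  also have "\<dots> = ?F (g, h, k)" using fin c by (intro sum_single) auto
  finally show "bar_d3 G (single (g, h, k)) x = single (h, k) x - single (g \<otimes> h, k) x
    + single (g, h \<otimes> k) x - single (g, h) x" by (auto simp: single_def)
qed

lemma bar_d2_single:
  assumes fin: "finite (carrier G)" and c: "g \<in> carrier G" "h \<in> carrier G"
  shows "bar_d2 G (single (g, h)) = (\<lambda>x. single h x - single (g \<otimes> h) x + single g x)"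
proof
  fix x
  let ?F = "\<lambda>(g, h). ((if h = x then 1 else 0) - (if g \<otimes> h = x then 1 else 0)
                    + (if g = x then 1 else 0)) :: int"
  have "bar_d2 G (single (g, h)) x = (\<Sum>y\<in>carrier G \<times> carrier G. single (g, h) y * ?F y)"
    unfolding bar_d2_def by (intro sum.cong) auto
  also have "\<dots> = ?F (g, h)" using fin c by (intro sum_single) auto
  finally show "bar_d2 G (single (g, h)) x = single h x - single (g \<otimes> h) x + single g x"
    by (auto simp: single_def)
qed

lemma bar_d3_chains2: "bar_d3 G c \<in> chains2 G"
proof -
  have "bar_d3 G c x = 0" if x: "x \<notin> carrier G \<times> carrier G" for x
    unfolding bar_d3_def
  proof (rule sum.neutral, rule ballI)
    fix y assume "y \<in> carrier G \<times> carrier G \<times> carrier G"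
    then obtain g h k where y: "y = (g, h, k)" "g \<in> carrier G" "h \<in> carrier G" "k \<in> carrier G"
      by auto
    hence "(h, k) \<noteq> x" "(g \<otimes> h, k) \<noteq> x" "(g, h \<otimes> k) \<noteq> x" "(g, h) \<noteq> x" using x by auto
    thus "(case y of (g, h, k) \<Rightarrow> c (g, h, k) * ((if (h, k) = x then 1 else 0)
        - (if (g \<otimes> h, k) = x then 1 else 0) + (if (g, h \<otimes> k) = x then 1 else 0)
        - (if (g, h) = x then 1 else 0))) = 0" using y(1) by simp
  qed
  thus ?thesis by (simp add: chains2_def)
qed

lemma boundaries2_subgroup: "subgroup (boundaries2 G) (chain_group G)"
proof (rule group.subgroupI)
  show "Group.group (chain_group G)" using chain_group[of G] by (rule comm_group.axioms(2))
  show "boundaries2 G \<subseteq> carrier (chain_group G)" using bar_d3_chains2 by (auto simp: boundaries2_def)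
  have "(\<lambda>_. 0) \<in> chains3 G" by (simp add: chains3_def)
  thus "boundaries2 G \<noteq> {}" by (auto simp: boundaries2_def)
next
  fix b assume "b \<in> boundaries2 G"
  then obtain c where c: "c \<in> chains3 G" "b = bar_d3 G c" by (auto simp: boundaries2_def)
  have "inv\<^bsub>chain_group G\<^esub> b = bar_d3 G (\<lambda>z. - c z)"
    using c bar_d3_chains2 by (simp add: chain_group_inv bar_d3_minus)
  moreover have "(\<lambda>z. - c z) \<in> chains3 G" using c by (simp add: chains3_def)
  ultimately show "inv\<^bsub>chain_group G\<^esub> b \<in> boundaries2 G" by (auto simp: boundaries2_def)
next
  fix b b' assume "b \<in> boundaries2 G" "b' \<in> boundaries2 G"
  then obtain c c' where c: "c \<in> chains3 G" "b = bar_d3 G c" "c' \<in> chains3 G" "b' = bar_d3 G c'"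
    by (auto simp: boundaries2_def)
  have "b \<otimes>\<^bsub>chain_group G\<^esub> b' = bar_d3 G (\<lambda>z. c z + c' z)" using c by (simp add: bar_d3_add)
  moreover have "(\<lambda>z. c z + c' z) \<in> chains3 G" using c by (simp add: chains3_def)
  ultimately show "b \<otimes>\<^bsub>chain_group G\<^esub> b' \<in> boundaries2 G" unfolding boundaries2_def by blast
qed

text \<open>The 2-chains are free abelian on the pairs (g, h). The equalizer of the two
  homomorphisms is closed under sums and negatives, so it contains the integer multiples of basis
  chains and then, by induction on the support, every chain.\<close>

lemma chains2_hom_eqI:
  assumes fin: "finite (carrier G)" and M: "group M"
    and h1: "\<psi>1 \<in> hom (chain_group G) M" and h2: "\<psi>2 \<in> hom (chain_group G) M"
    and eq: "\<And>g h. g \<in> carrier G \<Longrightarrow> h \<in> carrier G \<Longrightarrow> \<psi>1 (single (g, h)) = \<psi>2 (single (g, h))"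
    and c: "c \<in> chains2 G"
  shows "\<psi>1 c = \<psi>2 c"
proof -
  interpret C: comm_group "chain_group G" by (rule chain_group)
  interpret M: group M by (rule M)
  interpret p1: group_hom "chain_group G" M \<psi>1 by unfold_locales (rule h1)
  interpret p2: group_hom "chain_group G" M \<psi>2 by unfold_locales (rule h2)
  let ?K = "{c \<in> chains2 G. \<psi>1 c = \<psi>2 c}"
  have add: "(\<lambda>z. c z + c' z) \<in> ?K" if "c \<in> ?K" "c' \<in> ?K" for c c'
    using that p1.hom_mult[of c c'] p2.hom_mult[of c c'] by (auto simp: chains2_def)
  have neg: "(\<lambda>z. - c z) \<in> ?K" if "c \<in> ?K" for c
    using that p1.hom_inv[of c] p2.hom_inv[of c] by (auto simp: chain_group_inv) (auto simp: chains2_def)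
  have zero: "(\<lambda>z. 0) \<in> ?K" using p1.hom_one p2.hom_one by (auto simp: chains2_def)
  have mono: "(\<lambda>w. if w = z then n else 0) \<in> ?K" if z: "z \<in> carrier G \<times> carrier G" for z and n :: int
  proof -
    have s: "single z \<in> ?K" using z eq single_chains2 by (cases z) auto
    show ?thesis
    proof (induction n rule: int_induct[where k = 0])
      case base show ?case using zero by simp
    next
      case (step1 i)
      have "(\<lambda>w. (if w = z then i else 0) + single z w) = (\<lambda>w. if w = z then i + 1 else 0)"
        by (auto simp: single_def)
      thus ?case using add[OF step1(2) s] by simp
    next
      case (step2 i)
      have "(\<lambda>w. (if w = z then i else 0) + - single z w) = (\<lambda>w. if w = z then i - 1 else 0)"
        by (auto simp: single_def)
      thus ?case using add[OF step2(2) neg[OF s]] by simp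
    qed
  qed
  have "finite F \<Longrightarrow> F \<subseteq> carrier G \<times> carrier G \<Longrightarrow> (\<forall>x. x \<notin> F \<longrightarrow> c x = 0) \<Longrightarrow> c \<in> ?K" for F c
  proof (induction F arbitrary: c rule: finite_induct)
    case empty
    hence "c = (\<lambda>z. 0)" by auto
    thus ?case using zero by simp
  next
    case (insert z F)
    have "(c(z := 0)) \<in> ?K" by (rule insert.IH) (use insert.prems in auto)
    moreover have "(\<lambda>w. if w = z then c z else 0) \<in> ?K" using insert.prems by (intro mono) auto
    ultimately have "(\<lambda>w. (c(z := 0)) w + (if w = z then c z else 0)) \<in> ?K" by (rule add)
    moreover have "(\<lambda>w. (c(z := 0)) w + (if w = z then c z else 0)) = c" by auto
    ultimately show ?case by simp
  qed
  from this[of "carrier G \<times> carrier G" c] show ?thesis using fin c by (auto simp: chains2_def)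
qed

end

section \<open>The Schur multiplier of a p-group\<close>

context group
begin

lemma lcs_two_derived: "lcs G 2 = derived G (carrier G)"
  unfolding numeral_2_eq_2 lcs.simps comm_subgroup_def derived_def ..

definition chain_class where "chain_class c = boundaries2 G #>\<^bsub>chain_group G\<^esub> c"

definition chain_quotient where "chain_quotient = chain_group G Mod boundaries2 G"

lemma chain_quotient_group: "comm_group chain_quotient"
  unfolding chain_quotient_def
  by (rule comm_group.abelian_FactGroup[OF chain_group boundaries2_subgroup])

lemma chain_class_hom: "chain_class \<in> hom (chain_group G) chain_quotient"
proof -
  interpret C: comm_group "chain_group G" by (rule chain_group)
  interpret N: normal "boundaries2 G" "chain_group G"
    by (rule C.subgroup_imp_normal[OF boundaries2_subgroup])
  show ?thesis using N.r_coset_hom_Mod by (simp add: chain_class_def[abs_def] chain_quotient_def)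
qed

lemma chain_class_boundary: "b \<in> boundaries2 G \<Longrightarrow> chain_class b = \<one>\<^bsub>chain_quotient\<^esub>"
proof -
  assume b: "b \<in> boundaries2 G"
  interpret C: comm_group "chain_group G" by (rule chain_group)
  show ?thesis
    using C.coset_join2[OF _ boundaries2_subgroup b] subgroup.mem_carrier[OF boundaries2_subgroup b]
    by (simp add: chain_class_def chain_quotient_def)
qed

text \<open>The cocycle identity for the classes [g|h] says precisely that the boundary d3[g|h|k]
  vanishes in the quotient.\<close>

lemma chain_cocycle:
  assumes fin: "finite (carrier G)"
  shows "cocycle chain_quotient G (\<lambda>g h. chain_class (single (g, h)))"
proof (intro cocycle.intro cocycle_axioms.intro chain_quotient_group is_group)
  fix g h assume "g \<in> carrier G" "h \<in> carrier G"
  thus "chain_class (single (g, h)) \<in> carrier chain_quotient"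
    using hom_in_carrier[OF chain_class_hom, of "single (g, h)"] single_chains2 by simp
next
  fix g h k assume c: "g \<in> carrier G" "h \<in> carrier G" "k \<in> carrier G"
  interpret Q: comm_group chain_quotient by (rule chain_quotient_group)
  let ?b = "bar_d3 G (single (g, h, k))"
  have "single (g, h, k) \<in> chains3 G" using c by (auto simp: chains3_def single_def)
  hence b: "?b \<in> boundaries2 G" by (simp add: boundaries2_def)
  have s: "single (h, k) \<in> chains2 G" "single (g, h \<otimes> k) \<in> chains2 G" "single (g \<otimes> h, k) \<in> chains2 G"
    "single (g, h) \<in> chains2 G" using c single_chains2 by auto
  let ?c1 = "\<lambda>z. single (h, k) z + single (g, h \<otimes> k) z"
  let ?c2 = "\<lambda>z. single (g \<otimes> h, k) z + single (g, h) z"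
  have c2: "?c2 \<in> chains2 G" using s by (simp add: chains2_def)
  have "?c1 = (\<lambda>z. ?b z + ?c2 z)" using bar_d3_single[OF fin c] by auto
  hence "chain_class ?c1 = chain_class ?b \<otimes>\<^bsub>chain_quotient\<^esub> chain_class ?c2"
    using hom_mult[OF chain_class_hom, of ?b ?c2] bar_d3_chains2 c2 by simp
  also have "\<dots> = chain_class ?c2"
    using chain_class_boundary[OF b] hom_in_carrier[OF chain_class_hom, of ?c2] c2 by simp
  finally show "chain_class (single (h, k)) \<otimes>\<^bsub>chain_quotient\<^esub> chain_class (single (g, h \<otimes> k))
      = chain_class (single (g \<otimes> h, k)) \<otimes>\<^bsub>chain_quotient\<^esub> chain_class (single (g, h))"
    using hom_mult[OF chain_class_hom, of "single (h, k)" "single (g, h \<otimes> k)"]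
      hom_mult[OF chain_class_hom, of "single (g \<otimes> h, k)" "single (g, h)"] s by simp
qed

text \<open>In the abelianization of the extension the class of \<open>[g|h]\<close> becomes
  \<open>u g \<cdot> u h \<cdot> (u (g h))\<^sup>-\<^sup>1\<close>, that is, the class of a chain \<open>c\<close> only
  depends on \<open>d2 c\<close>; so cycles lie in the commutator subgroup.\<close>

lemma cycle_in_commutator_subgroup:
  assumes fin: "finite (carrier G)" and z: "z \<in> cycles2 G"
  shows "cocycle.inc chain_quotient G (\<lambda>g h. chain_class (single (g, h))) (chain_class z)
    \<in> lcs (cocycle.ext chain_quotient G (\<lambda>g h. chain_class (single (g, h)))) 2"
proof -
  interpret K: cocycle chain_quotient G "\<lambda>g h. chain_class (single (g, h))"
    by (rule chain_cocycle[OF fin])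
  interpret E: group K.ext by (rule K.ext_group)
  define D where "D = lcs K.ext 2"
  define Ab where "Ab = K.ext Mod D"
  interpret D: normal D K.ext unfolding D_def by (rule E.lcs_normal)
  interpret Ab: comm_group Ab
    unfolding Ab_def D_def E.lcs_two_derived by (rule E.derived_quot_is_comm_group)
  define q where "q = (\<lambda>e. D #>\<^bsub>K.ext\<^esub> e)"
  have q_hom: "q \<in> hom K.ext Ab" unfolding q_def Ab_def by (rule D.r_coset_hom_Mod)
  interpret q: group_hom K.ext Ab q by unfold_locales (rule q_hom)
  define u where "u g = q (\<one>\<^bsub>chain_quotient\<^esub>, g)" for g
  have u: "u g \<in> carrier Ab" if "g \<in> carrier G" for g
    unfolding u_def using that by (intro q.hom_closed) (simp add: K.ext_carrier)
  \<comment> \<open>Linear extension of \<open>u\<close> to 1-chains. Composed with d2 it is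
    compared with the class map on the basis chains [g|h].\<close>
  define \<Phi> where "\<Phi> e = finprod Ab (\<lambda>x. u x [^]\<^bsub>Ab\<^esub> (e x :: int)) (carrier G)" for e
  have \<Phi>_closed: "\<Phi> e \<in> carrier Ab" for e
    unfolding \<Phi>_def using u by (intro Ab.finprod_closed) auto
  have \<Phi>_add: "\<Phi> (\<lambda>x. e x + e' x) = \<Phi> e \<otimes>\<^bsub>Ab\<^esub> \<Phi> e'" for e e'
  proof -
    have "\<Phi> (\<lambda>x. e x + e' x) = finprod Ab (\<lambda>x. u x [^]\<^bsub>Ab\<^esub> e x \<otimes>\<^bsub>Ab\<^esub> u x [^]\<^bsub>Ab\<^esub> e' x) (carrier G)"
      unfolding \<Phi>_def by (rule Ab.finprod_cong') (use u in \<open>auto simp: Ab.int_pow_mult\<close>)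
    also have "\<dots> = \<Phi> e \<otimes>\<^bsub>Ab\<^esub> \<Phi> e'"
      unfolding \<Phi>_def using u by (intro Ab.finprod_multf) auto
    finally show ?thesis .
  qed
  have \<Phi>_single: "\<Phi> (single g) = u g" if g: "g \<in> carrier G" for g
  proof -
    have "\<Phi> (single g) = finprod Ab (\<lambda>x. if g = x then u x else \<one>\<^bsub>Ab\<^esub>) (carrier G)"
      unfolding \<Phi>_def
    proof (rule Ab.finprod_cong')
      fix x assume "x \<in> carrier G"
      thus "u x [^]\<^bsub>Ab\<^esub> (single g x) = (if g = x then u x else \<one>\<^bsub>Ab\<^esub>)"
        using u by (simp add: single_def)
    qed (use u in auto)
    also have "\<dots> = u g" using g fin u by (intro Ab.finprod_singleton) auto
    finally show ?thesis .
  qed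
  let ?\<psi> = "\<lambda>c. q (K.inc (chain_class c))"
  let ?\<psi>2 = "\<lambda>c. \<Phi> (bar_d2 G c)"
  have cl: "chain_class c \<in> carrier chain_quotient" if "c \<in> chains2 G" for c
    using hom_in_carrier[OF chain_class_hom] that by simp
  have "?\<psi> z = ?\<psi>2 z"
  proof (rule chains2_hom_eqI[OF fin Ab.is_group])
    show "?\<psi> \<in> hom (chain_group G) Ab"
    proof -
      have "q \<circ> (K.inc \<circ> chain_class) \<in> hom (chain_group G) Ab"
        by (rule Group.hom_compose[OF Group.hom_compose[OF chain_class_hom K.inc_hom] q_hom])
      thus ?thesis by (simp add: comp_def)
    qed
    show "?\<psi>2 \<in> hom (chain_group G) Ab"
      by (rule homI) (simp_all add: \<Phi>_closed bar_d2_add \<Phi>_add)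
    show "z \<in> chains2 G" using z by (simp add: cycles2_def)
  next
    fix g h assume gh: "g \<in> carrier G" "h \<in> carrier G"
    have inc: "K.inc (chain_class (single (g, h))) \<in> carrier K.ext"
      using hom_in_carrier[OF K.inc_hom] cl single_chains2 gh by simp
    have sec: "(\<one>\<^bsub>chain_quotient\<^esub>, x) \<in> carrier K.ext" if "x \<in> carrier G" for x
      using that by (simp add: K.ext_carrier)
    \<comment> \<open>Both sides are multiplied by u(gh), so that no inverses occur: d2[g|h] + [gh]
      = [g] + [h].\<close>
    have "?\<psi> (single (g, h)) \<otimes>\<^bsub>Ab\<^esub> u (g \<otimes> h)
        = q (K.inc (chain_class (single (g, h))) \<otimes>\<^bsub>K.ext\<^esub> (\<one>\<^bsub>chain_quotient\<^esub>, g \<otimes> h))"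
      unfolding u_def using inc sec gh by (intro q.hom_mult[symmetric]) auto
    also have "\<dots> = q ((\<one>\<^bsub>chain_quotient\<^esub>, g) \<otimes>\<^bsub>K.ext\<^esub> (\<one>\<^bsub>chain_quotient\<^esub>, h))"
      unfolding K.section_mult[OF gh] ..
    also have "\<dots> = u g \<otimes>\<^bsub>Ab\<^esub> u h"
      unfolding u_def using sec gh by (intro q.hom_mult) auto
    also have "\<dots> = \<Phi> (\<lambda>x. single g x + single h x)" using gh by (simp add: \<Phi>_add \<Phi>_single)
    also have "(\<lambda>x. single g x + single h x) = (\<lambda>x. bar_d2 G (single (g, h)) x + single (g \<otimes> h) x)"
      by (simp add: bar_d2_single[OF fin gh] add.commute)
    also have "\<Phi> \<dots> = ?\<psi>2 (single (g, h)) \<otimes>\<^bsub>Ab\<^esub> u (g \<otimes> h)" using gh by (simp add: \<Phi>_add \<Phi>_single)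
    finally have e: "?\<psi> (single (g, h)) \<otimes>\<^bsub>Ab\<^esub> u (g \<otimes> h) = ?\<psi>2 (single (g, h)) \<otimes>\<^bsub>Ab\<^esub> u (g \<otimes> h)" .
    have "u (g \<otimes> h) \<in> carrier Ab" "?\<psi> (single (g, h)) \<in> carrier Ab" "?\<psi>2 (single (g, h)) \<in> carrier Ab"
      using u gh inc \<Phi>_closed by auto
    thus "?\<psi> (single (g, h)) = ?\<psi>2 (single (g, h))" using e Ab.right_cancel by blast
  qed
  also have "\<dots> = \<one>\<^bsub>Ab\<^esub>"
  proof -
    have "bar_d2 G z = (\<lambda>_. 0)" using z by (simp add: cycles2_def)
    thus ?thesis unfolding \<Phi>_def by (simp add: Ab.finprod_one)
  qed
  finally have "D #>\<^bsub>K.ext\<^esub> K.inc (chain_class z) = D" by (simp add: q_def Ab_def)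
  moreover have "K.inc (chain_class z) \<in> carrier K.ext"
    using hom_in_carrier[OF K.inc_hom] cl z by (simp add: cycles2_def)
  ultimately have "K.inc (chain_class z) \<in> D" using E.coset_join1 D.subset D.subgroup_axioms by blast
  thus ?thesis by (simp add: D_def)
qed

text \<open>Relates homology classes to cosets of the boundaries among all chains, so that counting
  the former reduces to counting values of \<open>chain_class\<close> on cycles.\<close>

lemma schur_multiplier_class:
  assumes "z \<in> cycles2 G"
  shows "{y \<in> cycles2 G. (\<lambda>x. y x - z x) \<in> boundaries2 G} = cycles2 G \<inter> chain_class z"
proof (intro equalityI subsetI)
  fix y assume y: "y \<in> {y \<in> cycles2 G. (\<lambda>x. y x - z x) \<in> boundaries2 G}"
  thus "y \<in> cycles2 G \<inter> chain_class z"
    by (auto simp: chain_class_def r_coset_def intro!: bexI[of _ "\<lambda>x. y x - z x"])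
next
  fix y assume y: "y \<in> cycles2 G \<inter> chain_class z"
  then obtain b where "b \<in> boundaries2 G" "y = (\<lambda>x. b x + z x)"
    by (auto simp: chain_class_def r_coset_def)
  thus "y \<in> {y \<in> cycles2 G. (\<lambda>x. y x - z x) \<in> boundaries2 G}" using y by auto
qed

lemma schur_order_bound:
  assumes fin: "finite (carrier G)"
  defines "E \<equiv> cocycle.ext chain_quotient G (\<lambda>g h. chain_class (single (g, h)))"
  assumes finE: "finite (lcs E 2)"
  shows "schur_order G * card (lcs G 2) \<le> card (lcs E 2)"
proof -
  interpret K: cocycle chain_quotient G "\<lambda>g h. chain_class (single (g, h))"
    by (rule chain_cocycle[OF fin])
  have E: "E = K.ext" by (simp add: E_def)
  interpret c: central_extension E G snd unfolding E by (rule K.ext_central_extension)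
  let ?I = "(\<lambda>z. K.inc (chain_class z)) ` cycles2 G"
  let ?A = "{e \<in> lcs E 2. snd e = \<one>}"
  have IA: "?I \<subseteq> ?A"
    using cycle_in_commutator_subgroup[OF fin] by (auto simp: E K.inc_def)
  have finA: "finite ?A" using finE by simp
  have finI: "finite ?I" using IA finA finite_subset by blast
  have cl: "chain_class z \<in> carrier chain_quotient" if "z \<in> cycles2 G" for z
    using hom_in_carrier[OF chain_class_hom] that by (simp add: cycles2_def)
  have inj: "inj_on K.inc (chain_class ` cycles2 G)"
    by (rule inj_onI) (use cl K.inc_inj in blast)
  have I: "?I = K.inc ` chain_class ` cycles2 G" by (simp add: image_image)
  have "schur_multiplier G = (\<lambda>z. cycles2 G \<inter> chain_class z) ` cycles2 G"
    unfolding schur_multiplier_def by (rule image_cong[OF refl]) (rule schur_multiplier_class)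
  also have "\<dots> = (\<lambda>Y. cycles2 G \<inter> Y) ` chain_class ` cycles2 G" by (simp add: image_image)
  finally have "schur_order G \<le> card (chain_class ` cycles2 G)"
    unfolding schur_order_def using finI inj I by (simp add: card_image_le finite_image_iff)
  also have "\<dots> = card ?I" unfolding I using inj by (simp add: card_image)
  also have "\<dots> \<le> card ?A" using finA IA by (rule card_mono)
  finally have "schur_order G * card (lcs G 2) \<le> card ?A * card (lcs G 2)" by simp
  also have "\<dots> = card (lcs E 2)"
    using c.pi.card_image_kernel(2)[OF c.E.lcs_subgroup[of 2]] finE c.pi.image_lcs[OF c.surj, of 2]
      finite_subset[OF lcs_carrier fin] by (simp add: mult.commute)
  finally show ?thesis .
qed

section \<open>Nilpotency of finite p-groups\<close>

text \<open>Conjugation orbits have p-power size. If the centre were trivial, {1} would be the only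
  orbit of size one, and the class equation would make p divide 1.\<close>

lemma center_nontrivial:
  assumes p: "Factorial_Ring.prime p" and card: "card (carrier G) = p ^ j" and j: "0 < j"
  shows "center G \<noteq> {\<one>}"
proof
  assume Z: "center G = {\<one>}"
  define \<phi> where "\<phi> = (\<lambda>g. \<lambda>h\<in>carrier G. g \<otimes> h \<otimes> inv g)"
  interpret act: group_action G "carrier G" \<phi> unfolding \<phi>_def by (rule action_by_conjugation)
  let ?O = "orbits G (carrier G) \<phi>"
  have fin: "finite (carrier G)"
    using card prime_gt_0_nat[OF p] by (intro card_ge_0_finite) simp
  have O: "?O = orbit G \<phi> ` carrier G" by (auto simp: orbits_def)
  have finO: "finite ?O" using fin by (simp add: O)
  have one: "orbit G \<phi> \<one> = {\<one>}"
    using act.orbit_refl[of \<one>] by (auto simp: orbit_def \<phi>_def)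
  have dvd: "p dvd card b" if b: "b \<in> ?O - {{\<one>}}" for b
  proof -
    obtain x where x: "x \<in> carrier G" "b = orbit G \<phi> x" using b by (auto simp: O)
    have "card b dvd p ^ j"
      using act.orbit_stabilizer_theorem[OF x(1)] x(2) card by (metis dvd_triv_left order_def)
    then obtain i where i: "card b = p ^ i" using divides_primepow_nat[OF p] by blast
    have "i \<noteq> 0"
    proof
      assume "i = 0"
      hence "card b = 1" using i by simp
      then obtain y where y: "b = {y}" by (auto simp: card_1_singleton_iff)
      have bx: "b = {x}" using act.orbit_refl[OF x(1)] y x(2) by auto
      have "x \<in> center G"
      proof (rule centerI[OF x(1)])
        fix g assume g: "g \<in> carrier G"
        have "\<phi> g x \<in> b" using g x by (auto simp: orbit_def)
        hence "g \<otimes> x \<otimes> inv g = x" using bx x by (simp add: \<phi>_def)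
        hence "g \<otimes> x \<otimes> inv g \<otimes> g = x \<otimes> g" by simp
        thus "x \<otimes> g = g \<otimes> x" using g x by (simp add: m_assoc)
      qed
      hence "b = {\<one>}" using Z bx by simp
      thus False using b by simp
    qed
    thus ?thesis using i by (simp add: dvd_power)
  qed
  have "{\<one>} \<in> ?O" unfolding O using one by (intro image_eqI[of _ _ \<one>]) auto
  hence "(\<Sum>b\<in>?O. card b) = 1 + (\<Sum>b\<in>?O - {{\<one>}}. card b)"
    using finO by (simp add: sum.remove)
  moreover have "(\<Sum>b\<in>?O. card b) = p ^ j"
    using act.disjoint_sum[OF fin, of "\<lambda>_. 1 :: nat"] card by simp
  moreover have "p dvd (\<Sum>b\<in>?O - {{\<one>}}. card b)" using dvd by (rule dvd_sum)
  moreover have "p dvd p ^ j" using j by (simp add: dvd_power)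
  ultimately have "p dvd 1" by (metis dvd_add_left_iff)
  thus False using p by (simp add: prime_nat_iff)
qed

text \<open>Replace \<open>N\<close> by the preimage N' of the centre of G/N, which is strictly
  larger unless N = G. Once a lower central term lies in N', its commutators with G fall into
  \<open>N\<close>. The case of trivial \<open>N\<close> is nilpotency.\<close>

lemma lcs_subset_normal:
  assumes p: "Factorial_Ring.prime p" and card: "card (carrier G) = p ^ n" and N: "N \<lhd> G"
  shows "\<exists>m. lcs G m \<subseteq> N"
  using N
proof (induction "card (carrier G) - card N" arbitrary: N rule: less_induct)
  case less
  have fin: "finite (carrier G)"
    using card prime_gt_0_nat[OF p] by (intro card_ge_0_finite) simp
  interpret N: normal N G by (rule less.prems)
  interpret Q: group "G Mod N" by (rule N.factorgroup_is_group)
  interpret f: group_hom G "G Mod N" "\<lambda>x. N #> x"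
    by (rule group_hom.intro[OF is_group Q.is_group]) (rule group_hom_axioms.intro[OF N.r_coset_hom_Mod])
  have f1: "N #> x = \<one>\<^bsub>G Mod N\<^esub> \<longleftrightarrow> x \<in> N" if "x \<in> carrier G" for x
    using coset_join1[OF _ that N.subgroup_axioms] coset_join2[OF that N.subgroup_axioms] by auto
  show ?case
  proof (cases "N = carrier G")
    case True thus ?thesis by (intro exI[of _ 0]) simp
  next
    case False
    have "card (carrier (G Mod N)) * card N = p ^ n"
      using lagrange[OF N.subgroup_axioms] card by (simp add: FactGroup_def order_def)
    hence "card (carrier (G Mod N)) dvd p ^ n" by (metis dvd_triv_left)
    then obtain j where j: "card (carrier (G Mod N)) = p ^ j" using divides_primepow_nat[OF p] by blast
    have "j \<noteq> 0"
    proof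
      assume "j = 0"
      hence "card N = card (carrier G)"
        using \<open>card (carrier (G Mod N)) * card N = p ^ n\<close> j card by simp
      hence "N = carrier G" using N.subset fin card_subset_eq by blast
      thus False using False by simp
    qed
    hence "center (G Mod N) \<noteq> {\<one>\<^bsub>G Mod N\<^esub>}" using Q.center_nontrivial[OF p j] by simp
    then obtain c where c: "c \<in> center (G Mod N)" "c \<noteq> \<one>\<^bsub>G Mod N\<^esub>"
      using subgroup.one_closed[OF Q.center_subgroup] by blast
    define N' where "N' = {x \<in> carrier G. N #> x \<in> center (G Mod N)}"
    interpret ZQ: subgroup "center (G Mod N)" "G Mod N" by (rule Q.center_subgroup)
    have "subgroup N' G"
    proof (rule subgroupI)
      show "N' \<subseteq> carrier G" by (auto simp: N'_def)
      have "\<one> \<in> N'" using f.hom_one ZQ.one_closed by (simp add: N'_def)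
      thus "N' \<noteq> {}" by blast
    next
      fix a assume "a \<in> N'"
      thus "inv a \<in> N'" using f.hom_inv[of a] ZQ.m_inv_closed unfolding N'_def by simp
    next
      fix a b assume "a \<in> N'" "b \<in> N'"
      thus "a \<otimes> b \<in> N'" using f.hom_mult[of a b] ZQ.m_closed unfolding N'_def by simp
    qed
    moreover have "g \<otimes> a \<otimes> inv g \<in> N'" if "g \<in> carrier G" "a \<in> N'" for g a
    proof -
      have a: "a \<in> carrier G" "N #> a \<in> center (G Mod N)" using that by (auto simp: N'_def)
      have "N #> (g \<otimes> a \<otimes> inv g) = (N #> g) \<otimes>\<^bsub>G Mod N\<^esub> (N #> a) \<otimes>\<^bsub>G Mod N\<^esub> inv\<^bsub>G Mod N\<^esub> (N #> g)"
        using that(1) a f.hom_mult[of "g \<otimes> a" "inv g"] f.hom_mult[of g a] f.hom_inv[of g]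
        by (simp only: m_closed inv_closed)
      also have "\<dots> = N #> a" using a that(1) f.hom_closed[of g] by (intro Q.conj_center)
      finally show ?thesis using a that(1) by (simp add: N'_def)
    qed
    ultimately have N': "N' \<lhd> G" by (intro normal_invI)
    have "N \<subseteq> N'"
    proof
      fix x assume x: "x \<in> N"
      hence "N #> x = \<one>\<^bsub>G Mod N\<^esub>" using f1 N.subset by blast
      thus "x \<in> N'" using ZQ.one_closed x N.subset by (auto simp only: N'_def)
    qed
    moreover have "N \<noteq> N'"
    proof -
      obtain x where x: "x \<in> carrier G" "c = N #> x" using c(1) ZQ.subset by (auto simp: carrier_FactGroup)
      hence "x \<in> N'" "x \<notin> N" using c f1[OF x(1)] by (auto simp only: N'_def)
      thus ?thesis by blast
    qed
    moreover have N'G: "N' \<subseteq> carrier G" by (auto simp: N'_def)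
    ultimately have "card N < card N'" "card N' \<le> card (carrier G)"
      using fin by (auto intro!: psubset_card_mono card_mono intro: finite_subset)
    hence "card (carrier G) - card N' < card (carrier G) - card N" by simp
    then obtain m where m: "lcs G m \<subseteq> N'" using less.hyps[OF _ N'] by blast
    \<comment> \<open>The index is raised first because \<open>m\<close> may be 0, where the
      recursion \<open>lcs_Suc\<close> does not apply.\<close>
    hence mS: "lcs G (Suc m) \<subseteq> N'" using lcs_Suc_subset by blast
    have "lcs G (Suc (Suc m)) = comm_subgroup G (lcs G (Suc m)) (carrier G)" by (simp add: lcs_Suc)
    also have "\<dots> \<subseteq> N"
    proof (rule comm_subgroup_least[OF N.subgroup_axioms])
      fix a b assume ab: "a \<in> lcs G (Suc m)" "b \<in> carrier G"
      have a: "a \<in> carrier G" "N #> a \<in> center (G Mod N)" using ab mS by (auto simp: N'_def)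
      have "N #> commutator G a b = commutator (G Mod N) (N #> a) (N #> b)"
        using a ab by (intro f.hom_commutator)
      also have "\<dots> = \<one>\<^bsub>G Mod N\<^esub>" using a ab f.hom_closed by (intro Q.commutator_center_left)
      finally show "commutator G a b \<in> N" using f1 a ab by simp
    qed
    finally show ?thesis by blast
  qed
qed

lemma lcs_eventually_trivial:
  assumes "Factorial_Ring.prime p" "card (carrier G) = p ^ n"
  shows "\<exists>m. lcs G m = {\<one>}"
proof -
  obtain m where "lcs G m \<subseteq> {\<one>}" using lcs_subset_normal[OF assms one_is_normal] by blast
  hence "lcs G m = {\<one>}" using subgroup.one_closed[OF lcs_subgroup[of m]] by blast
  thus ?thesis by blast
qed

section \<open>Minimal generating sets and their lifts\<close>

lemma min_gens_attained:
  assumes "finite (carrier G)"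
  obtains S where "S \<subseteq> carrier G" "finite S" "card S = min_gens G" "generate G S = carrier G"
proof -
  let ?P = "\<lambda>n. \<exists>S. S \<subseteq> carrier G \<and> finite S \<and> card S = n \<and> generate G S = carrier G"
  have "generate G (carrier G) = carrier G" using generateI[OF subgroup_self] by blast
  hence "?P (card (carrier G))" using assms by blast
  hence "?P (min_gens G)" unfolding min_gens_def by (rule LeastI)
  thus ?thesis using that by blast
qed

lemma generators_mod_center:
  assumes fin: "finite (carrier G)"
  obtains x :: "nat \<Rightarrow> 'a" where "range x \<subseteq> carrier G"
    "generate G (center G \<union> x ` {..<min_gens (G Mod center G)}) = carrier G"
proof -
  let ?Z = "center G" and ?\<delta> = "min_gens (G Mod center G)"
  interpret Z: normal ?Z G by (rule center_normal)
  interpret Q: group "G Mod ?Z" by (rule Z.factorgroup_is_group)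
  interpret f: group_hom G "G Mod ?Z" "\<lambda>x. ?Z #> x"
    by (rule group_hom.intro[OF is_group Q.is_group]) (rule group_hom_axioms.intro[OF Z.r_coset_hom_Mod])
  have "finite (carrier (G Mod ?Z))" using fin by (simp add: carrier_FactGroup)
  then obtain S where S: "S \<subseteq> carrier (G Mod ?Z)" "finite S" "card S = ?\<delta>"
      "generate (G Mod ?Z) S = carrier (G Mod ?Z)"
    by (rule Q.min_gens_attained)
  obtain h where h: "bij_betw h {0..<card S} S" using ex_bij_betw_nat_finite[OF S(2)] by blast
  \<comment> \<open>For j outside the range any element of G will do; the pairings expect a sequence
    in G indexed by all naturals.\<close>
  have "\<forall>j. \<exists>y. y \<in> carrier G \<and> (j < ?\<delta> \<longrightarrow> ?Z #> y = h j)"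
  proof
    fix j
    show "\<exists>y. y \<in> carrier G \<and> (j < ?\<delta> \<longrightarrow> ?Z #> y = h j)"
    proof (cases "j < ?\<delta>")
      case True
      hence "h j \<in> carrier (G Mod ?Z)" using h S by (auto simp: bij_betw_def)
      thus ?thesis by (auto simp: carrier_FactGroup)
    qed auto
  qed
  then obtain x where x: "\<And>j. x j \<in> carrier G" "\<And>j. j < ?\<delta> \<Longrightarrow> ?Z #> x j = h j" by metis
  have Sx: "S = (\<lambda>x. ?Z #> x) ` x ` {..<?\<delta>}"
  proof -
    have "S = h ` {..<?\<delta>}" using h S(3) by (auto simp: bij_betw_def atLeast0LessThan)
    also have "\<dots> = (\<lambda>j. ?Z #> x j) ` {..<?\<delta>}" using x(2) by (intro image_cong) auto
    finally show ?thesis by (simp add: image_image)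
  qed
  have sub: "x ` {..<?\<delta>} \<subseteq> carrier G" using x by auto
  have subZ: "?Z \<union> x ` {..<?\<delta>} \<subseteq> carrier G" using x Z.subset by auto
  interpret U: subgroup "generate G (?Z \<union> x ` {..<?\<delta>})" G by (rule generate_is_subgroup[OF subZ])
  have "carrier G \<subseteq> generate G (?Z \<union> x ` {..<?\<delta>})"
  proof
    fix g assume g: "g \<in> carrier G"
    have "?Z #> g \<in> generate (G Mod ?Z) S" using g S(4) by simp
    hence "?Z #> g \<in> (\<lambda>x. ?Z #> x) ` generate G (x ` {..<?\<delta>})"
      unfolding Sx using f.generate_img[OF sub] by simp
    then obtain k where k: "k \<in> generate G (x ` {..<?\<delta>})" "?Z #> g = ?Z #> k" by blast
    have kU: "k \<in> generate G (?Z \<union> x ` {..<?\<delta>})" using k(1) mono_generate[of "x ` {..<?\<delta>}"] by blast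
    have "g \<in> ?Z #> k" using rcos_self[OF g Z.subgroup_axioms] k(2) by simp
    then obtain z where "z \<in> ?Z" "g = z \<otimes> k" by (auto simp: r_coset_def)
    thus "g \<in> generate G (?Z \<union> x ` {..<?\<delta>})" using kU by (auto intro: generate.incl)
  qed
  hence "generate G (?Z \<union> x ` {..<?\<delta>}) = carrier G" using U.subset by blast
  moreover have "range x \<subseteq> carrier G" using x by auto
  ultimately show ?thesis using that by blast
qed

end

section \<open>Assembling the exponent\<close>

theorem theorem3p3:
  fixes G :: "('a, 'b) monoid_scheme" and p n k r t :: nat
  assumes "group G"
    and "Factorial_Ring.prime p"
    and "finite (carrier G)"
    and "card (carrier G) = p ^ n"
    and "card (lcs G 2) = p ^ k"
    and "int (min_gens (G Mod center G) choose 2)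
           - int (min_gens ((G\<lparr>carrier := lcs G 2\<rparr>) Mod lcs G 3))
         = int (r choose 2) + int t"
    and "t < r"
  shows "real (schur_order G) \<le> real p powr
          ((1/2) * (real (min_gens G) - 1) * (real n + real k)
           - real k * (real (min_gens G) - real (min_gens (G Mod center G)))
           - real (min_gens (G Mod center G) choose 3)
           + real (r choose 3) + real (t choose 2))"
proof -
  interpret group G by fact
  note p = assms(2) and fin = assms(3) and n = assms(4) and k = assms(5)
  define d where "d = min_gens G"
  define \<delta> where "\<delta> = min_gens (G Mod center G)"
  define M where "M = schur_order G"
  define E where "E = cocycle.ext chain_quotient G (\<lambda>g h. chain_class (single (g, h)))"
  interpret central_extension E G snd
    unfolding E_def by (rule cocycle.ext_central_extension[OF chain_cocycle[OF fin]])
  obtain S where S: "S \<subseteq> carrier G" "finite S" "card S = d" "generate G S = carrier G"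
    unfolding d_def by (rule min_gens_attained[OF fin])
  obtain x :: "nat \<Rightarrow> 'a" where "range x \<subseteq> carrier G"
      and gen: "generate G (center G \<union> x ` {..<\<delta>}) = carrier G"
    unfolding \<delta>_def by (rule generators_mod_center[OF fin])
  hence xG: "\<And>j. x j \<in> carrier G" by auto
  obtain m where m: "lcs G m = {\<one>\<^bsub>G\<^esub>}" using lcs_eventually_trivial[OF p n] by blast
  have rt: "\<delta> choose 2 = min_gens (G\<lparr>carrier := lcs G 2\<rparr> Mod lcs G 3) + (r choose 2) + t"
    using assms(6) unfolding \<delta>_def by linarith
  obtain s where s: "\<delta> choose 3 \<le> s + (r choose 3) + (t choose 2)" and finE: "finite (lcs E 2)"
    and b: "(card (lcs E 2) * p ^ s)\<^sup>2 * p ^ (k * (d - 1)) \<le> p ^ (n * (d - 1) + 2 * (k * \<delta>))"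
    using card_lcs_two_bound[OF fin p n k S(2,1,4) xG gen m rt assms(7)] S(3) by blast
  have "M * p ^ k \<le> card (lcs E 2)"
    using schur_order_bound[OF fin] finE k by (simp add: M_def E_def)
  hence "(M * p ^ k * p ^ s)\<^sup>2 * p ^ (k * (d - 1)) \<le> (card (lcs E 2) * p ^ s)\<^sup>2 * p ^ (k * (d - 1))"
    by (intro mult_le_mono power_mono) auto
  also note b
  also have "(M * p ^ k * p ^ s)\<^sup>2 * p ^ (k * (d - 1)) = M\<^sup>2 * p ^ (2 * k + 2 * s + k * (d - 1))"
    by (simp add: power_mult_distrib power_add power_even_eq mult.assoc)
  finally have "M\<^sup>2 * p ^ (2 * k + 2 * s + k * (d - 1)) \<le> p ^ (n * (d - 1) + 2 * (k * \<delta>))" .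
  hence "real (M\<^sup>2 * p ^ (2 * k + 2 * s + k * (d - 1))) \<le> real (p ^ (n * (d - 1) + 2 * (k * \<delta>)))"
    by (simp only: of_nat_le_iff)
  hence le: "(real M)\<^sup>2 * real p ^ (2 * k + 2 * s + k * (d - 1)) \<le> real p ^ (n * (d - 1) + 2 * (k * \<delta>))"
    by simp
  have p1: "1 < real p" using prime_gt_1_nat[OF p] by simp
  define j where "j = d - 1"
  \<comment> \<open>Half the difference of the two exponents in \<open>le\<close>. It matches the
    claimed exponent with s in place of binom(delta,3) - binom(r,3) - binom(t,2).\<close>
  define e where "e = (1/2) * (real n - real k) * real j + real k * real \<delta> - real k - real s"
  have "(real M)\<^sup>2 \<le> real p ^ (n * j + 2 * (k * \<delta>)) / real p ^ (2 * k + 2 * s + k * j)"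
    using le p1 by (simp add: pos_le_divide_eq j_def)
  also have "\<dots> = real p powr (real (n * j + 2 * (k * \<delta>)) - real (2 * k + 2 * s + k * j))"
    using p1 by (simp only: powr_diff powr_realpow)
  also have "real (n * j + 2 * (k * \<delta>)) - real (2 * k + 2 * s + k * j) = 2 * e"
    by (simp add: e_def left_diff_distrib right_diff_distrib distrib_left)
  also have "real p powr (2 * e) = (real p powr e)\<^sup>2"
    using p1 by (simp add: power2_eq_square powr_add[symmetric])
  finally have "real M \<le> real p powr e" by (rule power2_le_imp_le) simp
  moreover have "e \<le> (1/2) * (real d - 1) * (real n + real k) - real k * (real d - real \<delta>)
      - real (\<delta> choose 3) + real (r choose 3) + real (t choose 2)"
  proof -
    have "real (\<delta> choose 3) \<le> real s + real (r choose 3) + real (t choose 2)" using s by linarith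
    \<comment> \<open>Truncated subtraction: for d = 0 the number j is 0 while
      \<open>real d - 1\<close> is -1. Then G is trivial, n = k = 0, and both sides vanish.\<close>
    moreover have "(real n - real k) * real j = (real n - real k) * (real d - 1)"
    proof (cases "d = 0")
      case True
      hence "S = {}" using S by simp
      hence "carrier G = {\<one>\<^bsub>G\<^esub>}" using S(4) generate_empty by simp
      moreover from this have "lcs G 2 = {\<one>\<^bsub>G\<^esub>}"
        using lcs_carrier[of 2] subgroup.one_closed[OF lcs_subgroup[of 2]] by blast
      ultimately have "p ^ n = 1" "p ^ k = 1" using n k by simp_all
      hence "n = 0" "k = 0" using prime_gt_1_nat[OF p] by (auto simp: power_eq_1_iff)
      thus ?thesis by simp
    qed (simp add: j_def)
    hence "e = (1/2) * ((real n - real k) * (real d - 1)) + real k * real \<delta> - real k - real s"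
      by (simp add: e_def)
    moreover have "(1/2) * (real d - 1) * (real n + real k) - real k * (real d - real \<delta>)
        = (1/2) * ((real n - real k) * (real d - 1)) + real k * real \<delta> - real k"
      by (simp add: field_simps)
    ultimately show ?thesis by linarith
  qed
  ultimately have "real M \<le> real p powr ((1/2) * (real d - 1) * (real n + real k)
      - real k * (real d - real \<delta>) - real (\<delta> choose 3) + real (r choose 3) + real (t choose 2))"
    using p1 by (meson less_imp_le order_trans powr_mono)
  thus ?thesis by (simp only: M_def d_def \<delta>_def)
qed

end
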